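(* Let $E=\bigoplus_{\lambda\in\mathrm{Young}(n-2,2)}\mathbb{S}^\lambda\mathcal{W}$ on $\mathrm{Gr}(n,2)$ and let $A=\operatorname{End}(E)$. Let $Q$ be the tilting quiver of $\mathrm{Gr}(n,2)$. Then the $\Bbbk$-algebra $A$ is isomorphic to $\Bbbk Q/I$, where $I$ is the two-sided ideal generated by $$\bigcup_{(\lambda,\mu)\in P_2}K_{\lambda,\mu},\qquad P_2=\{(\lambda,\mu)\in Q_0^2\mid \lambda<\mu,\ |\mu|=|\lambda|+2\},$$ and the sets $K_{\lambda,\mu}\subset\Bbbk Q$ are as follows: (i) if $\mu=(\lambda_1+2,\lambda_2)$, then $K_{\lambda,\mu}=\{f_{u_j}f^\lambda_{u_i}-f_{u_i}f^\lambda_{u_j}\mid 1\le i,j\le n\}$; (ii) if $\mu=(\lambda_1,\lambda_2+2)$, then $K_{\lambda,\mu}=\{g_{u_j}g^\lambda_{u_i}-g_{u_i}g^\lambda_{u_j}\mid 1\le i,j\le n\}$; (iii) if $\lambda_1=\lambda_2$ and $\mu=(\lambda_1+1,\lambda_1+1)$, then $K_{\lambda,\mu}=\{g_{u_j}f^\lambda_{u_i}+g_{u_i}f^\lambda_{u_j}\mid 1\le i,j\le n\}$; (iv) if $\lambda_1>\lambda_2$ and $\mu=(\lambda_1+1,\lambda_2+1)$, then $$K_{\lambda,\mu}=\{(\lambda_1-\lambda_2)\,g_{u_j}f^\lambda_{u_i}-(\lambda_1-\lambda_2+1)\,f_{u_i}g^\lambda_{u_j}+f_{u_j}g^\lambda_{u_i}\mid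 1\le i,j\le n\}.$$
   Context: Let $\Bbbk$ be an algebraically closed field of characteristic zero, $n\ge4$, $V=\Bbbk^n$ with a fixed basis $u_1,\dots,u_n$. $\mathrm{Gr}(n,2)$ is the Grassmannian of $2$-dimensional quotients of $V$, and $\mathcal{W}$ is its rank $2$ tautological quotient bundle. $\mathrm{Young}(n-2,2)=\{\lambda\in\mathbb{Z}^2\mid n-2\ge\lambda_1\ge\lambda_2\ge0\}$; $|\lambda|=\lambda_1+\lambda_2$; $\lambda\le\mu$ means $\lambda_i\le\mu_i$ for $i=1,2$, and $\lambda<\mu$ means moreover $\lambda\neq\mu$; $e_1,e_2$ is the standard basis of $\mathbb{Z}^2$. $\mathbb{S}^\lambda\mathcal{W}$ is the Schur power of $\mathcal{W}$, i.e. the vector bundle whose fibre at each point is the irreducible $\mathrm{GL}(2)$-module of highest weight $\lambda$ (so $\mathbb{S}^\lambda\mathcal{W}\cong(\bigwedge^2\mathcal{W})^{\otimes\lambda_2}\otimes\mathrm{Sym}^{\lambda_1-\lambda_2}\mathcal{W}$). The tilting quiver $Q$ has vertex set $Q_0=\mathrm{Young}(n-2,2)$ and, for every $i\in\{1,2\}$ and $\lambda$ with $\lambda,\lambda+e_i\in Q_0$, exactly $n$ arrows $a^{\lambda,i}_1,\dots,a^{\lambda,i}_n$ with tail $\lambda$ and head $\lambda+e_i$. $\Bbbk Q$ is the path algebra; paths are composed from right to left (the rightmost arrow is traversed first), like composition of maps in $\operatorname{End}(E)$. Notation: the arrow $a^{\lambda,1}_\rho$ is denoted $f^\lambda_{u_\rho}$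 and the arrow $a^{\lambda,2}_\rho$ is denoted $g^\lambda_{u_\rho}$. In a path only the first (rightmost) arrow carries its superscript (its tail); the superscripts of the subsequent arrows are omitted, since they are determined by the heads of the preceding arrows (an $f$-arrow adds $e_1$, a $g$-arrow adds $e_2$). *)

theory Defs
  imports
    "HOL-Analysis.Analysis"
    "HOL-Algebra.QuotRing"
    "HOL-Algebra.Module"
    "HOL-Computational_Algebra.Polynomial"
    "Graph_Theory.Arc_Walk"
begin

section \<open>The Grassmannian of two-dimensional quotients\<close>

text \<open>
  $V = k^n$ is the type \<open>'a ^ 'n\<close> with basis $u_\rho$ = \<open>axis \<rho> 1\<close>, so $n$ is \<open>CARD('n)\<close>.
  A two-dimensional quotient of $V$ is represented by its kernel $K$, the quotient itself
  being $V/K$.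
\<close>

definition grassmannian :: "('a::field ^ 'n) set set" where
  "grassmannian = {K. vec.subspace K \<and> vec.dim K + 2 = CARD('n)}"

definition has_frame_coords ::
    "'n \<times> 'n \<Rightarrow> ('a::field ^ 'n) set \<Rightarrow> 'a ^ 'n \<Rightarrow> 'a \<times> 'a \<Rightarrow> bool" where
  "has_frame_coords c K v p \<longleftrightarrow>
     v - (fst p *s axis (fst c) 1 + snd p *s axis (snd c) 1) \<in> K"

text \<open>
  The standard affine chart with index $c = (i,j)$ is the open set of all $K$ such that the
  classes of $u_i, u_j$ form a basis of $V/K$.
\<close>

definition chart :: "'n \<times> 'n \<Rightarrow> ('a::field ^ 'n) set set" where
  "chart c = {K \<in> grassmannian. \<forall>v. \<exists>!p. has_frame_coords c K v p}"

text \<open>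
  The first (\<open>a = 1\<close>) and second (\<open>a = 2\<close>) coordinate of the class of $v$ in $V/K$ with
  respect to the basis given by the classes of $u_i, u_j$.
\<close>

definition frame_coord :: "'n \<times> 'n \<Rightarrow> ('a::field ^ 'n) set \<Rightarrow> 'a ^ 'n \<Rightarrow> nat \<Rightarrow> 'a" where
  "frame_coord c K v a =
     (let p = (THE p. has_frame_coords c K v p) in if a = 1 then fst p else snd p)"

text \<open>
  The coordinates of the classes of the basis vectors $u_\rho$ (those of $u_i, u_j$ being
  constant) identify the chart with the affine space of dimension $2(n-2)$; hence the regular
  functions on the chart are the polynomials in these coordinates.
\<close>

inductive_set chart_polys :: "'n \<times> 'n \<Rightarrow> (('a::field ^ 'n) set \<Rightarrow> 'a) set"
  for c :: "'n \<times> 'n" where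
  const: "(\<lambda>_. x) \<in> chart_polys c"
| coord: "(\<lambda>K. frame_coord c K (axis \<rho> 1) a) \<in> chart_polys c"
| add: "p \<in> chart_polys c \<Longrightarrow> q \<in> chart_polys c \<Longrightarrow> (\<lambda>K. p K + q K) \<in> chart_polys c"
| mult: "p \<in> chart_polys c \<Longrightarrow> q \<in> chart_polys c \<Longrightarrow> (\<lambda>K. p K * q K) \<in> chart_polys c"

definition regular_on_chart :: "'n \<times> 'n \<Rightarrow> (('a::field ^ 'n) set \<Rightarrow> 'a) \<Rightarrow> bool" where
  "regular_on_chart c h \<longleftrightarrow> (\<exists>p \<in> chart_polys c. \<forall>K \<in> chart c. h K = p K)"


section \<open>Vector bundles\<close>

text \<open>
  A vector bundle on the Grassmannian which is trivial on the standard charts is given by the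
  index set \<open>frame_ix\<close> of its local frames and by its transition matrices: \<open>transition B c d K a b\<close>
  is the coefficient of the \<open>a\<close>-th vector of the frame over \<open>chart c\<close> in the expansion of the
  \<open>b\<close>-th vector of the frame over \<open>chart d\<close>, at the point \<open>K\<close> of \<open>chart c \<inter> chart d\<close>.
\<close>

record ('a, 'n, 'b) vec_bundle =
  frame_ix :: "'b set"
  transition :: "'n \<times> 'n \<Rightarrow> 'n \<times> 'n \<Rightarrow> ('a ^ 'n) set \<Rightarrow> 'b \<Rightarrow> 'b \<Rightarrow> 'a"

text \<open>
  The bundle $\mathcal{W}$ with fibre $V/K$ at $K$, and with local frame
  the classes of $u_i, u_j$ over the chart $(i,j)$.
\<close>

definition taut_quotient_bundle :: "('a::field, 'n::finite, nat) vec_bundle" where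
  "taut_quotient_bundle =
     \<lparr>frame_ix = {1, 2},
      transition = (\<lambda>c d K a b. frame_coord c K (axis (if b = 1 then fst d else snd d) 1) a)\<rparr>"

text \<open>
  The matrix by which the linear map \<open>g\<close> of $k^2$ acts on
  $(\bigwedge^2 k^2)^{\otimes\lambda_2} \otimes \mathrm{Sym}^d k^2$, $d = \lambda_1 - \lambda_2$, in
  the basis $w_1^{d-b} w_2^b$ ($0 \le b \le d$) of $\mathrm{Sym}^d k^2$.
  The symmetric algebra of $k^2$ is dehomogenised by $w_1 = 1$, so \<open>[:g 1 1, g 2 1:]\<close> is
  the image of $w_1$ and \<open>[:g 1 2, g 2 2:]\<close> the image of $w_2$.
\<close>

definition schur_matrix ::
    "nat \<times> nat \<Rightarrow> (nat \<Rightarrow> nat \<Rightarrow> 'a::field) \<Rightarrow> nat \<Rightarrow> nat \<Rightarrow> 'a" where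
  "schur_matrix lam g a b =
     (g 1 1 * g 2 2 - g 1 2 * g 2 1) ^ snd lam *
     coeff ([:g 1 1, g 2 1:] ^ (fst lam - snd lam - b) * [:g 1 2, g 2 2:] ^ b) a"

definition schur_bundle ::
    "nat \<times> nat \<Rightarrow> ('a::field, 'n::finite, nat) vec_bundle \<Rightarrow> ('a, 'n, nat) vec_bundle" where
  "schur_bundle lam W =
     \<lparr>frame_ix = {.. fst lam - snd lam},
      transition = (\<lambda>c d K. schur_matrix lam (transition W c d K))\<rparr>"

definition direct_sum_bundle ::
    "'l set \<Rightarrow> ('l \<Rightarrow> ('a::field, 'n::finite, 'b) vec_bundle) \<Rightarrow> ('a, 'n, 'l \<times> 'b) vec_bundle" where
  "direct_sum_bundle L B =
     \<lparr>frame_ix = Sigma L (\<lambda>l. frame_ix (B l)),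
      transition = (\<lambda>c d K x y.
        if fst x = fst y then transition (B (fst x)) c d K (snd x) (snd y) else 0)\<rparr>"

text \<open>
  A global endomorphism is a family of matrices \<open>\<phi> c K\<close> (the matrix of the endomorphism of
  the fibre at \<open>K\<close> in the frame over \<open>chart c\<close>, acting on columns) that depend regularly on
  \<open>K\<close> and are compatible with the change of frames. All values outside the domain are set
  to 0 so that equality of endomorphisms is equality of functions.
\<close>

type_synonym ('a, 'n, 'b) local_matrices =
  "'n \<times> 'n \<Rightarrow> ('a ^ 'n) set \<Rightarrow> 'b \<Rightarrow> 'b \<Rightarrow> 'a"

definition bundle_endos ::
    "('a::field, 'n::finite, 'b) vec_bundle \<Rightarrow> ('a, 'n, 'b) local_matrices set" where
  "bundle_endos B =
     {\<phi>. (\<forall>c a b. regular_on_chart c (\<lambda>K. \<phi> c K a b)) \<and>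
         (\<forall>c d. \<forall>K \<in> chart c \<inter> chart d. \<forall>a \<in> frame_ix B. \<forall>b \<in> frame_ix B.
            (\<Sum>m \<in> frame_ix B. \<phi> c K a m * transition B c d K m b) =
            (\<Sum>m \<in> frame_ix B. transition B c d K a m * \<phi> d K m b)) \<and>
         (\<forall>c K a b. \<phi> c K a b \<noteq> 0 \<longrightarrow> K \<in> chart c \<and> a \<in> frame_ix B \<and> b \<in> frame_ix B)}"

text \<open>
  A (not necessarily commutative) $k$-algebra is rendered by the record type \<open>module\<close>, which
  extends the ring operations by a scalar multiplication.
\<close>

definition End_algebra ::
    "('a::field, 'n::finite, 'b) vec_bundle \<Rightarrow> ('a, ('a, 'n, 'b) local_matrices) module" where
  "End_algebra B =
     \<lparr>carrier = bundle_endos B,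
      mult = (\<lambda>\<phi> \<psi> c K a b. \<Sum>m \<in> frame_ix B. \<phi> c K a m * \<psi> c K m b),
      one = (\<lambda>c K a b. if K \<in> chart c \<and> a \<in> frame_ix B \<and> a = b then 1 else 0),
      zero = (\<lambda>c K a b. 0),
      add = (\<lambda>\<phi> \<psi> c K a b. \<phi> c K a b + \<psi> c K a b),
      smult = (\<lambda>s \<phi> c K a b. s * \<phi> c K a b)\<rparr>"


section \<open>Path algebras, quotients and isomorphisms of algebras\<close>

text \<open>
  A path is a pair of its start vertex and the list of its arrows in the order in which they
  are traversed. Elements of the path algebra are finitely supported functions on paths.
  In a product the right factor is traversed first.
\<close>

definition quiver_paths :: "('v, 'e) pre_digraph \<Rightarrow> ('v \<times> 'e list) set" where
  "quiver_paths Q = {(u, p). \<exists>v. pre_digraph.awalk Q u p v}"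

definition path_algebra ::
    "('v, 'e) pre_digraph \<Rightarrow> ('a::field, 'v \<times> 'e list \<Rightarrow> 'a) module" where
  "path_algebra Q =
     \<lparr>carrier = {x. finite {\<pi>. x \<pi> \<noteq> 0} \<and> {\<pi>. x \<pi> \<noteq> 0} \<subseteq> quiver_paths Q},
      mult = (\<lambda>x y (u, p). \<Sum>k \<le> length p.
        x (pre_digraph.awlast Q u (take k p), drop k p) * y (u, take k p)),
      one = (\<lambda>(u, p). if u \<in> verts Q \<and> p = [] then 1 else 0),
      zero = (\<lambda>_. 0),
      add = (\<lambda>x y \<pi>. x \<pi> + y \<pi>),
      smult = (\<lambda>s x \<pi>. s * x \<pi>)\<rparr>"

definition arrow :: "('v, 'e) pre_digraph \<Rightarrow> 'e \<Rightarrow> 'v \<times> 'e list \<Rightarrow> 'a::field" where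
  "arrow Q e = (\<lambda>\<pi>. if \<pi> = (tail Q e, [e]) then 1 else 0)"

definition quotient_algebra :: "('a, 'b) module \<Rightarrow> 'b set \<Rightarrow> ('a, 'b set) module" where
  "quotient_algebra P I =
     ring.extend (P Quot I) (module.fields (\<lambda>s X. \<Union>x \<in> X. I +>\<^bsub>P\<^esub> (s \<odot>\<^bsub>P\<^esub> x)))"

definition algebra_isomorphic :: "('a, 'b) module \<Rightarrow> ('a, 'c) module \<Rightarrow> bool" where
  "algebra_isomorphic A B \<longleftrightarrow>
     (\<exists>h \<in> ring_iso A B. \<forall>s. \<forall>x \<in> carrier A. h (s \<odot>\<^bsub>A\<^esub> x) = s \<odot>\<^bsub>B\<^esub> h x)"


section \<open>The tilting bundle and the tilting quiver\<close>

text \<open>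
  \<open>young m\<close> is the set $\mathrm{Young}(m,2)$; as its elements have nonnegative entries, they
  are taken in \<open>nat \<times> nat\<close>. Throughout, \<open>lam\<close> stands for $\lambda$.
\<close>

definition young :: "nat \<Rightarrow> (nat \<times> nat) set" where
  "young m = {lam. m \<ge> fst lam \<and> fst lam \<ge> snd lam}"

definition tilting_bundle :: "('a::field, 'n::finite, (nat \<times> nat) \<times> nat) vec_bundle" where
  "tilting_bundle =
     direct_sum_bundle (young (CARD('n) - 2)) (\<lambda>lam. schur_bundle lam taut_quotient_bundle)"

definition add_e :: "nat \<times> nat \<Rightarrow> nat \<Rightarrow> nat \<times> nat" where
  "add_e lam i = (if i = 1 then (fst lam + 1, snd lam) else (fst lam, snd lam + 1))"

text \<open>The arrow $a^{\lambda,i}_\rho$ is the triple \<open>(lam, i, \<rho>)\<close>.\<close>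

definition tilting_quiver :: "(nat \<times> nat, (nat \<times> nat) \<times> nat \<times> 'n::finite) pre_digraph" where
  "tilting_quiver =
     \<lparr>verts = young (CARD('n) - 2),
      arcs = {(lam, i, \<rho>). lam \<in> young (CARD('n) - 2) \<and> i \<in> {1, 2} \<and>
                        add_e lam i \<in> young (CARD('n) - 2)},
      tail = (\<lambda>(lam, i, \<rho>). lam),
      head = (\<lambda>(lam, i, \<rho>). add_e lam i)\<rparr>"

type_synonym ('a, 'n) path_element =
  "(nat \<times> nat) \<times> ((nat \<times> nat) \<times> nat \<times> 'n) list \<Rightarrow> 'a"

definition tilting_path_algebra ::
    "('a::field, ('a, 'n::finite) path_element) module" where
  "tilting_path_algebra = path_algebra tilting_quiver"

text \<open>
  \<open>farr lam \<rho>\<close> is $f^\lambda_{u_\rho}$ and \<open>garr lam \<rho>\<close> is $g^\lambda_{u_\rho}$; the tail, left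
  implicit in the usual notation for the later arrows of a path, is always given.
\<close>

definition farr :: "nat \<times> nat \<Rightarrow> 'n::finite \<Rightarrow> ('a::field, 'n) path_element" where
  "farr lam \<rho> = arrow tilting_quiver (lam, 1, \<rho>)"

definition garr :: "nat \<times> nat \<Rightarrow> 'n::finite \<Rightarrow> ('a::field, 'n) path_element" where
  "garr lam \<rho> = arrow tilting_quiver (lam, 2, \<rho>)"

definition P2 :: "nat \<Rightarrow> ((nat \<times> nat) \<times> (nat \<times> nat)) set" where
  "P2 m = {(lam, \<mu>). lam \<in> young m \<and> \<mu> \<in> young m \<and>
             fst lam \<le> fst \<mu> \<and> snd lam \<le> snd \<mu> \<and> lam \<noteq> \<mu> \<and>
             fst \<mu> + snd \<mu> = fst lam + snd lam + 2}"

definition K_set ::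
    "nat \<times> nat \<Rightarrow> nat \<times> nat \<Rightarrow> ('a::field, 'n::finite) path_element set" where
  "K_set lam \<mu> =
    (let A = tilting_path_algebra :: ('a, ('a, 'n) path_element) module;
         lamf = add_e lam 1;
         lamg = add_e lam 2;
         d = fst lam - snd lam
     in if \<mu> = (fst lam + 2, snd lam) then
          {(farr lamf j \<otimes>\<^bsub>A\<^esub> farr lam i) \<ominus>\<^bsub>A\<^esub> (farr lamf i \<otimes>\<^bsub>A\<^esub> farr lam j) | i j. True}
        else if \<mu> = (fst lam, snd lam + 2) then
          {(garr lamg j \<otimes>\<^bsub>A\<^esub> garr lam i) \<ominus>\<^bsub>A\<^esub> (garr lamg i \<otimes>\<^bsub>A\<^esub> garr lam j) | i j. True}
        else if fst lam = snd lam \<and> \<mu> = (fst lam + 1, snd lam + 1) then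
          {(garr lamf j \<otimes>\<^bsub>A\<^esub> farr lam i) \<oplus>\<^bsub>A\<^esub> (garr lamf i \<otimes>\<^bsub>A\<^esub> farr lam j) | i j. True}
        else if fst lam > snd lam \<and> \<mu> = (fst lam + 1, snd lam + 1) then
          {(of_nat d \<odot>\<^bsub>A\<^esub> (garr lamf j \<otimes>\<^bsub>A\<^esub> farr lam i))
             \<ominus>\<^bsub>A\<^esub> (of_nat (d + 1) \<odot>\<^bsub>A\<^esub> (farr lamg i \<otimes>\<^bsub>A\<^esub> garr lam j))
             \<oplus>\<^bsub>A\<^esub> (farr lamg j \<otimes>\<^bsub>A\<^esub> garr lam i) | i j. True}
        else {})"

definition tilting_relations :: "('a::field, 'n::finite) path_element set" where
  "tilting_relations = (\<Union>(lam, \<mu>) \<in> P2 (CARD('n) - 2). K_set lam \<mu>)"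

end

(*
  A point K of the Grassmannian together with a basis of V/K is a 2 x n matrix M of rank 2, whose
  columns are the coordinates of the classes of u_1, ..., u_n. Hence an element of
  Hom(S^lambda W, S^mu W) is a GL(2)-equivariant regular function on matrices of rank 2 with values
  in Hom(S^lambda k^2, S^mu k^2); as two minors without common variables exist for n >= 4, it
  extends to a polynomial function on all matrices. In this picture f_u is multiplication by the
  column u = u_1 x + u_2 y and g_u is the operator u_1 d/dy - u_2 d/dx, on polynomials in x and y;
  they satisfy the relations.

  Conversely, let F be such an equivariant polynomial map with values in polynomials of degree e
  in x and y, homogeneous of degree N in M. There are equivariant maps F'_i, F''_i of degree N - 1,
  obtained by contracting the derivatives of F by the entries of the i-th column, such that the sum
  of f_i F'_i + g_i F''_i is (e + 1) N F. This Euler identity defines, by recursion on N, an element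
  psi F of the path algebra that is represented by F. Commuting the lowering operators with the
  f_j and g_j shows that psi (f_j F) = f_j psi F and psi (g_j F) = g_j psi F modulo the relations,
  so a path is congruent to psi of the map it represents, and the relations generate the kernel.
*)

theory Submission
  imports Defs
begin

section \<open>Polynomial functions\<close>

text \<open>The constants of relation (iv) come out of the Euler identity. Let e be the degree of F
  in x and y. Expanding psi (f_j F) and f_j psi F by one step each leaves, applied to lowered maps
  and over the denominator e + 1, multiples of f_i f_j - f_j f_i and of (e + 1) g_i f_j - (e + 2)
  f_j g_i + f_i g_j. The second starts at a vertex with row difference e + 1, where it is relation
  (iv). For g_j the leftover is a combination of two instances of (iv), which degenerates to (iii)
  when e = 1.

  The obstacle is to keep the recursion inside the finite quiver. Lowering never passes the bound n
  - 2. At the other walls the lowered map itself vanishes: beyond equal rows its target has degree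
  -1, and below second row 0 it would be an equivariant polynomial map with a negative determinant
  twist, of which there are none.

  Characteristic zero allows the division by (e + 1) N and makes polynomials and polynomial
  functions the same thing. Families are indexed by integers and padded with zeros, so that index
  shifts cause few boundary cases.\<close>

inductive_set poly_funs :: "(('v \<Rightarrow> 'a::field_char_0) \<Rightarrow> 'a) set" where
  const: "(\<lambda>_. x) \<in> poly_funs"
| var: "(\<lambda>M. M v) \<in> poly_funs"
| add: "F \<in> poly_funs \<Longrightarrow> G \<in> poly_funs \<Longrightarrow> (\<lambda>M. F M + G M) \<in> poly_funs"
| mult: "F \<in> poly_funs \<Longrightarrow> G \<in> poly_funs \<Longrightarrow> (\<lambda>M. F M * G M) \<in> poly_funs"

lemma poly_funs_minus: "F \<in> poly_funs \<Longrightarrow> (\<lambda>M. - F M) \<in> poly_funs"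
  using poly_funs.mult[OF poly_funs.const[of "-1"]] by fastforce

lemma poly_funs_diff: "F \<in> poly_funs \<Longrightarrow> G \<in> poly_funs \<Longrightarrow> (\<lambda>M. F M - G M) \<in> poly_funs"
  using poly_funs.add[OF _ poly_funs_minus[of G]] by fastforce

lemma poly_funs_power: "F \<in> poly_funs \<Longrightarrow> (\<lambda>M. F M ^ k) \<in> poly_funs"
  by (induction k) (auto intro: poly_funs.intros)

lemma poly_funs_sum: "(\<And>i. i \<in> S \<Longrightarrow> F i \<in> poly_funs) \<Longrightarrow> (\<lambda>M. \<Sum>i\<in>S. F i M) \<in> poly_funs"
  by (induction S rule: infinite_finite_induct) (auto intro: poly_funs.intros)

lemma poly_funs_prod: "(\<And>i. i \<in> S \<Longrightarrow> F i \<in> poly_funs) \<Longrightarrow> (\<lambda>M. \<Prod>i\<in>S. F i M) \<in> poly_funs"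
  by (induction S rule: infinite_finite_induct) (auto intro: poly_funs.intros)

lemmas poly_funs_closed =
  poly_funs.intros poly_funs_minus poly_funs_diff poly_funs_power poly_funs_sum poly_funs_prod

lemma poly_funs_substitute:
  assumes "F \<in> poly_funs" "\<And>v. (\<lambda>M. T M v) \<in> poly_funs"
  shows "(\<lambda>M. F (T M)) \<in> poly_funs"
  using assms(1) by induction (auto intro: poly_funs.intros assms(2))

text \<open>Pulling back along a polynomial curve leads to univariate polynomials, with their
  coefficients and \<open>pderiv\<close>. The arguments on density, homogeneity and weights all pass
  through such curves.\<close>

lemma poly_funs_curve:
  assumes "F \<in> poly_funs"
  obtains r where "\<And>s. poly r s = F (\<lambda>v. poly (c v) s)"
proof -
  have "\<exists>r. \<forall>s. poly r s = F (\<lambda>v. poly (c v) s)"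
    using assms
  proof induction
    case (const x)
    show ?case by (rule exI[of _ "[:x:]"]) simp
  next
    case (var v)
    show ?case by (rule exI[of _ "c v"]) simp
  next
    case (add F G)
    then obtain p q where "\<forall>s. poly p s = F (\<lambda>v. poly (c v) s)" "\<forall>s. poly q s = G (\<lambda>v. poly (c v) s)"
      by blast
    then show ?case by (intro exI[of _ "p + q"]) simp
  next
    case (mult F G)
    then obtain p q where "\<forall>s. poly p s = F (\<lambda>v. poly (c v) s)" "\<forall>s. poly q s = G (\<lambda>v. poly (c v) s)"
      by blast
    then show ?case by (intro exI[of _ "p * q"]) simp
  qed
  with that show ?thesis by blast
qed

section \<open>Partial derivatives of polynomial functions\<close>

definition axis_poly :: "(('v \<Rightarrow> 'a::field_char_0) \<Rightarrow> 'a) \<Rightarrow> ('v \<Rightarrow> 'a) \<Rightarrow> 'v \<Rightarrow> 'a poly" where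
  "axis_poly F M v = (THE r. \<forall>s. poly r s = F (M(v := s)))"

text \<open>A field of characteristic zero is infinite, so a univariate polynomial is determined by
  its values; one polynomial with the right values identifies the description.\<close>

lemma axis_poly_eqI:
  assumes "\<And>s. poly r s = F (M(v := s))"
  shows "axis_poly F M v = r"
  unfolding axis_poly_def
proof (rule the_equality)
  show "\<forall>s. poly r s = F (M(v := s))" using assms by blast
  show "r' = r" if "\<forall>s. poly r' s = F (M(v := s))" for r'
    using that assms by (metis ext poly_eq_poly_eq_iff)
qed

lemma poly_axis_poly:
  assumes "F \<in> poly_funs"
  shows "poly (axis_poly F M v) s = F (M(v := s))"
proof -
  have M: "M(v := s) = (\<lambda>w. poly (if w = v then [:0, 1:] else [:M w:]) s)" for s
    by auto
  obtain r where "\<And>s. poly r s = F (M(v := s))"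
    using poly_funs_curve[OF assms, of "\<lambda>w. if w = v then [:0, 1:] else [:M w:]"] unfolding M by blast
  with axis_poly_eqI[of r F M v] show ?thesis by simp
qed

text \<open>Functions are differentiated, not formal polynomials. The value is meaningful only on
  \<open>poly_funs\<close>, hence the membership hypotheses in the rules below.\<close>

definition pd :: "'v \<Rightarrow> (('v \<Rightarrow> 'a::field_char_0) \<Rightarrow> 'a) \<Rightarrow> ('v \<Rightarrow> 'a) \<Rightarrow> 'a" where
  "pd v F M = poly (pderiv (axis_poly F M v)) (M v)"

lemma pd_const [simp]: "pd v (\<lambda>_. x) = (\<lambda>_. 0)"
proof
  fix M
  have "axis_poly (\<lambda>_. x) M v = [:x:]" by (rule axis_poly_eqI) simp
  then show "pd v (\<lambda>_. x) M = 0" by (simp add: pd_def)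
qed

lemma pd_var [simp]: "pd v (\<lambda>M. M w) = (\<lambda>_. if v = w then 1 else 0)"
proof
  fix M :: "'a \<Rightarrow> 'b"
  have "axis_poly (\<lambda>M. M w) M v = (if v = w then [:0, 1:] else [:M w:])"
    by (rule axis_poly_eqI) simp
  then show "pd v (\<lambda>M. M w) M = (if v = w then 1 else 0)" by (simp add: pd_def pderiv_pCons)
qed

lemma pd_add:
  assumes "F \<in> poly_funs" "G \<in> poly_funs"
  shows "pd v (\<lambda>M. F M + G M) = (\<lambda>M. pd v F M + pd v G M)"
proof
  fix M
  have "axis_poly (\<lambda>M. F M + G M) M v = axis_poly F M v + axis_poly G M v"
    by (rule axis_poly_eqI) (simp add: poly_axis_poly assms)
  then show "pd v (\<lambda>M. F M + G M) M = pd v F M + pd v G M" by (simp add: pd_def pderiv_add)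
qed

lemma pd_mult:
  assumes "F \<in> poly_funs" "G \<in> poly_funs"
  shows "pd v (\<lambda>M. F M * G M) = (\<lambda>M. pd v F M * G M + F M * pd v G M)"
proof
  fix M
  have "axis_poly (\<lambda>M. F M * G M) M v = axis_poly F M v * axis_poly G M v"
    by (rule axis_poly_eqI) (simp add: poly_axis_poly assms)
  then show "pd v (\<lambda>M. F M * G M) M = pd v F M * G M + F M * pd v G M"
    by (simp add: pd_def pderiv_mult poly_axis_poly assms algebra_simps)
qed

lemma pd_cmult:
  "F \<in> poly_funs \<Longrightarrow> pd v (\<lambda>M. x * F M) = (\<lambda>M. x * pd v F M)"
  by (subst pd_mult) (auto intro: poly_funs.intros)

lemma pd_diff:
  assumes "F \<in> poly_funs" "G \<in> poly_funs"
  shows "pd v (\<lambda>M. F M - G M) = (\<lambda>M. pd v F M - pd v G M)"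
proof -
  have "(\<lambda>M. F M - G M) = (\<lambda>M. F M + (-1) * G M)" by auto
  then show ?thesis
    using assms by (simp only: pd_add pd_cmult poly_funs_closed) auto
qed

lemma pd_sum:
  "(\<And>i. i \<in> S \<Longrightarrow> F i \<in> poly_funs) \<Longrightarrow>
    pd v (\<lambda>M. \<Sum>i\<in>S. F i M) = (\<lambda>M. \<Sum>i\<in>S. pd v (F i) M)"
proof (induction S rule: infinite_finite_induct)
  case (insert x S)
  then show ?case by (simp add: pd_add poly_funs_sum)
qed auto

lemma pd_poly_funs:
  assumes "F \<in> poly_funs"
  shows "pd v F \<in> poly_funs"
  using assms by induction (auto simp: pd_add pd_mult intro!: poly_funs.intros)

lemma pd_commute:
  assumes "F \<in> poly_funs"
  shows "pd v (pd w F) = pd w (pd v F)"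
  using assms
proof induction
  case (add F G)
  then show ?case by (simp add: pd_add pd_poly_funs)
next
  case (mult F G)
  then show ?case
    by (auto simp: pd_add pd_mult pd_poly_funs poly_funs.intros algebra_simps)
qed auto

text \<open>Induction on the construction of \<open>F\<close>. The polynomial \<open>r\<close> is
  generalised because each constituent has its own pullback, of which \<open>r\<close> is the sum or
  product by uniqueness.\<close>

lemma pd_chain:
  fixes F :: "('v::finite \<Rightarrow> 'a::field_char_0) \<Rightarrow> 'a"
  assumes "F \<in> poly_funs" and r: "\<And>s. poly r s = F (\<lambda>v. poly (c v) s)"
  shows "poly (pderiv r) s = (\<Sum>v\<in>UNIV. pd v F (\<lambda>v. poly (c v) s) * poly (pderiv (c v)) s)"
  using assms
proof (induction arbitrary: r)
  case (const x)
  then have "poly r = poly [:x:]" by auto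
  then have "r = [:x:]" using poly_eq_poly_eq_iff by blast
  then show ?case by simp
next
  case (var w)
  then have "r = c w" by (metis poly_eq_poly_eq_iff ext)
  then show ?case by (simp add: if_distrib if_distribR cong: if_cong)
next
  case (add F G)
  obtain p q where pq: "\<And>s. poly p s = F (\<lambda>v. poly (c v) s)" "\<And>s. poly q s = G (\<lambda>v. poly (c v) s)"
    by (metis poly_funs_curve add.hyps)
  have "poly r = poly (p + q)" using add.prems pq by (auto simp: fun_eq_iff)
  then have "r = p + q" using poly_eq_poly_eq_iff by blast
  then show ?case
    using add.IH pq by (simp add: pd_add add.hyps pderiv_add sum.distrib distrib_right)
next
  case (mult F G)
  obtain p q where pq: "\<And>s. poly p s = F (\<lambda>v. poly (c v) s)" "\<And>s. poly q s = G (\<lambda>v. poly (c v) s)"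
    by (metis poly_funs_curve mult.hyps)
  have "poly r = poly (p * q)" using mult.prems pq by (auto simp: fun_eq_iff)
  then have "r = p * q" using poly_eq_poly_eq_iff by blast
  then show ?case
    using mult.IH pq
    by (simp add: pd_mult mult.hyps pderiv_mult flip: sum.distrib)
      (simp add: sum_distrib_left sum.distrib algebra_simps)
qed

text \<open>On the line through \<open>M\<close> and a point where \<open>D\<close> does not vanish, everything is a
  univariate polynomial.\<close>

lemma poly_fun_eq_0:
  assumes F: "F \<in> poly_funs" and D: "D \<in> poly_funs" and "D M0 \<noteq> 0"
    and 0: "\<And>M. D M \<noteq> 0 \<Longrightarrow> F M = 0"
  shows "F M = 0"
proof -
  define c where "c v = [:M0 v, M v - M0 v:]" for v
  obtain r where r: "\<And>s. poly r s = F (\<lambda>v. poly (c v) s)" using poly_funs_curve[OF F] by blast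
  obtain q where q: "\<And>s. poly q s = D (\<lambda>v. poly (c v) s)" using poly_funs_curve[OF D] by blast
  have "poly q 0 \<noteq> 0" using q \<open>D M0 \<noteq> 0\<close> by (simp add: c_def)
  then have "q \<noteq> 0" by auto
  have "poly (q * r) s = poly 0 s" for s
    using 0[of "\<lambda>v. poly (c v) s"] q r by auto
  then have "q * r = 0" by (metis ext poly_eq_poly_eq_iff)
  with \<open>q \<noteq> 0\<close> have "r = 0" by simp
  then have "poly r 1 = 0" by simp
  then show ?thesis using r by (simp add: c_def)
qed

lemma poly_funs_eqI:
  assumes "F \<in> poly_funs" "G \<in> poly_funs" "D \<in> poly_funs" "D M0 \<noteq> 0"
    and "\<And>M. D M \<noteq> 0 \<Longrightarrow> F M = G M"
  shows "F M = G M"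
  using poly_fun_eq_0[of "\<lambda>M. F M - G M" D M0 M] assms by (simp add: poly_funs_diff)

text \<open>On the ray from 0 through \<open>M\<close> the hypothesis reads s r' = w r, so only the
  coefficient of s^w can be nonzero: none if w < 0, and only the constant one if w = 0.\<close>

lemma euler_eigenfunction:
  fixes F :: "('v::finite \<Rightarrow> 'a::field_char_0) \<Rightarrow> 'a"
  assumes F: "F \<in> poly_funs"
    and euler: "\<And>M. (\<Sum>v\<in>UNIV. M v * pd v F M) = of_int w * F M"
  shows "w < 0 \<Longrightarrow> F M = 0" "w = 0 \<Longrightarrow> F M = F (\<lambda>_. 0)"
proof -
  define c where "c v = [:0, M v:]" for v
  obtain r where r: "\<And>s. poly r s = F (\<lambda>v. poly (c v) s)" using poly_funs_curve[OF F] by blast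
  have "poly ([:0, 1:] * pderiv r) s = poly (Polynomial.smult (of_int w) r) s" for s
  proof -
    have "poly ([:0, 1:] * pderiv r) s = s * (\<Sum>v\<in>UNIV. pd v F (\<lambda>v. poly (c v) s) * M v)"
      using pd_chain[OF F r] by (simp add: c_def pderiv_pCons)
    also have "\<dots> = (\<Sum>v\<in>UNIV. poly (c v) s * pd v F (\<lambda>v. poly (c v) s))"
      by (simp add: c_def sum_distrib_left mult_ac)
    also have "\<dots> = of_int w * poly r s" by (simp add: euler r)
    finally show ?thesis by simp
  qed
  then have eq: "[:0, 1:] * pderiv r = Polynomial.smult (of_int w) r" by (metis ext poly_eq_poly_eq_iff)
  have c: "of_nat k * coeff r k = of_int w * coeff r k" for k
  proof (cases k)
    case 0
    have "coeff ([:0, 1:] * pderiv r) 0 = coeff (Polynomial.smult (of_int w) r) 0" using eq by simp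
    with 0 show ?thesis by simp
  next
    case (Suc j)
    have "coeff ([:0, 1:] * pderiv r) k = coeff (Polynomial.smult (of_int w) r) k" using eq by simp
    with Suc show ?thesis by (simp add: coeff_pderiv)
  qed
  have z: "coeff r k = 0" if "int k \<noteq> w" for k
  proof -
    have "(of_int (int k - w) :: 'a) * coeff r k = 0" using c[of k] by (simp add: left_diff_distrib)
    then show ?thesis using that by (simp del: of_int_diff)
  qed
  show "F M = 0" if "w < 0"
  proof -
    have "r = 0" using z that by (intro poly_eqI) auto
    then show ?thesis using r[of 1] by (simp add: c_def)
  qed
  show "F M = F (\<lambda>_. 0)" if "w = 0"
  proof -
    have "r = [:coeff r 0:]"
    proof (rule poly_eqI)
      fix k show "coeff r k = coeff [:coeff r 0:] k" using z[of k] that by (cases k) auto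
    qed
    then obtain x where "r = [:x:]" by blast
    then show ?thesis using r[of 1] r[of 0] by (simp add: c_def)
  qed
qed

lemma pd_eq_0_if_constant:
  assumes "\<And>M. F M = F (\<lambda>_. 0)"
  shows "pd v F M = 0"
proof -
  have "F = (\<lambda>_. F (\<lambda>_. 0))" using assms by blast
  then show ?thesis by (metis pd_const)
qed

section \<open>Lagrange interpolation in a single variable\<close>

definition lagrange :: "'a::field_char_0 set \<Rightarrow> 'a \<Rightarrow> 'a poly" where
  "lagrange S s = (\<Prod>t\<in>S - {s}. Polynomial.smult (1 / (s - t)) [:-t, 1:])"

lemma poly_lagrange:
  assumes "finite S" "s \<in> S" "t \<in> S"
  shows "poly (lagrange S s) t = (if s = t then 1 else 0)"
proof (cases "s = t")
  case True
  have "poly (Polynomial.smult (1 / (t - u)) [:-u, 1:]) t = 1" if "u \<in> S - {t}" for u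
  proof -
    have "poly (Polynomial.smult (1 / (t - u)) [:-u, 1:]) t = (1 / (t - u)) * (t - u)"
      by (subst poly_smult, rule arg_cong[of _ _ "(*) _"]) simp
    also have "\<dots> = 1" using that by (metis DiffE eq_iff_diff_eq_0 insertCI nonzero_eq_divide_eq)
    finally show ?thesis .
  qed
  with True show ?thesis by (simp only: lagrange_def poly_prod if_True refl prod.neutral[OF ballI])
next
  case False
  then have "(\<Prod>u\<in>S - {s}. poly (Polynomial.smult (1 / (s - u)) [:-u, 1:]) t) = 0"
    using assms by (intro prod_zero bexI[of _ t]) auto
  with False show ?thesis by (simp only: lagrange_def poly_prod if_False)
qed

lemma degree_lagrange:
  assumes "finite S" "s \<in> S"
  shows "degree (lagrange S s) < card S"
proof -
  have "degree (lagrange S s) \<le> (\<Sum>t\<in>S - {s}. degree (Polynomial.smult (1 / (s - t)) [:-t, 1:]))"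
    unfolding lagrange_def
    using assms degree_prod_sum_le[of "S - {s}" "\<lambda>t. Polynomial.smult (1 / (s - t)) [:-t, 1:]"]
    by (simp only: o_def finite_Diff)
  also have "\<dots> \<le> (\<Sum>t\<in>S - {s}. 1)" by (rule sum_mono) auto
  also have "\<dots> < card S" using assms card_Diff1_less[of S s] by simp
  finally show ?thesis .
qed

text \<open>Both sides have degree below \<open>card S\<close> and agree on
  \<open>S\<close>.\<close>

lemma lagrange_interpolation:
  assumes "finite S" "degree r < card S"
  shows "poly r x = (\<Sum>s\<in>S. poly (lagrange S s) x * poly r s)"
proof -
  define q where "q = (\<Sum>s\<in>S. Polynomial.smult (poly r s) (lagrange S s))"
  have "S \<noteq> {}" using assms by auto
  then have "degree q < card S"
    unfolding q_def using assms degree_lagrange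
    by (intro degree_sum_less) (auto simp: card_gt_0_iff intro: le_less_trans[OF degree_smult_le])
  have "poly q t = poly r t" if "t \<in> S" for t
  proof -
    have "poly q t = (\<Sum>s\<in>S. if s = t then poly r s else 0)"
      unfolding q_def poly_sum poly_smult
      by (rule sum.cong) (use that assms in \<open>auto simp: poly_lagrange\<close>)
    then show ?thesis using that assms by simp
  qed
  then have "q = r"
    by (rule poly_eqI_degree[of S]) (use assms \<open>degree q < card S\<close> in auto)
  then have "poly r x = poly q x" by simp
  then show ?thesis by (simp add: q_def poly_sum mult_ac)
qed

text \<open>Interpolation will use one fixed set of nodes for all points, so the bound must be
  uniform in the point \<open>M\<close> and the variable \<open>v\<close>.\<close>

lemma poly_fun_degree_bound:
  fixes F :: "('v \<Rightarrow> 'a::field_char_0) \<Rightarrow> 'a"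
  assumes "F \<in> poly_funs"
  obtains N where "\<And>M v. degree (axis_poly F M v) \<le> N"
proof -
  have "\<exists>N. \<forall>M v. degree (axis_poly F M v) \<le> N"
    using assms
  proof induction
    case (const x)
    have "axis_poly (\<lambda>_. x) M v = [:x:]" for M :: "'v \<Rightarrow> 'a" and v by (rule axis_poly_eqI) simp
    then show ?case by (intro exI[of _ 0]) simp
  next
    case (var w)
    have "axis_poly (\<lambda>M. M w) M v = (if v = w then [:0, 1:] else [:M w:])"
      for M :: "'v \<Rightarrow> 'a" and v
      by (rule axis_poly_eqI) simp
    then show ?case by (intro exI[of _ 1]) auto
  next
    case (add F G)
    have "axis_poly (\<lambda>M. F M + G M) M v = axis_poly F M v + axis_poly G M v" for M v
      by (rule axis_poly_eqI) (simp add: poly_axis_poly add)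
    moreover from add obtain N N' where "\<forall>M v. degree (axis_poly F M v) \<le> N"
      "\<forall>M v. degree (axis_poly G M v) \<le> N'" by blast
    ultimately show ?case
      by (intro exI[of _ "N + N'"]) (auto intro!: degree_add_le simp: trans_le_add1 trans_le_add2)
  next
    case (mult F G)
    have "axis_poly (\<lambda>M. F M * G M) M v = axis_poly F M v * axis_poly G M v" for M v
      by (rule axis_poly_eqI) (simp add: poly_axis_poly mult)
    moreover from mult obtain N N' where "\<forall>M v. degree (axis_poly F M v) \<le> N"
      "\<forall>M v. degree (axis_poly G M v) \<le> N'" by blast
    ultimately show ?case
      by (intro exI[of _ "N + N'"]) (auto intro!: order_trans[OF degree_mult_le] add_mono)
  qed
  with that show ?thesis by blast
qed

lemma poly_fun_interpolation:
  assumes "F \<in> poly_funs" "finite S" "\<And>M v. degree (axis_poly F M v) < card S"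
  shows "F M = (\<Sum>s\<in>S. poly (lagrange S s) (M v) * F (M(v := s)))"
  using lagrange_interpolation[OF assms(2,3), of M v "M v"] assms(1) by (simp add: poly_axis_poly)

section \<open>Equivariant polynomial maps between symmetric powers\<close>

type_synonym ('a, 'n) coeff_family = "int \<Rightarrow> int \<Rightarrow> ('n \<times> bool \<Rightarrow> 'a) \<Rightarrow> 'a"

text \<open>The vector field by which an elementary matrix of gl_2 acts on functions of a 2 x n
  matrix: it is the derivative of adding a small multiple of row \<open>u\<close> to row
  \<open>v\<close>, and for \<open>u = v\<close> the Euler operator of one row.\<close>

definition polar :: "bool \<Rightarrow> bool \<Rightarrow> (('n::finite \<times> bool \<Rightarrow> 'a::field_char_0) \<Rightarrow> 'a) \<Rightarrow>
    ('n \<times> bool \<Rightarrow> 'a) \<Rightarrow> 'a" where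
  "polar u v F = (\<lambda>M. \<Sum>i\<in>UNIV. M (i, u) * pd (i, v) F M)"

lemma polar_0: "polar u v (\<lambda>_. 0) = (\<lambda>_. 0)"
  by (simp add: polar_def)

lemma polar_add: "F \<in> poly_funs \<Longrightarrow> G \<in> poly_funs \<Longrightarrow>
    polar u v (\<lambda>M. F M + G M) = (\<lambda>M. polar u v F M + polar u v G M)"
  by (simp add: polar_def pd_add distrib_left sum.distrib)

lemma polar_diff: "F \<in> poly_funs \<Longrightarrow> G \<in> poly_funs \<Longrightarrow>
    polar u v (\<lambda>M. F M - G M) = (\<lambda>M. polar u v F M - polar u v G M)"
  by (simp add: polar_def pd_diff right_diff_distrib sum_subtractf)

lemma polar_cmult: "F \<in> poly_funs \<Longrightarrow> polar u v (\<lambda>M. x * F M) = (\<lambda>M. x * polar u v F M)"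
  by (simp add: polar_def pd_cmult sum_distrib_left mult_ac)

lemma polar_var_mult:
  assumes "F \<in> poly_funs"
  shows "polar u v (\<lambda>M. M (j, s) * F M) =
    (\<lambda>M. (if v = s then M (j, u) * F M else 0) + M (j, s) * polar u v F M)"
proof
  fix M
  have "polar u v (\<lambda>M. M (j, s) * F M) M =
      (\<Sum>i\<in>UNIV. (if i = j then (if v = s then M (i, u) * F M else 0) else 0)) +
      (\<Sum>i\<in>UNIV. M (i, u) * (M (j, s) * pd (i, v) F M))"
    unfolding polar_def sum.distrib[symmetric]
    by (rule sum.cong) (auto simp: pd_mult assms poly_funs.intros algebra_simps)
  then show "polar u v (\<lambda>M. M (j, s) * F M) M =
      (if v = s then M (j, u) * F M else 0) + M (j, s) * polar u v F M"
    by (simp add: polar_def sum_distrib_left mult_ac)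
qed

text \<open>The commutator of the gl_2-action with a partial derivative: the derivatives of a column
  transform dually to the column.\<close>

lemma polar_pd:
  assumes "F \<in> poly_funs"
  shows "polar u v (pd (k, s) F) =
    (\<lambda>M. pd (k, s) (polar u v F) M - (if s = u then pd (k, v) F M else 0))"
proof
  fix M
  have "pd (k, s) (polar u v F) M =
      (\<Sum>i\<in>UNIV. (if i = k then (if s = u then pd (i, v) F M else 0) else 0)) +
      (\<Sum>i\<in>UNIV. M (i, u) * pd (i, v) (pd (k, s) F) M)"
    unfolding polar_def sum.distrib[symmetric]
    by (subst pd_sum)
      (auto simp: pd_mult assms poly_funs.intros pd_poly_funs pd_commute[of F "(k, s)"]
        intro!: poly_funs.intros sum.cong)
  then show "polar u v (pd (k, s) F) M =
      pd (k, s) (polar u v F) M - (if s = u then pd (k, v) F M else 0)"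
    by (simp add: polar_def)
qed

text \<open>
  The columns $m_i = (a_i, b_i)$ of a $2 \times n$-matrix are $a_i$ = \<open>M (i, False)\<close> and
  $b_i$ = \<open>M (i, True)\<close>. A family \<open>F\<close> is the matrix of a polynomial map from such matrices to
  $\mathrm{Hom}(\mathrm{Sym}^d k^2, \mathrm{Sym}^e k^2)$, $e = d + p - q$: the entry \<open>F a b\<close> is
  the coefficient of $x^{e-a}y^a$ in the image of $x^{d-b}y^b$. The conditions express
  equivariance under the diagonal torus and one unipotent root of $\mathfrak{gl}_2$.
\<close>

definition equivariant_maps ::
    "int \<Rightarrow> int \<Rightarrow> int \<Rightarrow> ('a::field_char_0, 'n::finite) coeff_family set" where
  "equivariant_maps d p q = {F.
     (\<forall>a b. F a b \<in> poly_funs) \<and>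
     (\<forall>a b. \<not> (0 \<le> a \<and> a \<le> d + p - q \<and> 0 \<le> b \<and> b \<le> d) \<longrightarrow> F a b = (\<lambda>_. 0)) \<and>
     (\<forall>a b. polar False False (F a b) = (\<lambda>M. of_int (p - a + b) * F a b M)) \<and>
     (\<forall>a b. polar True True (F a b) = (\<lambda>M. of_int (q + a - b) * F a b M)) \<and>
     (\<forall>a b. 0 \<le> b \<longrightarrow> b \<le> d \<longrightarrow> polar True False (F a b) =
        (\<lambda>M. of_int (a + 1) * F (a + 1) b M - of_int b * F a (b - 1) M))}"

definition raise_f :: "'n::finite \<Rightarrow> ('a::field_char_0, 'n) coeff_family \<Rightarrow> ('a, 'n) coeff_family" where
  "raise_f j F = (\<lambda>a b M. M (j, False) * F a b M + M (j, True) * F (a - 1) b M)"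

definition raise_g ::
    "'n::finite \<Rightarrow> int \<Rightarrow> ('a::field_char_0, 'n) coeff_family \<Rightarrow> ('a, 'n) coeff_family" where
  "raise_g j e F = (\<lambda>a b M. of_int (a + 1) * (M (j, False) * F (a + 1) b M)
     - of_int (e - a) * (M (j, True) * F a b M))"

text \<open>With \<open>raise_f\<close> as $ax + by$ and \<open>raise_g\<close> as $a\partial_y - b\partial_x$, the operators
  \<open>lower_f\<close> and \<open>lower_g\<close> are $\partial_x\partial_a + \partial_y\partial_b$ and
  $y\partial_a - x\partial_b$.\<close>

definition lower_f ::
    "'n::finite \<Rightarrow> int \<Rightarrow> ('a::field_char_0, 'n) coeff_family \<Rightarrow> ('a, 'n) coeff_family" where
  "lower_f i e F = (\<lambda>a b M. of_int (e - a) * pd (i, False) (F a b) M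
     + of_int (a + 1) * pd (i, True) (F (a + 1) b) M)"

definition lower_g :: "'n::finite \<Rightarrow> ('a::field_char_0, 'n) coeff_family \<Rightarrow> ('a, 'n) coeff_family" where
  "lower_g i F = (\<lambda>a b M. pd (i, False) (F (a - 1) b) M - pd (i, True) (F a b) M)"

lemma equivariant_mapsD:
  assumes "F \<in> equivariant_maps d p q"
  shows "F a b \<in> poly_funs"
    and "\<not> (0 \<le> a \<and> a \<le> d + p - q \<and> 0 \<le> b \<and> b \<le> d) \<Longrightarrow> F a b = (\<lambda>_. 0)"
    and "polar False False (F a b) = (\<lambda>M. of_int (p - a + b) * F a b M)"
    and "polar True True (F a b) = (\<lambda>M. of_int (q + a - b) * F a b M)"
    and "0 \<le> b \<Longrightarrow> b \<le> d \<Longrightarrow> polar True False (F a b) =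
        (\<lambda>M. of_int (a + 1) * F (a + 1) b M - of_int b * F a (b - 1) M)"
  using assms by (auto simp: equivariant_maps_def)

lemmas pd_rules = pd_add pd_diff pd_cmult pd_mult
lemmas polar_rules = polar_add polar_diff polar_cmult polar_var_mult polar_pd

text \<open>Replacing the four letters of a x + b y by the corresponding derivatives keeps the
  pairing equivariant and lowers the weight \<open>p\<close> by one. In coordinates this is a
  computation with \<open>polar_pd\<close>.\<close>

lemma lower_f_equivariant:
  assumes F: "F \<in> equivariant_maps d p q"
  shows "lower_f i (d + p - q) F \<in> equivariant_maps d (p - 1) q"
proof -
  note D = equivariant_mapsD[OF F]
  have pf: "F a b \<in> poly_funs" "pd v (F a b) \<in> poly_funs" for a b v
    by (rule D(1), rule pd_poly_funs[OF D(1)])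
  show ?thesis
    unfolding equivariant_maps_def
  proof (intro CollectI conjI allI impI)
    fix a b :: int
    show "lower_f i (d + p - q) F a b \<in> poly_funs"
      unfolding lower_f_def by (intro poly_funs_closed pf)
    show "lower_f i (d + p - q) F a b = (\<lambda>_. 0)"
      if "\<not> (0 \<le> a \<and> a \<le> d + (p - 1) - q \<and> 0 \<le> b \<and> b \<le> d)"
    proof -
      \<comment> \<open>At the two indices where only one of the summands leaves the old range, the
        factor of the other one is zero: \<open>e - a\<close> at a = e and \<open>a + 1\<close> at a
        = -1.\<close>
      have "a = d + p - q \<or> F a b = (\<lambda>_. 0)"
        using that by (cases "a = d + p - q") (simp_all add: D(2))
      moreover have "a = - 1 \<or> F (a + 1) b = (\<lambda>_. 0)"
        using that by (cases "a = - 1") (simp_all add: D(2))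
      moreover have "a = - 1 \<longrightarrow> F a b = (\<lambda>_. 0)" "a = d + p - q \<longrightarrow> F (a + 1) b = (\<lambda>_. 0)"
        by (simp_all add: D(2))
      ultimately show ?thesis by (elim disjE) (simp_all add: lower_f_def)
    qed
    show "polar False False (lower_f i (d + p - q) F a b) =
        (\<lambda>M. of_int (p - 1 - a + b) * lower_f i (d + p - q) F a b M)"
      unfolding lower_f_def
      by (simp add: polar_rules pd_rules pf poly_funs_closed D(3)) (simp add: algebra_simps)
    show "polar True True (lower_f i (d + p - q) F a b) =
        (\<lambda>M. of_int (q + a - b) * lower_f i (d + p - q) F a b M)"
      unfolding lower_f_def
      by (simp add: polar_rules pd_rules pf poly_funs_closed D(4)) (simp add: algebra_simps)
    show "polar True False (lower_f i (d + p - q) F a b) =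
        (\<lambda>M. of_int (a + 1) * lower_f i (d + p - q) F (a + 1) b M -
          of_int b * lower_f i (d + p - q) F a (b - 1) M)" if "0 \<le> b" "b \<le> d"
      unfolding lower_f_def
      by (simp add: polar_rules pd_rules pf poly_funs_closed D(5) that) (simp add: algebra_simps)
  qed
qed

lemma lower_g_equivariant:
  assumes F: "F \<in> equivariant_maps d p q"
  shows "lower_g i F \<in> equivariant_maps d p (q - 1)"
proof -
  note D = equivariant_mapsD[OF F]
  have pf: "F a b \<in> poly_funs" "pd v (F a b) \<in> poly_funs" for a b v
    by (rule D(1), rule pd_poly_funs[OF D(1)])
  show ?thesis
    unfolding equivariant_maps_def
  proof (intro CollectI conjI allI impI)
    fix a b :: int
    show "lower_g i F a b \<in> poly_funs"
      unfolding lower_g_def by (intro poly_funs_closed pf)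
    show "lower_g i F a b = (\<lambda>_. 0)"
      if "\<not> (0 \<le> a \<and> a \<le> d + p - (q - 1) \<and> 0 \<le> b \<and> b \<le> d)"
    proof -
      have "F a b = (\<lambda>_. 0)" "F (a - 1) b = (\<lambda>_. 0)"
        using that by (auto intro!: D(2))
      then show ?thesis by (simp add: lower_g_def)
    qed
    show "polar False False (lower_g i F a b) = (\<lambda>M. of_int (p - a + b) * lower_g i F a b M)"
      unfolding lower_g_def
      by (simp add: polar_rules pd_rules pf poly_funs_closed D(3)) (simp add: algebra_simps)
    show "polar True True (lower_g i F a b) = (\<lambda>M. of_int (q - 1 + a - b) * lower_g i F a b M)"
      unfolding lower_g_def
      by (simp add: polar_rules pd_rules pf poly_funs_closed D(4)) (simp add: algebra_simps)
    show "polar True False (lower_g i F a b) =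
        (\<lambda>M. of_int (a + 1) * lower_g i F (a + 1) b M - of_int b * lower_g i F a (b - 1) M)"
      if "0 \<le> b" "b \<le> d"
      unfolding lower_g_def
      by (simp add: polar_rules pd_rules pf poly_funs_closed D(5) that) (simp add: algebra_simps)
  qed
qed

lemma raise_f_equivariant:
  assumes F: "F \<in> equivariant_maps d p q"
  shows "raise_f j F \<in> equivariant_maps d (p + 1) q"
proof -
  note D = equivariant_mapsD[OF F]
  note pf = D(1)
  show ?thesis
    unfolding equivariant_maps_def
  proof (intro CollectI conjI allI impI)
    fix a b :: int
    show "raise_f j F a b \<in> poly_funs"
      unfolding raise_f_def by (intro poly_funs_closed pf)
    show "raise_f j F a b = (\<lambda>_. 0)"
      if "\<not> (0 \<le> a \<and> a \<le> d + (p + 1) - q \<and> 0 \<le> b \<and> b \<le> d)"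
    proof -
      have "F a b = (\<lambda>_. 0)" "F (a - 1) b = (\<lambda>_. 0)"
        using that by (auto intro!: D(2))
      then show ?thesis by (simp add: raise_f_def)
    qed
    show "polar False False (raise_f j F a b) = (\<lambda>M. of_int (p + 1 - a + b) * raise_f j F a b M)"
      unfolding raise_f_def
      by (simp add: polar_rules pf poly_funs_closed D(3)) (simp add: algebra_simps)
    show "polar True True (raise_f j F a b) = (\<lambda>M. of_int (q + a - b) * raise_f j F a b M)"
      unfolding raise_f_def
      by (simp add: polar_rules pf poly_funs_closed D(4)) (simp add: algebra_simps)
    show "polar True False (raise_f j F a b) =
        (\<lambda>M. of_int (a + 1) * raise_f j F (a + 1) b M - of_int b * raise_f j F a (b - 1) M)"
      if "0 \<le> b" "b \<le> d"
      unfolding raise_f_def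
      by (simp add: polar_rules pf poly_funs_closed D(5) that) (simp add: algebra_simps)
  qed
qed

lemma raise_g_equivariant:
  assumes F: "F \<in> equivariant_maps d p q"
  shows "raise_g j (d + p - q) F \<in> equivariant_maps d p (q + 1)"
proof -
  note D = equivariant_mapsD[OF F]
  note pf = D(1)
  show ?thesis
    unfolding equivariant_maps_def
  proof (intro CollectI conjI allI impI)
    fix a b :: int
    show "raise_g j (d + p - q) F a b \<in> poly_funs"
      unfolding raise_g_def by (intro poly_funs_closed pf)
    show "raise_g j (d + p - q) F a b = (\<lambda>_. 0)"
      if "\<not> (0 \<le> a \<and> a \<le> d + p - (q + 1) \<and> 0 \<le> b \<and> b \<le> d)"
    proof -
      have "a = d + p - q \<or> F a b = (\<lambda>_. 0)"
        using that by (cases "a = d + p - q") (simp_all add: D(2))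
      moreover have "a = - 1 \<or> F (a + 1) b = (\<lambda>_. 0)"
        using that by (cases "a = - 1") (simp_all add: D(2))
      moreover have "a = - 1 \<longrightarrow> F a b = (\<lambda>_. 0)" "a = d + p - q \<longrightarrow> F (a + 1) b = (\<lambda>_. 0)"
        by (simp_all add: D(2))
      ultimately show ?thesis by (elim disjE) (simp_all add: raise_g_def)
    qed
    show "polar False False (raise_g j (d + p - q) F a b) =
        (\<lambda>M. of_int (p - a + b) * raise_g j (d + p - q) F a b M)"
      unfolding raise_g_def
      by (simp add: polar_rules pf poly_funs_closed D(3)) (simp add: algebra_simps)
    show "polar True True (raise_g j (d + p - q) F a b) =
        (\<lambda>M. of_int (q + 1 + a - b) * raise_g j (d + p - q) F a b M)"
      unfolding raise_g_def
      by (simp add: polar_rules pf poly_funs_closed D(4)) (simp add: algebra_simps)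
    show "polar True False (raise_g j (d + p - q) F a b) =
        (\<lambda>M. of_int (a + 1) * raise_g j (d + p - q) F (a + 1) b M -
          of_int b * raise_g j (d + p - q) F a (b - 1) M)" if "0 \<le> b" "b \<le> d"
      unfolding raise_g_def
      by (simp add: polar_rules pf poly_funs_closed D(5) that) (simp add: algebra_simps)
  qed
qed

section \<open>Commutation relations and the Euler identity\<close>

text \<open>In (a x + b y)(d_x d_a + d_y d_b) + (a d_y - b d_x)(y d_a - x d_b) the mixed terms
  cancel, and the rest is the operator x d_x + y d_y + 1, which is e + 1 on forms of degree e, times
  a d_a + b d_b. The level \<open>e + 1\<close> in \<open>raise_g\<close> is the degree of the
  output of \<open>lower_g\<close>.\<close>

lemma raise_lower_sum:
  "raise_f j (lower_f i e F) a b M + raise_g j (e + 1) (lower_g i F) a b M =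
    of_int (e + 1) * (M (j, False) * pd (i, False) (F a b) M + M (j, True) * pd (i, True) (F a b) M)"
  by (simp add: raise_f_def raise_g_def lower_f_def lower_g_def algebra_simps)

text \<open>The term for \<open>i = j\<close> is d_x x + d_y y = e + 2 on forms of degree e. The
  last bracket arises from moving d_x and d_y past x and y.\<close>

lemma lower_f_raise_f:
  assumes "\<And>a b. F a b \<in> poly_funs"
  shows "lower_f i (e + 1) (raise_f j F) a b M =
    (if i = j then of_int (e + 2) * F a b M else 0) + raise_f j (lower_f i e F) a b M
    + (M (j, False) * pd (i, False) (F a b) M + M (j, True) * pd (i, True) (F a b) M)"
  by (simp add: lower_f_def raise_f_def pd_rules assms poly_funs_closed)
    (simp add: algebra_simps)

text \<open>For \<open>i = j\<close> the extra term would be y x - x y = 0; likewise d_x d_y - d_y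
  d_x = 0 in the next lemma. The mixed pairs thus commute exactly.\<close>

lemma lower_g_raise_f:
  assumes "\<And>a b. F a b \<in> poly_funs"
  shows "lower_g i (raise_f j F) = raise_f j (lower_g i F)"
  by (intro ext, simp add: lower_g_def raise_f_def pd_rules assms poly_funs_closed)
    (simp add: algebra_simps)

lemma lower_f_raise_g:
  assumes "\<And>a b. F a b \<in> poly_funs"
  shows "lower_f i (e - 1) (raise_g j e F) = raise_g j (e - 1) (lower_f i e F)"
  by (intro ext, simp add: lower_f_def raise_g_def pd_rules assms poly_funs_closed)
    (simp add: algebra_simps)

text \<open>Here the term for \<open>i = j\<close> is y d_y + x d_x = e, and the reordering of y and
  d_y costs the bracket with the opposite sign.\<close>

lemma lower_g_raise_g:
  assumes "\<And>a b. F a b \<in> poly_funs"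
  shows "lower_g i (raise_g j e F) a b M =
    (if i = j then of_int e * F a b M else 0) + raise_g j (e + 1) (lower_g i F) a b M
    - (M (j, False) * pd (i, False) (F a b) M + M (j, True) * pd (i, True) (F a b) M)"
  by (simp add: lower_g_def raise_g_def pd_rules assms poly_funs_closed)
    (simp add: algebra_simps)

lemma sum_UNIV_pair_bool:
  fixes g :: "'n::finite \<times> bool \<Rightarrow> 'b::comm_monoid_add"
  shows "(\<Sum>v\<in>UNIV. g v) = (\<Sum>i\<in>UNIV. g (i, False) + g (i, True))"
proof -
  have "(\<Sum>i\<in>UNIV. \<Sum>s\<in>UNIV. g (i, s)) = (\<Sum>v\<in>UNIV. g v)"
    by (subst sum.cartesian_product) simp
  then show ?thesis by (simp add: UNIV_bool)
qed

text \<open>The two row weights \<open>p - a + b\<close> and \<open>q + a - b\<close> add up to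
  \<open>p + q\<close> whatever the indices are, so all entries are homogeneous of one
  degree.\<close>

lemma equivariant_maps_euler:
  assumes F: "F \<in> equivariant_maps d p q"
  shows "(\<Sum>v\<in>UNIV. M v * pd v (F a b) M) = of_int (p + q) * F a b M"
proof -
  have "(\<Sum>v\<in>UNIV. M v * pd v (F a b) M) = polar False False (F a b) M + polar True True (F a b) M"
    by (simp add: polar_def sum_UNIV_pair_bool sum.distrib)
  then show ?thesis by (simp add: equivariant_mapsD[OF F] algebra_simps)
qed

lemma equivariant_maps_lower_sum:
  assumes F: "F \<in> equivariant_maps d p q" and "e = d + p - q"
  shows "of_int ((e + 1) * (p + q)) * F a b M =
    (\<Sum>i\<in>UNIV. raise_f i (lower_f i e F) a b M + raise_g i (e + 1) (lower_g i F) a b M)"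
proof -
  have "(\<Sum>i\<in>UNIV. M (i, False) * pd (i, False) (F a b) M + M (i, True) * pd (i, True) (F a b) M) =
      (\<Sum>v\<in>UNIV. M v * pd v (F a b) M)"
    by (simp add: sum_UNIV_pair_bool)
  then show ?thesis
    unfolding raise_lower_sum sum_distrib_left[symmetric] equivariant_maps_euler[OF F] by simp
qed

lemma equivariant_maps_neg_degree:
  assumes "F \<in> equivariant_maps d p q" "p + q < 0"
  shows "F a b M = 0"
  using euler_eigenfunction(1)[OF equivariant_mapsD(1)[OF assms(1)] equivariant_maps_euler[OF assms(1)] assms(2)] .

lemma equivariant_maps_degree_0:
  assumes "F \<in> equivariant_maps d p q" "p + q = 0"
  shows "F a b M = F a b (\<lambda>_. 0)"
  using euler_eigenfunction(2)[OF equivariant_mapsD(1)[OF assms(1)] equivariant_maps_euler[OF assms(1)] assms(2)] .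

lemma equivariant_maps_degree_0_pd:
  assumes "F \<in> equivariant_maps d p q" "p + q = 0"
  shows "pd v (F a b) M = 0"
  by (rule pd_eq_0_if_constant) (rule equivariant_maps_degree_0[OF assms])

text \<open>A constant is annihilated by \<open>polar\<close>, so an entry can be nonzero only where
  its torus weight \<open>p - a + b\<close> vanishes.\<close>

lemma equivariant_maps_degree_0_off_diagonal:
  assumes F: "F \<in> equivariant_maps d p q" and "p + q = 0" "a \<noteq> b + p"
  shows "F a b M = 0"
proof -
  have "of_int (p - a + b) * F a b M = 0"
    using fun_cong[OF equivariant_mapsD(3)[OF F, of a b], of M] equivariant_maps_degree_0_pd[OF assms(1,2)]
    by (simp add: polar_def del: of_int_add of_int_diff)
  then show ?thesis using assms(3) by (simp del: of_int_add of_int_diff)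
qed

text \<open>Schur's lemma for constant maps: along the diagonal the unipotent condition becomes the
  recursion $(b + p) c_b = b c_{b-1}$.\<close>

lemma equivariant_maps_degree_0_step:
  assumes F: "F \<in> equivariant_maps d p q" and "p + q = 0" "0 \<le> b" "b \<le> d"
  shows "of_int (b + p) * F (b + p) b M = of_int b * F (b - 1 + p) (b - 1) M"
proof -
  have "of_int (b + p) * F (b + p - 1 + 1) b M - of_int b * F (b + p - 1) (b - 1) M = 0"
    using fun_cong[OF equivariant_mapsD(5)[OF F assms(3,4), of "b + p - 1"], of M]
      equivariant_maps_degree_0_pd[OF assms(1,2)]
    by (simp add: polar_def)
  then show ?thesis by (simp add: algebra_simps)
qed

text \<open>With c_b the entry at \<open>(b + p, b)\<close>, the recursion (b + p) c_b = b c_{b-1}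
  is run from whichever end starts with zero. For p > 0 it gives p c_0 = 0 and propagates upwards.
  For p < 0 the row index d + p lies beyond the top degree d + 2p, so c_d = 0, and zero propagates
  downwards.\<close>

lemma equivariant_maps_degree_0_eq_0:
  assumes F: "F \<in> equivariant_maps d p q" and pq: "p + q = 0" "p \<noteq> 0"
  shows "F a b M = 0"
proof (cases "a = b + p \<and> 0 \<le> b \<and> b \<le> d \<and> 0 \<le> b + p \<and> b + p \<le> d + p - q")
  case False
  then show ?thesis
    using equivariant_maps_degree_0_off_diagonal[OF F pq(1), of a b]
      fun_cong[OF equivariant_mapsD(2)[OF F, of a b], of M] by blast
next
  case True
  note step = equivariant_maps_degree_0_step[OF F pq(1), of _ M]
  have "F (b + p) b M = 0"
  proof (cases "p > 0")
    case True
    have "b \<le> d \<longrightarrow> F (b + p) b M = 0" if "0 \<le> b"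
      using that
    proof (induction b rule: int_ge_induct)
      case base
      then show ?case using step[of 0] True by auto
    next
      case (step b)
      then show ?case
        using equivariant_maps_degree_0_step[OF F pq(1), of "b + 1" M] True
        by (auto simp del: of_int_add)
    qed
    then show ?thesis using \<open>a = b + p \<and> _\<close> by blast
  next
    case False
    with pq have "p < 0" by simp
    have "0 \<le> b \<longrightarrow> F (b + p) b M = 0" if "b \<le> d"
      using that
    proof (induction b rule: int_le_induct)
      case base
      have "F (d + p) d = (\<lambda>_. 0)" by (rule equivariant_mapsD(2)[OF F]) (use \<open>p < 0\<close> pq in auto)
      then show ?case by simp
    next
      case (step b)
      then show ?case
        using equivariant_maps_degree_0_step[OF F pq(1), of b M]
          equivariant_mapsD(2)[OF F, of "b - 1 + p" "b - 1"] by (cases "b = 0") auto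
    qed
    then show ?thesis using \<open>a = b + p \<and> _\<close> by blast
  qed
  then show ?thesis using True by simp
qed

text \<open>For p = 0 the recursion reads b c_b = b c_{b-1}, so the diagonal entries are all equal
  to the one at \<open>(0, 0)\<close>, the scalar that \<open>psi\<close> will use.\<close>

lemma equivariant_maps_scalar:
  assumes F: "F \<in> equivariant_maps d 0 0"
  shows "F a b M = (if a = b \<and> 0 \<le> b \<and> b \<le> d then F 0 0 (\<lambda>_. 0) else 0)"
proof (cases "a = b \<and> 0 \<le> b \<and> b \<le> d")
  case False
  then show ?thesis
    using equivariant_maps_degree_0_off_diagonal[OF F, of a b]
      fun_cong[OF equivariant_mapsD(2)[OF F, of a b], of M] by (cases "a = b") auto
next
  case True
  have "b \<le> d \<longrightarrow> F b b M = F 0 0 M" if "0 \<le> b"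
    using that
  proof (induction b rule: int_ge_induct)
    case (step b)
    then show ?case
      using equivariant_maps_degree_0_step[OF F, of "b + 1" M] by (auto simp del: of_int_add)
  qed auto
  then show ?thesis using True equivariant_maps_degree_0[OF F, of 0 0 M] by simp
qed

text \<open>By induction on the degree both lowered maps vanish, and the Euler identity recovers
  \<open>F\<close> from them; in degree at most 0 Schur's lemma applies because q < 0 excludes p = q
  = 0. This is the wall that stops the recursion at second row 0.\<close>

lemma equivariant_maps_neg_twist:
  assumes "F \<in> equivariant_maps d p q" "q < 0"
  shows "F a b M = 0"
  using assms
proof (induction "nat (p + q)" arbitrary: F p q a b M)
  case 0
  then have "p + q < 0 \<or> p + q = 0 \<and> p \<noteq> 0" by auto
  then show ?case
    using 0 equivariant_maps_neg_degree equivariant_maps_degree_0_eq_0 by blast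
next
  case (Suc N)
  define e where "e = d + p - q"
  show ?case
  proof (cases "0 \<le> e")
    case False
    then show ?thesis using equivariant_mapsD(2)[OF Suc.prems(1), of a b] by (auto simp: e_def)
  next
    case True
    have "lower_f i e F a b M = 0" for i a b
      using lower_f_equivariant[OF Suc.prems(1)] Suc by (intro Suc(1)[of "p - 1" q]) (auto simp: e_def)
    moreover have "lower_g i F a b M = 0" for i a b
      using lower_g_equivariant[OF Suc.prems(1)] Suc by (intro Suc(1)[of p "q - 1"]) auto
    ultimately have "of_int ((e + 1) * (p + q)) * F a b M = 0"
      by (subst equivariant_maps_lower_sum[OF Suc.prems(1) e_def]) (simp add: raise_f_def raise_g_def)
    moreover have "(e + 1) * (p + q) \<noteq> 0" using True Suc(2) by auto
    ultimately show ?thesis by (simp del: of_int_add of_int_mult)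
  qed
qed

lemma identity_equivariant:
  "(\<lambda>a b _. if a = b \<and> 0 \<le> b \<and> b \<le> d then 1 else 0) \<in>
    (equivariant_maps d 0 0 :: ('a::field_char_0, 'n::finite) coeff_family set)"
proof -
  have "polar u v (\<lambda>_. x) = (\<lambda>_. 0)" for u v and x :: 'a
    by (simp add: polar_def)
  then show ?thesis
    by (auto simp: equivariant_maps_def poly_funs.const fun_eq_iff simp flip: eq_neg_iff_add_eq_0)
qed

section \<open>The path algebra\<close>

context fin_digraph
begin

lemma quiver_paths_iff: "(u, p) \<in> quiver_paths G \<longleftrightarrow> awalk u p (awlast u p)"
  unfolding quiver_paths_def by auto

lemma quiver_paths_append:
  "(u, p @ q) \<in> quiver_paths G \<longleftrightarrow> (u, p) \<in> quiver_paths G \<and> (awlast u p, q) \<in> quiver_paths G"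
  by (simp add: quiver_paths_iff awlast_append awalk_append_iff)

lemma quiver_paths_Nil: "(u, []) \<in> quiver_paths G \<longleftrightarrow> u \<in> verts G"
  by (simp add: quiver_paths_iff awalk_Nil_iff)

lemma quiver_paths_awlast: "(u, p) \<in> quiver_paths G \<Longrightarrow> awlast u p \<in> verts G"
  by (auto simp: quiver_paths_iff)

abbreviation PA :: "('f::field, 'a \<times> 'b list \<Rightarrow> 'f) module" where
  "PA \<equiv> path_algebra G"

lemma path_mult:
  "(x \<otimes>\<^bsub>PA\<^esub> y) (u, p) =
    (\<Sum>k\<le>length p. x (awlast u (take k p), drop k p) * y (u, take k p))"
  by (simp add: path_algebra_def)

lemma path_carrier:
  "x \<in> carrier PA \<longleftrightarrow> finite {\<pi>. x \<pi> \<noteq> 0} \<and> (\<forall>\<pi>. x \<pi> \<noteq> 0 \<longrightarrow> \<pi> \<in> quiver_paths G)"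
  by (auto simp: path_algebra_def)

lemma path_add: "x \<oplus>\<^bsub>PA\<^esub> y = (\<lambda>\<pi>. x \<pi> + y \<pi>)"
  and path_zero: "\<zero>\<^bsub>PA\<^esub> = (\<lambda>_. 0)"
  and path_smult: "s \<odot>\<^bsub>PA\<^esub> x = (\<lambda>\<pi>. s * x \<pi>)"
  and path_one: "\<one>\<^bsub>PA\<^esub> = (\<lambda>(u, p). if u \<in> verts G \<and> p = [] then 1 else 0)"
  by (simp_all add: path_algebra_def)

lemma path_add_closed:
  assumes "x \<in> carrier PA" "y \<in> carrier PA"
  shows "(\<lambda>\<pi>. x \<pi> + y \<pi>) \<in> carrier PA"
proof -
  have "{\<pi>. x \<pi> + y \<pi> \<noteq> 0} \<subseteq> {\<pi>. x \<pi> \<noteq> 0} \<union> {\<pi>. y \<pi> \<noteq> 0}" by auto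
  then show ?thesis using assms unfolding path_carrier by (auto intro: finite_subset)
qed

lemma path_scale_closed:
  assumes "x \<in> carrier PA"
  shows "(\<lambda>\<pi>. s * x \<pi>) \<in> carrier PA"
proof -
  have "{\<pi>. s * x \<pi> \<noteq> 0} \<subseteq> {\<pi>. x \<pi> \<noteq> 0}" by auto
  then show ?thesis using assms unfolding path_carrier by (auto intro: finite_subset)
qed

lemma path_zero_closed: "(\<lambda>_. 0) \<in> carrier PA"
  by (simp add: path_carrier)

lemma path_sum_closed:
  "(\<And>i. i \<in> S \<Longrightarrow> h i \<in> carrier PA) \<Longrightarrow> (\<lambda>\<pi>. \<Sum>i\<in>S. h i \<pi>) \<in> carrier PA"
  by (induction S rule: infinite_finite_induct) (auto intro: path_zero_closed path_add_closed)

lemma path_mult_nonzero: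
  assumes "(x \<otimes>\<^bsub>PA\<^esub> y) (u, p) \<noteq> 0"
  obtains k where "k \<le> length p" "x (awlast u (take k p), drop k p) \<noteq> 0" "y (u, take k p) \<noteq> 0"
proof -
  have "\<exists>k\<in>{..length p}. x (awlast u (take k p), drop k p) * y (u, take k p) \<noteq> 0"
    using assms unfolding path_mult by (meson sum.not_neutral_contains_not_neutral)
  then show ?thesis using that by auto
qed

lemma path_mult_closed:
  assumes x: "x \<in> carrier PA" and y: "y \<in> carrier PA"
  shows "x \<otimes>\<^bsub>PA\<^esub> y \<in> carrier PA"
proof -
  let ?S = "(\<lambda>(\<pi>, \<pi>'). (fst \<pi>', snd \<pi>' @ snd \<pi>)) ` ({\<pi>. x \<pi> \<noteq> 0} \<times> {\<pi>. y \<pi> \<noteq> 0})"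
  have *: "\<pi> \<in> ?S \<and> \<pi> \<in> quiver_paths G" if nz: "(x \<otimes>\<^bsub>PA\<^esub> y) \<pi> \<noteq> 0" for \<pi>
  proof -
    obtain u p where \<pi>: "\<pi> = (u, p)" by force
    then obtain k where k: "x (awlast u (take k p), drop k p) \<noteq> 0" "y (u, take k p) \<noteq> 0"
      using path_mult_nonzero[of x y u p] nz by blast
    then have "(u, take k p @ drop k p) \<in> quiver_paths G"
      unfolding quiver_paths_append using x y by (auto simp: path_carrier)
    moreover have "\<pi> \<in> ?S"
      unfolding \<pi> by (rule image_eqI[of _ _ "((awlast u (take k p), drop k p), (u, take k p))"]) (use k in auto)
    ultimately show ?thesis by (simp add: \<pi>)
  qed
  have "finite ?S" using x y by (simp add: path_carrier)
  then have "finite {\<pi>. (x \<otimes>\<^bsub>PA\<^esub> y) \<pi> \<noteq> 0}"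
    by (rule rev_finite_subset) (use * in blast)
  with * show ?thesis by (simp add: path_carrier)
qed

text \<open>Both sides sum over the ways to cut a path into three pieces; \<open>k\<close> and
  \<open>m\<close> are the lengths of the first two, and the reindexing replaces \<open>m\<close> by
  the second cut point.\<close>

lemma path_mult_assoc: "(x \<otimes>\<^bsub>PA\<^esub> y) \<otimes>\<^bsub>PA\<^esub> z = x \<otimes>\<^bsub>PA\<^esub> (y \<otimes>\<^bsub>PA\<^esub> z)"
proof
  fix \<pi> :: "'a \<times> 'b list"
  obtain u p where \<pi>: "\<pi> = (u, p)" by force
  let ?l = "length p"
  define T where "T k m = x (awlast u (take (k + m) p), drop (k + m) p) *
    y (awlast u (take k p), take m (drop k p)) * z (u, take k p)" for k m
  have last: "awlast (awlast u (take k p)) (take m (drop k p)) = awlast u (take (k + m) p)" for k m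
    by (simp add: take_add awlast_append)
  have "((x \<otimes>\<^bsub>PA\<^esub> y) \<otimes>\<^bsub>PA\<^esub> z) \<pi> = (\<Sum>k\<le>?l. \<Sum>m\<le>?l - k. T k m)"
    unfolding \<pi> path_mult T_def by (simp add: sum_distrib_right last add.commute)
  also have "\<dots> = (\<Sum>(k, m)\<in>Sigma {..?l} (\<lambda>k. {..?l - k}). T k m)"
    by (simp add: sum.Sigma)
  also have "Sigma {..?l} (\<lambda>k. {..?l - k}) = {(k, m). k + m \<le> ?l}" by auto
  also have "(\<Sum>(k, m)\<in>{(k, m). k + m \<le> ?l}. T k m) = (\<Sum>j\<le>?l. \<Sum>k\<le>j. T k (j - k))"
    by (rule sum.triangle_reindex_eq)
  also have "\<dots> = (x \<otimes>\<^bsub>PA\<^esub> (y \<otimes>\<^bsub>PA\<^esub> z)) \<pi>"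
    unfolding \<pi> path_mult T_def
    by (auto simp: sum_distrib_left mult_ac drop_take min_absorb1 min_absorb2 intro!: sum.cong)
  finally show "((x \<otimes>\<^bsub>PA\<^esub> y) \<otimes>\<^bsub>PA\<^esub> z) \<pi> = (x \<otimes>\<^bsub>PA\<^esub> (y \<otimes>\<^bsub>PA\<^esub> z)) \<pi>" .
qed

text \<open>The unit is the sum of the trivial paths; its support is finite because the quiver has
  finitely many vertices.\<close>

lemma path_one_closed: "\<one>\<^bsub>PA\<^esub> \<in> carrier PA"
proof -
  have "{\<pi>. (case \<pi> of (u, p) \<Rightarrow> if u \<in> verts G \<and> p = [] then 1 else (0::'f::field)) \<noteq> 0} \<subseteq>
      verts G \<times> {[]}" by (auto split: if_splits)
  then show ?thesis
    by (auto simp: path_carrier path_one quiver_paths_Nil intro: finite_subset split: if_splits)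
qed

lemma path_one_left:
  assumes "x \<in> carrier PA"
  shows "\<one>\<^bsub>PA\<^esub> \<otimes>\<^bsub>PA\<^esub> x = x"
proof
  fix \<pi> :: "'a \<times> 'b list"
  obtain u p where \<pi>: "\<pi> = (u, p)" by force
  have "(\<one>\<^bsub>PA\<^esub> \<otimes>\<^bsub>PA\<^esub> x) \<pi> =
      (\<Sum>k\<le>length p. if k = length p then (if awlast u p \<in> verts G then x (u, p) else 0) else 0)"
    unfolding \<pi> path_mult by (rule sum.cong) (auto simp: path_one)
  then show "(\<one>\<^bsub>PA\<^esub> \<otimes>\<^bsub>PA\<^esub> x) \<pi> = x \<pi>"
    using assms quiver_paths_awlast[of u p] by (auto simp: path_carrier \<pi>)
qed

lemma path_one_right:
  assumes "x \<in> carrier PA"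
  shows "x \<otimes>\<^bsub>PA\<^esub> \<one>\<^bsub>PA\<^esub> = x"
proof
  fix \<pi> :: "'a \<times> 'b list"
  obtain u p where \<pi>: "\<pi> = (u, p)" by force
  have "(x \<otimes>\<^bsub>PA\<^esub> \<one>\<^bsub>PA\<^esub>) \<pi> =
      (\<Sum>k\<le>length p. if k = 0 then (if u \<in> verts G then x (u, p) else 0) else 0)"
    unfolding \<pi> path_mult by (rule sum.cong) (auto simp: path_one)
  moreover have "u \<in> verts G" if "x (u, p) \<noteq> 0"
    using assms that quiver_paths_append[of u "[]" p] by (auto simp: path_carrier quiver_paths_Nil)
  ultimately show "(x \<otimes>\<^bsub>PA\<^esub> \<one>\<^bsub>PA\<^esub>) \<pi> = x \<pi>"
    by (auto simp: \<pi>)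
qed

lemma path_mult_add_left: "(\<lambda>\<pi>. x \<pi> + y \<pi>) \<otimes>\<^bsub>PA\<^esub> z = (\<lambda>\<pi>. (x \<otimes>\<^bsub>PA\<^esub> z) \<pi> + (y \<otimes>\<^bsub>PA\<^esub> z) \<pi>)"
  and path_mult_add_right: "z \<otimes>\<^bsub>PA\<^esub> (\<lambda>\<pi>. x \<pi> + y \<pi>) = (\<lambda>\<pi>. (z \<otimes>\<^bsub>PA\<^esub> x) \<pi> + (z \<otimes>\<^bsub>PA\<^esub> y) \<pi>)"
  by (auto simp: path_mult distrib_left distrib_right sum.distrib)

lemma path_mult_scale_left: "(\<lambda>\<pi>. s * x \<pi>) \<otimes>\<^bsub>PA\<^esub> y = (\<lambda>\<pi>. s * (x \<otimes>\<^bsub>PA\<^esub> y) \<pi>)"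
  and path_mult_scale_right: "x \<otimes>\<^bsub>PA\<^esub> (\<lambda>\<pi>. s * y \<pi>) = (\<lambda>\<pi>. s * (x \<otimes>\<^bsub>PA\<^esub> y) \<pi>)"
  by (auto simp: path_mult sum_distrib_left mult_ac)

lemma path_mult_diff_left: "(\<lambda>\<pi>. x \<pi> - y \<pi>) \<otimes>\<^bsub>PA\<^esub> z = (\<lambda>\<pi>. (x \<otimes>\<^bsub>PA\<^esub> z) \<pi> - (y \<otimes>\<^bsub>PA\<^esub> z) \<pi>)"
  and path_mult_diff_right: "z \<otimes>\<^bsub>PA\<^esub> (\<lambda>\<pi>. x \<pi> - y \<pi>) = (\<lambda>\<pi>. (z \<otimes>\<^bsub>PA\<^esub> x) \<pi> - (z \<otimes>\<^bsub>PA\<^esub> y) \<pi>)"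
  by (auto simp: path_mult left_diff_distrib right_diff_distrib sum_subtractf)

lemma path_mult_zero_right: "z \<otimes>\<^bsub>PA\<^esub> (\<lambda>_. 0) = (\<lambda>_. 0)"
  by (auto simp: path_mult)

lemma path_mult_sum_right: "z \<otimes>\<^bsub>PA\<^esub> (\<lambda>\<pi>. \<Sum>i\<in>S. h i \<pi>) = (\<lambda>\<pi>. \<Sum>i\<in>S. (z \<otimes>\<^bsub>PA\<^esub> h i) \<pi>)"
  by (induction S rule: infinite_finite_induct)
    (simp_all add: path_mult_zero_right path_mult_add_right)

lemma path_algebra_ring: "ring (PA :: ('f::field, 'a \<times> 'b list \<Rightarrow> 'f) module)"
proof (rule ringI)
  show "abelian_group (PA :: ('f, _) module)"
  proof (rule abelian_groupI)
    show "\<exists>y\<in>carrier PA. y \<oplus>\<^bsub>PA\<^esub> x = \<zero>\<^bsub>PA\<^esub>" if "x \<in> carrier PA" for x :: "_ \<Rightarrow> 'f"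
      by (rule bexI[OF _ path_scale_closed[OF that, of "-1"]]) (simp add: path_add path_zero)
  qed (auto simp: path_add path_zero path_add_closed path_zero_closed add_ac)
  show "Group.monoid (PA :: ('f, _) module)"
    by (rule Group.monoidI)
      (simp_all add: path_mult_closed path_one_closed path_mult_assoc path_one_left path_one_right)
qed (simp_all add: path_add path_mult_add_left path_mult_add_right)

text \<open>Subtraction in a ring record is defined through additive inverses, so its pointwise form
  holds only on the carrier.\<close>

lemma path_minus:
  assumes "x \<in> carrier PA" "y \<in> carrier PA"
  shows "x \<ominus>\<^bsub>PA\<^esub> y = (\<lambda>\<pi>. x \<pi> - y \<pi>)"
proof -
  interpret R: ring "PA :: ('c, 'a \<times> 'b list \<Rightarrow> 'c) module" by (rule path_algebra_ring)
  have "\<ominus>\<^bsub>PA\<^esub> y = (\<lambda>\<pi>. - 1 * y \<pi>)"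
    by (rule R.minus_equality[OF _ assms(2) path_scale_closed[OF assms(2)]])
      (simp add: path_add path_zero)
  then show ?thesis by (simp add: a_minus_def path_add)
qed

definition single_path :: "'a \<times> 'b list \<Rightarrow> 'a \<times> 'b list \<Rightarrow> 'f::field" where
  "single_path \<pi> = (\<lambda>\<pi>'. if \<pi>' = \<pi> then 1 else 0)"

lemma single_path_closed: "\<pi> \<in> quiver_paths G \<Longrightarrow> single_path \<pi> \<in> carrier PA"
  by (auto simp: path_carrier single_path_def)

lemma arrow_closed: "e \<in> arcs G \<Longrightarrow> arrow G e \<in> carrier PA"
  using single_path_closed[of "(tail G e, [e])"]
  by (simp add: single_path_def arrow_def quiver_paths_iff awalk_def)

text \<open>The left factor is traversed last while lists store arrows in order of traversal, so
  left multiplication by an arrow acts at the end of the list.\<close>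

lemma arrow_mult:
  "(arrow G e \<otimes>\<^bsub>PA\<^esub> x) (u, p) =
    (if p \<noteq> [] \<and> last p = e \<and> awlast u (butlast p) = tail G e then x (u, butlast p) else 0)"
proof -
  have *: "drop k p = [e] \<longleftrightarrow> p \<noteq> [] \<and> k = length p - 1 \<and> last p = e" if "k \<le> length p" for k
  proof
    assume e: "drop k p = [e]"
    then have "p = take k p @ [e]" by (metis append_take_drop_id)
    moreover have "length p - k = 1" using e by (metis length_drop length_Cons list.size(3) One_nat_def)
    ultimately show "p \<noteq> [] \<and> k = length p - 1 \<and> last p = e"
      using that by (metis Nil_is_append_conv diff_diff_cancel last_snoc not_Cons_self2)
  next
    assume e: "p \<noteq> [] \<and> k = length p - 1 \<and> last p = e"
    then show "drop k p = [e]"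
      by (metis append_butlast_last_id append_eq_conv_conj length_butlast)
  qed
  have "(arrow G e \<otimes>\<^bsub>PA\<^esub> x) (u, p) = (\<Sum>k\<le>length p. if k = length p - 1 then
      (if p \<noteq> [] \<and> last p = e \<and> awlast u (butlast p) = tail G e then x (u, butlast p) else 0) else 0)"
    unfolding path_mult by (rule sum.cong) (auto simp: arrow_def * butlast_conv_take)
  then show ?thesis by simp
qed

lemma arrow_mult_single:
  assumes "awlast u p = tail G e"
  shows "arrow G e \<otimes>\<^bsub>PA\<^esub> single_path (u, p) = single_path (u, p @ [e])"
proof
  fix \<pi>' :: "'a \<times> 'b list"
  obtain v q where "\<pi>' = (v, q)" by force
  then show "(arrow G e \<otimes>\<^bsub>PA\<^esub> single_path (u, p)) \<pi>' = (single_path (u, p @ [e]) \<pi>' :: 'c)"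
    using assms by (cases q rule: rev_cases) (auto simp: arrow_mult single_path_def)
qed

end

section \<open>The tilting quiver and its relations\<close>

lemma finite_young: "finite (young m)"
proof -
  have "young m \<subseteq> {..m} \<times> {..m}" by (auto simp: young_def)
  then show ?thesis by (rule finite_subset) simp
qed

interpretation TQ: fin_digraph
  "tilting_quiver :: (nat \<times> nat, (nat \<times> nat) \<times> nat \<times> 'n::finite) pre_digraph"
proof
  let ?A = "young (CARD('n) - 2) \<times> {1, 2} \<times> (UNIV :: 'n set)"
  have "arcs (tilting_quiver :: (nat \<times> nat, (nat \<times> nat) \<times> nat \<times> 'n) pre_digraph) \<subseteq> ?A"
    by (auto simp: tilting_quiver_def)
  then show "finite (arcs (tilting_quiver :: (nat \<times> nat, (nat \<times> nat) \<times> nat \<times> 'n) pre_digraph))"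
    by (rule finite_subset) (simp add: finite_young)
qed (auto simp: tilting_quiver_def finite_young)

lemma tilting_quiver_sel:
  "verts (tilting_quiver :: (nat \<times> nat, (nat \<times> nat) \<times> nat \<times> 'n::finite) pre_digraph) =
    young (CARD('n) - 2)"
  "tail tilting_quiver (lam, i, \<rho>) = lam"
  "head tilting_quiver (lam, i, \<rho>) = add_e lam i"
  by (simp_all add: tilting_quiver_def)

lemma tilting_arcs_iff:
  "(lam, i, \<rho> :: 'n::finite) \<in> arcs tilting_quiver \<longleftrightarrow>
    i \<in> {1, 2} \<and> lam \<in> young (CARD('n) - 2) \<and> add_e lam i \<in> young (CARD('n) - 2)"
  by (auto simp: tilting_quiver_def)

lemma add_e_simps: "add_e lam 1 = (fst lam + 1, snd lam)" "add_e lam 2 = (fst lam, snd lam + 1)"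
  "add_e lam (Suc 0) = (fst lam + 1, snd lam)"
  by (simp_all add: add_e_def)

abbreviation TP :: "('a::field, ('a, 'n::finite) path_element) module" where
  "TP \<equiv> path_algebra tilting_quiver"

definition fmul :: "nat \<times> nat \<Rightarrow> 'n::finite \<Rightarrow> ('a::field, 'n) path_element \<Rightarrow> ('a, 'n) path_element" where
  "fmul lam i x = arrow tilting_quiver (lam, 1, i) \<otimes>\<^bsub>TP\<^esub> x"

definition gmul :: "nat \<times> nat \<Rightarrow> 'n::finite \<Rightarrow> ('a::field, 'n) path_element \<Rightarrow> ('a, 'n) path_element" where
  "gmul lam i x = arrow tilting_quiver (lam, 2, i) \<otimes>\<^bsub>TP\<^esub> x"

definition tilting_ideal :: "('a::field, 'n::finite) path_element set" where
  "tilting_ideal = Idl\<^bsub>TP\<^esub> tilting_relations"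

lemma fmul_arrow_closed:
  assumes "lam \<in> young (CARD('n) - 2)" "fst lam + 1 \<le> CARD('n::finite) - 2"
  shows "arrow tilting_quiver (lam, 1, i :: 'n) \<in> carrier TP"
  using assms by (intro TQ.arrow_closed) (auto simp: tilting_arcs_iff add_e_simps young_def)

lemma gmul_arrow_closed:
  assumes "lam \<in> young (CARD('n) - 2)" "snd lam + 1 \<le> fst lam"
  shows "arrow tilting_quiver (lam, 2, i :: 'n::finite) \<in> carrier TP"
  using assms by (intro TQ.arrow_closed) (auto simp: tilting_arcs_iff add_e_simps young_def)

lemma fmul_closed:
  assumes "lam \<in> young (CARD('n) - 2)" "fst lam + 1 \<le> CARD('n::finite) - 2" "x \<in> carrier TP"
  shows "fmul lam (i :: 'n) x \<in> carrier TP"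
  unfolding fmul_def by (intro TQ.path_mult_closed fmul_arrow_closed assms)

lemma gmul_closed:
  assumes "lam \<in> young (CARD('n) - 2)" "snd lam + 1 \<le> fst lam" "x \<in> carrier TP"
  shows "gmul lam (i :: 'n::finite) x \<in> carrier TP"
  unfolding gmul_def by (intro TQ.path_mult_closed gmul_arrow_closed assms)

lemma fmul_linear:
  "fmul lam i (\<lambda>\<pi>. x \<pi> + y \<pi>) = (\<lambda>\<pi>. fmul lam i x \<pi> + fmul lam i y \<pi>)"
  "fmul lam i (\<lambda>\<pi>. x \<pi> - y \<pi>) = (\<lambda>\<pi>. fmul lam i x \<pi> - fmul lam i y \<pi>)"
  "fmul lam i (\<lambda>\<pi>. s * x \<pi>) = (\<lambda>\<pi>. s * fmul lam i x \<pi>)"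
  "fmul lam i (\<lambda>\<pi>. \<Sum>k\<in>S. h k \<pi>) = (\<lambda>\<pi>. \<Sum>k\<in>S. fmul lam i (h k) \<pi>)"
  "fmul lam i (\<lambda>_. 0) = (\<lambda>_. 0)"
  unfolding fmul_def
  by (rule TQ.path_mult_add_right TQ.path_mult_diff_right TQ.path_mult_scale_right
      TQ.path_mult_sum_right TQ.path_mult_zero_right)+

lemma gmul_linear:
  "gmul lam i (\<lambda>\<pi>. x \<pi> + y \<pi>) = (\<lambda>\<pi>. gmul lam i x \<pi> + gmul lam i y \<pi>)"
  "gmul lam i (\<lambda>\<pi>. x \<pi> - y \<pi>) = (\<lambda>\<pi>. gmul lam i x \<pi> - gmul lam i y \<pi>)"
  "gmul lam i (\<lambda>\<pi>. s * x \<pi>) = (\<lambda>\<pi>. s * gmul lam i x \<pi>)"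
  "gmul lam i (\<lambda>\<pi>. \<Sum>k\<in>S. h k \<pi>) = (\<lambda>\<pi>. \<Sum>k\<in>S. gmul lam i (h k) \<pi>)"
  "gmul lam i (\<lambda>_. 0) = (\<lambda>_. 0)"
  unfolding gmul_def
  by (rule TQ.path_mult_add_right TQ.path_mult_diff_right TQ.path_mult_scale_right
      TQ.path_mult_sum_right TQ.path_mult_zero_right)+

text \<open>This and the next lemmas resolve the case distinction of \<open>K_set\<close> and
  replace ring subtraction by the pointwise one, which is why the arrows involved have to
  exist.\<close>

lemma K_set_ff:
  "(K_set lam (fst lam + 2, snd lam) :: ('a::field, 'n::finite) path_element set) = {(\<lambda>\<pi>.
      fmul (fst lam + 1, snd lam) j (arrow tilting_quiver (lam, 1, i)) \<pi> -
      fmul (fst lam + 1, snd lam) i (arrow tilting_quiver (lam, 1, j)) \<pi>) | i j. True}"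
  if "lam \<in> young (CARD('n) - 2)" "fst lam + 2 \<le> CARD('n) - 2"
  for lam :: "nat \<times> nat"
proof -
  have "(farr (add_e lam 1) j \<otimes>\<^bsub>TP\<^esub> (farr lam i :: ('a, 'n) path_element)) \<ominus>\<^bsub>TP\<^esub> (farr (add_e lam 1) i \<otimes>\<^bsub>TP\<^esub> farr lam j) =
      (\<lambda>\<pi>. fmul (fst lam + 1, snd lam) j (arrow tilting_quiver (lam, 1, i)) \<pi> -
      fmul (fst lam + 1, snd lam) i (arrow tilting_quiver (lam, 1, j)) \<pi>)" for i j :: 'n
    unfolding farr_def add_e_simps fmul_def
    by (rule TQ.path_minus)
      (use that in \<open>auto intro!: TQ.path_mult_closed fmul_arrow_closed simp: young_def simp del: One_nat_def\<close>)
  then show ?thesis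
    by (simp add: K_set_def tilting_path_algebra_def Let_def del: One_nat_def)
qed

lemma K_set_gg:
  "(K_set lam (fst lam, snd lam + 2) :: ('a::field, 'n::finite) path_element set) = {(\<lambda>\<pi>.
      gmul (fst lam, snd lam + 1) j (arrow tilting_quiver (lam, 2, i)) \<pi> -
      gmul (fst lam, snd lam + 1) i (arrow tilting_quiver (lam, 2, j)) \<pi>) | i j. True}"
  if "lam \<in> young (CARD('n) - 2)" "snd lam + 2 \<le> fst lam"
  for lam :: "nat \<times> nat"
proof -
  have "(garr (add_e lam 2) j \<otimes>\<^bsub>TP\<^esub> (garr lam i :: ('a, 'n) path_element)) \<ominus>\<^bsub>TP\<^esub> (garr (add_e lam 2) i \<otimes>\<^bsub>TP\<^esub> garr lam j) =
      (\<lambda>\<pi>. gmul (fst lam, snd lam + 1) j (arrow tilting_quiver (lam, 2, i)) \<pi> -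
      gmul (fst lam, snd lam + 1) i (arrow tilting_quiver (lam, 2, j)) \<pi>)" for i j :: 'n
    unfolding garr_def add_e_simps gmul_def
    by (rule TQ.path_minus)
      (use that in \<open>auto intro!: TQ.path_mult_closed gmul_arrow_closed simp: young_def simp del: One_nat_def\<close>)
  then show ?thesis
    by (simp add: K_set_def tilting_path_algebra_def Let_def del: One_nat_def)
qed

lemma K_set_gf_diagonal:
  "(K_set lam (fst lam + 1, snd lam + 1) :: ('a::field, 'n::finite) path_element set) = {(\<lambda>\<pi>.
      gmul (fst lam + 1, snd lam) j (arrow tilting_quiver (lam, 1, i)) \<pi> +
      gmul (fst lam + 1, snd lam) i (arrow tilting_quiver (lam, 1, j)) \<pi>) | i j. True}"
  if "fst lam = snd lam"
  for lam :: "nat \<times> nat"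
  using that
  by (simp add: K_set_def tilting_path_algebra_def Let_def TQ.path_add farr_def garr_def
      add_e_simps gmul_def)

lemma K_set_gf:
  "(K_set lam (fst lam + 1, snd lam + 1) :: ('a::field, 'n::finite) path_element set) = {(\<lambda>\<pi>.
      of_nat (fst lam - snd lam) * gmul (fst lam + 1, snd lam) j (arrow tilting_quiver (lam, 1, i)) \<pi> -
      of_nat (fst lam - snd lam + 1) * fmul (fst lam, snd lam + 1) i (arrow tilting_quiver (lam, 2, j)) \<pi> +
      fmul (fst lam, snd lam + 1) j (arrow tilting_quiver (lam, 2, i)) \<pi>) | i j. True}"
  if "lam \<in> young (CARD('n) - 2)" "fst lam + 1 \<le> CARD('n) - 2" "snd lam + 1 \<le> fst lam"
  for lam :: "nat \<times> nat"
proof -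
  let ?d = "fst lam - snd lam"
  have "(of_nat ?d \<odot>\<^bsub>TP\<^esub> (garr (add_e lam 1) j \<otimes>\<^bsub>TP\<^esub> (farr lam i :: ('a, 'n) path_element)))
      \<ominus>\<^bsub>TP\<^esub> (of_nat (?d + 1) \<odot>\<^bsub>TP\<^esub> (farr (add_e lam 2) i \<otimes>\<^bsub>TP\<^esub> garr lam j)) =
     (\<lambda>\<pi>. of_nat ?d * gmul (fst lam + 1, snd lam) j (arrow tilting_quiver (lam, 1, i)) \<pi> -
      of_nat (?d + 1) * fmul (fst lam, snd lam + 1) i (arrow tilting_quiver (lam, 2, j)) \<pi>)"
    for i j :: 'n
    unfolding farr_def garr_def add_e_simps gmul_def fmul_def TQ.path_smult
    by (rule TQ.path_minus)
      (use that in \<open>auto intro!: TQ.path_scale_closed TQ.path_mult_closed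
        gmul_arrow_closed fmul_arrow_closed simp: young_def simp del: One_nat_def\<close>)
  moreover have "farr (add_e lam 2) j \<otimes>\<^bsub>TP\<^esub> (garr lam i :: ('a, 'n) path_element) =
      fmul (fst lam, snd lam + 1) j (arrow tilting_quiver (lam, 2, i))" for i j :: 'n
    by (simp add: farr_def garr_def add_e_simps fmul_def)
  ultimately show ?thesis
    using that by (simp add: K_set_def tilting_path_algebra_def Let_def TQ.path_add del: One_nat_def of_nat_add)
qed

lemma P2_cases:
  assumes "(lam, \<mu>) \<in> P2 m"
  obtains "lam \<in> young m" "fst lam + 2 \<le> m" "\<mu> = (fst lam + 2, snd lam)"
  | "lam \<in> young m" "snd lam + 2 \<le> fst lam" "\<mu> = (fst lam, snd lam + 2)"
  | "lam \<in> young m" "fst lam + 1 \<le> m" "fst lam = snd lam" "\<mu> = (fst lam + 1, snd lam + 1)"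
  | "lam \<in> young m" "fst lam + 1 \<le> m" "snd lam + 1 \<le> fst lam" "\<mu> = (fst lam + 1, snd lam + 1)"
proof -
  obtain a b c d where [simp]: "lam = (a, b)" "\<mu> = (c, d)" by (metis surj_pair)
  from assms have "c = a + 2 \<and> d = b \<or> c = a \<and> d = b + 2 \<or> c = a + 1 \<and> d = b + 1"
    by (auto simp: P2_def)
  with assms that show ?thesis by (auto simp: P2_def young_def) linarith+
qed

lemma tilting_relations_closed:
  "(tilting_relations :: ('a::field, 'n::finite) path_element set) \<subseteq> carrier TP"
proof
  fix r :: "('a, 'n) path_element"
  assume "r \<in> tilting_relations"
  then obtain lam \<mu> where P2: "(lam, \<mu>) \<in> P2 (CARD('n) - 2)" and r: "r \<in> K_set lam \<mu>"
    by (auto simp: tilting_relations_def)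
  have diff: "(\<lambda>\<pi>. x \<pi> - y \<pi>) \<in> carrier TP" if "x \<in> carrier TP" "y \<in> carrier TP"
    for x y :: "('a, 'n) path_element"
    using TQ.path_add_closed[OF that(1) TQ.path_scale_closed[OF that(2), of "-1"]] by simp
  note closed = diff TQ.path_add_closed TQ.path_scale_closed fmul_closed gmul_closed
    fmul_arrow_closed gmul_arrow_closed
  from P2 show "r \<in> carrier TP"
  proof (cases rule: P2_cases)
    case 1
    with r show ?thesis
      unfolding 1(3) K_set_ff[OF 1(1-2)]
      by (auto simp: young_def simp del: One_nat_def intro!: closed)
  next
    case 2
    with r show ?thesis
      unfolding 2(3) K_set_gg[OF 2(1-2)]
      by (auto simp: young_def simp del: One_nat_def intro!: closed)
  next
    case 3
    with r show ?thesis
      unfolding 3(4) K_set_gf_diagonal[OF 3(3)]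
      by (auto simp: young_def simp del: One_nat_def intro!: closed)
  next
    case 4
    with r show ?thesis
      unfolding 4(4) K_set_gf[OF 4(1-3)]
      by (auto simp: young_def simp del: One_nat_def intro!: closed)
  qed
qed

lemma tilting_ideal: "ideal (tilting_ideal :: ('a::field, 'n::finite) path_element set) TP"
  unfolding tilting_ideal_def
  by (rule ring.genideal_ideal[OF TQ.path_algebra_ring tilting_relations_closed])

lemma tilting_relation_mult:
  fixes x :: "('a::field, 'n::finite) path_element"
  assumes "(lam, \<mu>) \<in> P2 (CARD('n) - 2)" "r \<in> K_set lam \<mu>" "x \<in> carrier TP"
  shows "r \<otimes>\<^bsub>TP\<^esub> x \<in> tilting_ideal"
proof -
  have "r \<in> tilting_relations" using assms by (auto simp: tilting_relations_def)
  then have "r \<in> tilting_ideal"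
    using ring.genideal_self[OF TQ.path_algebra_ring tilting_relations_closed]
    by (auto simp: tilting_ideal_def)
  then show ?thesis using ideal.I_r_closed[OF tilting_ideal] assms(3) by blast
qed

lemma tilting_ideal_subset: "tilting_ideal \<subseteq> carrier TP"
  by (meson additive_subgroup.a_subset ideal.axioms(1) tilting_ideal)

lemma tilting_ideal_add:
  "x \<in> tilting_ideal \<Longrightarrow> y \<in> tilting_ideal \<Longrightarrow> (\<lambda>\<pi>. x \<pi> + y \<pi>) \<in> tilting_ideal"
  using additive_subgroup.a_closed[OF ideal.axioms(1)[OF tilting_ideal]] by (simp add: TQ.path_add)

lemma tilting_ideal_zero: "(\<lambda>_. 0) \<in> tilting_ideal"
  using additive_subgroup.zero_closed[OF ideal.axioms(1)[OF tilting_ideal]] by (simp add: TQ.path_zero)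

text \<open>Ideals of a ring know nothing of scalars; scaling by \<open>s\<close> is multiplication
  by \<open>s\<close> times the unit, which lies in the path algebra.\<close>

lemma tilting_ideal_scale:
  assumes "x \<in> tilting_ideal"
  shows "(\<lambda>\<pi>. s * x \<pi>) \<in> tilting_ideal"
proof -
  have x: "x \<in> carrier TP" using assms tilting_ideal_subset by blast
  have "(\<lambda>\<pi>. s * \<one>\<^bsub>TP\<^esub> \<pi>) \<otimes>\<^bsub>TP\<^esub> x \<in> tilting_ideal"
    by (rule ideal.I_l_closed[OF tilting_ideal assms]) (rule TQ.path_scale_closed[OF TQ.path_one_closed])
  then show ?thesis by (simp add: TQ.path_mult_scale_left TQ.path_one_left[OF x])
qed

lemma tilting_ideal_sum:
  "(\<And>i. i \<in> S \<Longrightarrow> h i \<in> tilting_ideal) \<Longrightarrow> (\<lambda>\<pi>. \<Sum>i\<in>S. h i \<pi>) \<in> tilting_ideal"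
  by (induction S rule: infinite_finite_induct) (auto intro: tilting_ideal_zero tilting_ideal_add)

lemma tilting_ideal_fmul:
  assumes "lam \<in> young (CARD('n) - 2)" "fst lam + 1 \<le> CARD('n::finite) - 2" "x \<in> tilting_ideal"
  shows "fmul lam (i :: 'n) x \<in> tilting_ideal"
  unfolding fmul_def by (rule ideal.I_l_closed[OF tilting_ideal assms(3) fmul_arrow_closed[OF assms(1,2)]])

lemma tilting_ideal_gmul:
  assumes "lam \<in> young (CARD('n) - 2)" "snd lam + 1 \<le> fst lam" "x \<in> tilting_ideal"
  shows "gmul lam (i :: 'n::finite) x \<in> tilting_ideal"
  unfolding gmul_def by (rule ideal.I_l_closed[OF tilting_ideal assms(3) gmul_arrow_closed[OF assms(1,2)]])

text \<open>Relations in operator form, valid on any element \<open>x\<close>. The induction applies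
  them to the value of \<open>psi\<close> on a lowered map.\<close>

lemma relation_ff:
  fixes x :: "('a::field, 'n::finite) path_element"
  assumes "lam \<in> young (CARD('n) - 2)" "fst lam + 2 \<le> CARD('n) - 2" "x \<in> carrier TP"
  shows "(\<lambda>\<pi>. fmul (fst lam + 1, snd lam) j (fmul lam i x) \<pi> -
    fmul (fst lam + 1, snd lam) i (fmul lam j x) \<pi>) \<in> tilting_ideal"
proof -
  have "(lam, (fst lam + 2, snd lam)) \<in> P2 (CARD('n) - 2)"
    using assms by (auto simp: P2_def young_def prod_eq_iff)
  then have "(\<lambda>\<pi>. fmul (fst lam + 1, snd lam) j (arrow tilting_quiver (lam, 1, i)) \<pi> -
      fmul (fst lam + 1, snd lam) i (arrow tilting_quiver (lam, 1, j)) \<pi>) \<otimes>\<^bsub>TP\<^esub> x \<in> tilting_ideal"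
    by (rule tilting_relation_mult) (unfold K_set_ff[OF assms(1,2)], use assms in auto)
  then show ?thesis
    by (simp only: TQ.path_mult_diff_left fmul_def TQ.path_mult_assoc)
qed

lemma relation_gg:
  fixes x :: "('a::field, 'n::finite) path_element"
  assumes "lam \<in> young (CARD('n) - 2)" "snd lam + 2 \<le> fst lam" "x \<in> carrier TP"
  shows "(\<lambda>\<pi>. gmul (fst lam, snd lam + 1) j (gmul lam i x) \<pi> -
    gmul (fst lam, snd lam + 1) i (gmul lam j x) \<pi>) \<in> tilting_ideal"
proof -
  have "(lam, (fst lam, snd lam + 2)) \<in> P2 (CARD('n) - 2)"
    using assms by (auto simp: P2_def young_def prod_eq_iff)
  then have "(\<lambda>\<pi>. gmul (fst lam, snd lam + 1) j (arrow tilting_quiver (lam, 2, i)) \<pi> -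
      gmul (fst lam, snd lam + 1) i (arrow tilting_quiver (lam, 2, j)) \<pi>) \<otimes>\<^bsub>TP\<^esub> x \<in> tilting_ideal"
    by (rule tilting_relation_mult) (unfold K_set_gg[OF assms(1,2)], use assms in auto)
  then show ?thesis
    by (simp only: TQ.path_mult_diff_left gmul_def TQ.path_mult_assoc)
qed

lemma relation_gf_diagonal:
  fixes x :: "('a::field, 'n::finite) path_element"
  assumes "lam \<in> young (CARD('n) - 2)" "fst lam + 1 \<le> CARD('n) - 2" "fst lam = snd lam" "x \<in> carrier TP"
  shows "(\<lambda>\<pi>. gmul (fst lam + 1, snd lam) j (fmul lam i x) \<pi> +
    gmul (fst lam + 1, snd lam) i (fmul lam j x) \<pi>) \<in> tilting_ideal"
proof -
  have "(lam, (fst lam + 1, snd lam + 1)) \<in> P2 (CARD('n) - 2)"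
    using assms by (auto simp: P2_def young_def prod_eq_iff)
  then have "(\<lambda>\<pi>. gmul (fst lam + 1, snd lam) j (arrow tilting_quiver (lam, 1, i)) \<pi> +
      gmul (fst lam + 1, snd lam) i (arrow tilting_quiver (lam, 1, j)) \<pi>) \<otimes>\<^bsub>TP\<^esub> x \<in> tilting_ideal"
    by (rule tilting_relation_mult) (unfold K_set_gf_diagonal[OF assms(3)], use assms in auto)
  then show ?thesis
    by (simp only: TQ.path_mult_add_left gmul_def fmul_def TQ.path_mult_assoc)
qed

lemma relation_gf:
  fixes x :: "('a::field, 'n::finite) path_element"
  assumes "lam \<in> young (CARD('n) - 2)" "fst lam + 1 \<le> CARD('n) - 2" "snd lam + 1 \<le> fst lam"
    "x \<in> carrier TP"
  shows "(\<lambda>\<pi>. of_nat (fst lam - snd lam) * gmul (fst lam + 1, snd lam) j (fmul lam i x) \<pi> -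
    of_nat (fst lam - snd lam + 1) * fmul (fst lam, snd lam + 1) i (gmul lam j x) \<pi> +
    fmul (fst lam, snd lam + 1) j (gmul lam i x) \<pi>) \<in> tilting_ideal"
proof -
  have "(lam, (fst lam + 1, snd lam + 1)) \<in> P2 (CARD('n) - 2)"
    using assms by (auto simp: P2_def young_def prod_eq_iff)
  then have "(\<lambda>\<pi>. of_nat (fst lam - snd lam) * gmul (fst lam + 1, snd lam) j (arrow tilting_quiver (lam, 1, i)) \<pi> -
      of_nat (fst lam - snd lam + 1) * fmul (fst lam, snd lam + 1) i (arrow tilting_quiver (lam, 2, j)) \<pi> +
      fmul (fst lam, snd lam + 1) j (arrow tilting_quiver (lam, 2, i)) \<pi>) \<otimes>\<^bsub>TP\<^esub> x \<in> tilting_ideal"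
    by (rule tilting_relation_mult) (unfold K_set_gf[OF assms(1-3)], use assms in auto)
  then show ?thesis
    by (simp only: TQ.path_mult_add_left TQ.path_mult_diff_left TQ.path_mult_scale_left
        gmul_def fmul_def TQ.path_mult_assoc)
qed

section \<open>From equivariant maps to the path algebra\<close>

definition level :: "nat \<times> nat \<Rightarrow> int" where
  "level mu = int (fst mu) - int (snd mu)"

text \<open>The weights are the differences of the row lengths, so the degree \<open>p + q\<close>
  of a map is the number of arrows on any path from \<open>lam\<close> to \<open>mu\<close>.\<close>

definition hom_maps :: "nat \<times> nat \<Rightarrow> nat \<times> nat \<Rightarrow> ('a::field_char_0, 'n::finite) coeff_family set" where
  "hom_maps lam mu =
     equivariant_maps (level lam) (int (fst mu) - int (fst lam)) (int (snd mu) - int (snd lam))"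

lemma hom_maps_level:
  "level lam + (int (fst mu) - int (fst lam)) - (int (snd mu) - int (snd lam)) = level mu"
  by (simp add: level_def)

lemma lower_f_hom_maps:
  assumes "F \<in> hom_maps lam mu" "snd mu < fst mu"
  shows "lower_f i (level mu) F \<in> hom_maps lam (fst mu - 1, snd mu)"
  using lower_f_equivariant[of F "level lam" "int (fst mu) - int (fst lam)" "int (snd mu) - int (snd lam)" i] assms
  unfolding hom_maps_level hom_maps_def by (simp add: of_nat_diff algebra_simps)

lemma lower_g_hom_maps:
  assumes "F \<in> hom_maps lam mu" "0 < snd mu"
  shows "lower_g i F \<in> hom_maps lam (fst mu, snd mu - 1)"
  using lower_g_equivariant[of F "level lam" "int (fst mu) - int (fst lam)" "int (snd mu) - int (snd lam)" i] assms
  unfolding hom_maps_def by (simp add: of_nat_diff algebra_simps)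

lemma raise_f_hom_maps:
  assumes "F \<in> hom_maps lam mu"
  shows "raise_f j F \<in> hom_maps lam (fst mu + 1, snd mu)"
  using raise_f_equivariant[of F "level lam" "int (fst mu) - int (fst lam)" "int (snd mu) - int (snd lam)" j] assms
  unfolding hom_maps_def by (simp add: algebra_simps)

lemma raise_g_hom_maps:
  assumes "F \<in> hom_maps lam mu"
  shows "raise_g j (level mu) F \<in> hom_maps lam (fst mu, snd mu + 1)"
  using raise_g_equivariant[of F "level lam" "int (fst mu) - int (fst lam)" "int (snd mu) - int (snd lam)" j] assms
  unfolding hom_maps_level hom_maps_def by (simp add: algebra_simps)

text \<open>The target would be forms of degree -1. Together with the next lemma this makes both
  branches of the recursion stop by themselves at the walls of the Young diagrams.\<close>

lemma lower_f_eq_0: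
  assumes "F \<in> hom_maps lam mu" "fst mu = snd mu"
  shows "lower_f i (level mu) F = (\<lambda>_ _ _. 0)"
proof -
  have "lower_f i (level mu) F a b = (\<lambda>_. 0)" for a b
    using equivariant_mapsD(2)[OF lower_f_equivariant[OF assms(1)[unfolded hom_maps_def]], of a b i] assms(2)
    unfolding hom_maps_level by (simp add: level_def)
  then show ?thesis by (intro ext) simp
qed

lemma lower_g_eq_0:
  assumes "F \<in> hom_maps lam mu" "snd mu = 0"
  shows "lower_g i F = (\<lambda>_ _ _. 0)"
  by (intro ext equivariant_maps_neg_twist[OF lower_g_equivariant[OF assms(1)[unfolded hom_maps_def]]])
    (use assms(2) in simp)

lemma hom_maps_poly_funs: "F \<in> hom_maps lam mu \<Longrightarrow> F a b \<in> poly_funs"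
  unfolding hom_maps_def by (rule equivariant_mapsD(1))

text \<open>The coefficient is the inverse of (e + 1)(p + q) in the Euler identity, with e =
  \<open>level mu\<close> and p + q = \<open>N + 1\<close>. In degree 0 a map is a scalar if
  \<open>lam = mu\<close> and zero otherwise.\<close>

fun psi :: "nat \<Rightarrow> nat \<times> nat \<Rightarrow> nat \<times> nat \<Rightarrow> ('a::field_char_0, 'n::finite) coeff_family \<Rightarrow>
    ('a, 'n) path_element" where
  "psi 0 lam mu F = (\<lambda>\<pi>. (if lam = mu then F 0 0 (\<lambda>_. 0) else 0) * TQ.single_path (lam, []) \<pi>)"
| "psi (Suc N) lam mu F = (\<lambda>\<pi>. inverse (of_int ((level mu + 1) * (int N + 1))) *
     (\<Sum>i\<in>UNIV. fmul (fst mu - 1, snd mu) i (psi N lam (fst mu - 1, snd mu) (lower_f i (level mu) F)) \<pi> +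
       gmul (fst mu, snd mu - 1) i (psi N lam (fst mu, snd mu - 1) (lower_g i F)) \<pi>))"

lemma lower_f_poly_funs: "(\<And>a b. F a b \<in> poly_funs) \<Longrightarrow> lower_f i e F a b \<in> poly_funs"
  unfolding lower_f_def by (intro poly_funs_closed pd_poly_funs)

lemma lower_g_poly_funs: "(\<And>a b. F a b \<in> poly_funs) \<Longrightarrow> lower_g i F a b \<in> poly_funs"
  unfolding lower_g_def by (intro poly_funs_closed pd_poly_funs)

lemma raise_f_poly_funs: "(\<And>a b. F a b \<in> poly_funs) \<Longrightarrow> raise_f i F a b \<in> poly_funs"
  unfolding raise_f_def by (intro poly_funs_closed)

lemma raise_g_poly_funs: "(\<And>a b. F a b \<in> poly_funs) \<Longrightarrow> raise_g i e F a b \<in> poly_funs"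
  unfolding raise_g_def by (intro poly_funs_closed)

lemma psi_add:
  assumes "\<And>a b. F a b \<in> poly_funs" "\<And>a b. G a b \<in> poly_funs"
  shows "psi N lam mu (\<lambda>a b M. F a b M + G a b M) = (\<lambda>\<pi>. psi N lam mu F \<pi> + psi N lam mu G \<pi>)"
  using assms
proof (induction N arbitrary: mu F G)
  case (Suc N)
  have "lower_f i e (\<lambda>a b M. F a b M + G a b M) = (\<lambda>a b M. lower_f i e F a b M + lower_f i e G a b M)"
    "lower_g i (\<lambda>a b M. F a b M + G a b M) = (\<lambda>a b M. lower_g i F a b M + lower_g i G a b M)" for i e
    unfolding lower_f_def lower_g_def by (simp_all add: pd_add Suc.prems algebra_simps)
  then show ?case
    by (simp add: Suc.IH Suc.prems lower_f_poly_funs lower_g_poly_funs fmul_linear gmul_linear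
        sum.distrib distrib_left add_ac)
qed (auto simp: algebra_simps)

lemma psi_cmult:
  assumes "\<And>a b. F a b \<in> poly_funs"
  shows "psi N lam mu (\<lambda>a b M. s * F a b M) = (\<lambda>\<pi>. s * psi N lam mu F \<pi>)"
  using assms
proof (induction N arbitrary: mu F)
  case (Suc N)
  have "lower_f i e (\<lambda>a b M. s * F a b M) = (\<lambda>a b M. s * lower_f i e F a b M)"
    "lower_g i (\<lambda>a b M. s * F a b M) = (\<lambda>a b M. s * lower_g i F a b M)" for i e
    unfolding lower_f_def lower_g_def by (simp_all add: pd_cmult Suc.prems algebra_simps)
  then show ?case
    by (simp add: Suc.IH Suc.prems lower_f_poly_funs lower_g_poly_funs fmul_linear gmul_linear
        sum_distrib_left distrib_left mult_ac)
qed (auto simp: algebra_simps)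

lemma psi_zero: "psi N lam mu (\<lambda>_ _ _. 0) = (\<lambda>_. 0)"
  using psi_cmult[of "\<lambda>_ _ _. 0" N lam mu 0] by (simp add: poly_funs.const)

lemma psi_sum:
  "(\<And>k a b. k \<in> S \<Longrightarrow> F k a b \<in> poly_funs) \<Longrightarrow>
    psi N lam mu (\<lambda>a b M. \<Sum>k\<in>S. F k a b M) = (\<lambda>\<pi>. \<Sum>k\<in>S. psi N lam mu (F k) \<pi>)"
  by (induction S rule: infinite_finite_induct) (simp_all add: psi_zero psi_add poly_funs_sum)

text \<open>At a wall the truncated subtraction in \<open>psi\<close> names a vertex from which no
  suitable arrow need start; the lowered map is then zero, and so is its contribution.\<close>

lemma psi_closed:
  fixes F :: "('a::field_char_0, 'n::finite) coeff_family"
  assumes "F \<in> hom_maps lam mu" "lam \<in> young (CARD('n) - 2)" "mu \<in> young (CARD('n) - 2)"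
  shows "psi N lam mu F \<in> carrier TP"
  using assms(1,3)
proof (induction N arbitrary: mu F)
  case 0
  have "TQ.single_path (lam, []) \<in> carrier (TP :: ('a, ('a, 'n) path_element) module)"
    by (rule TQ.single_path_closed) (simp add: TQ.quiver_paths_Nil tilting_quiver_sel assms(2))
  then show ?case by (simp add: TQ.path_scale_closed)
next
  case (Suc N)
  let ?A = "\<lambda>i. psi N lam (fst mu - 1, snd mu) (lower_f i (level mu) F)"
  let ?B = "\<lambda>i. psi N lam (fst mu, snd mu - 1) (lower_g i F)"
  have "fmul (fst mu - 1, snd mu) i (?A i) \<in> carrier TP" for i
  proof (cases "snd mu < fst mu")
    case True
    then have Y: "(fst mu - 1, snd mu) \<in> young (CARD('n) - 2)" using Suc.prems(2) by (auto simp: young_def)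
    have "?A i \<in> carrier TP" by (rule Suc.IH[OF lower_f_hom_maps[OF Suc.prems(1) True] Y])
    then show ?thesis
      using Y Suc.prems(2) True by (intro fmul_closed) (auto simp: young_def)
  next
    case False
    then have "fst mu = snd mu" using Suc.prems by (auto simp: young_def)
    then show ?thesis
      by (simp add: lower_f_eq_0[OF Suc.prems(1)] psi_zero fmul_linear TQ.path_zero_closed)
  qed
  moreover have "gmul (fst mu, snd mu - 1) i (?B i) \<in> carrier TP" for i
  proof (cases "0 < snd mu")
    case True
    then have Y: "(fst mu, snd mu - 1) \<in> young (CARD('n) - 2)" using Suc.prems(2) by (auto simp: young_def)
    have "?B i \<in> carrier TP" by (rule Suc.IH[OF lower_g_hom_maps[OF Suc.prems(1) True] Y])
    then show ?thesis
      using Y Suc.prems(2) True by (intro gmul_closed) (auto simp: young_def)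
  next
    case False
    then show ?thesis
      by (simp add: lower_g_eq_0[OF Suc.prems(1)] psi_zero gmul_linear TQ.path_zero_closed)
  qed
  ultimately show ?case
    unfolding psi.simps by (intro TQ.path_scale_closed TQ.path_sum_closed TQ.path_add_closed)
qed

text \<open>Read backwards, \<open>raise_lower_sum\<close> trades the bracket of derivatives for
  raised lowered maps. The right-hand side then contains only \<open>F\<close> itself and maps to
  which the induction hypothesis of \<open>psi_raise\<close> applies.\<close>

lemma lower_f_raise_f':
  fixes F :: "('a::field_char_0, 'n::finite) coeff_family"
  assumes "\<And>a b. F a b \<in> poly_funs" "e + 1 \<noteq> 0"
  shows "lower_f i (e + 1) (raise_f j F) = (\<lambda>a b M. (if i = j then of_int (e + 2) else 0) * F a b M +
    (of_int (e + 2) / of_int (e + 1) * raise_f j (lower_f i e F) a b M +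
      1 / of_int (e + 1) * raise_g j (e + 1) (lower_g i F) a b M))"
proof (intro ext)
  fix a b M
  let ?E = "M (j, False) * pd (i, False) (F a b) M + M (j, True) * pd (i, True) (F a b) M"
  have "of_int (e + 1) \<noteq> (0 :: 'a)" using assms(2) by (simp only: of_int_eq_0_iff not_False_eq_True)
  have E: "?E = (raise_f j (lower_f i e F) a b M + raise_g j (e + 1) (lower_g i F) a b M) / of_int (e + 1)"
    unfolding raise_lower_sum by (rule nonzero_mult_div_cancel_left[OF \<open>of_int (e + 1) \<noteq> 0\<close>, symmetric])
  have e2: "of_int (e + 2) = of_int (e + 1) + (1 :: 'a)" by simp
  have "of_int (e + 2) / of_int (e + 1) = 1 + 1 / (of_int (e + 1) :: 'a)"
    unfolding e2 by (simp only: add_divide_distrib divide_self[OF \<open>of_int (e + 1) \<noteq> 0\<close>])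
  then show "lower_f i (e + 1) (raise_f j F) a b M = (if i = j then of_int (e + 2) else 0) * F a b M +
    (of_int (e + 2) / of_int (e + 1) * raise_f j (lower_f i e F) a b M +
      1 / of_int (e + 1) * raise_g j (e + 1) (lower_g i F) a b M)"
    unfolding lower_f_raise_f[of F, OF assms(1)] E by (simp add: add_divide_distrib distrib_right)
qed

lemma lower_g_raise_g':
  fixes F :: "('a::field_char_0, 'n::finite) coeff_family"
  assumes "\<And>a b. F a b \<in> poly_funs" "e + 1 \<noteq> 0"
  shows "lower_g i (raise_g j e F) = (\<lambda>a b M. (if i = j then of_int e else 0) * F a b M +
    (of_int e / of_int (e + 1) * raise_g j (e + 1) (lower_g i F) a b M +
      (- 1 / of_int (e + 1)) * raise_f j (lower_f i e F) a b M))"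
proof (intro ext)
  fix a b M
  let ?E = "M (j, False) * pd (i, False) (F a b) M + M (j, True) * pd (i, True) (F a b) M"
  have "of_int (e + 1) \<noteq> (0 :: 'a)" using assms(2) by (simp only: of_int_eq_0_iff not_False_eq_True)
  have E: "?E = (raise_f j (lower_f i e F) a b M + raise_g j (e + 1) (lower_g i F) a b M) / of_int (e + 1)"
    unfolding raise_lower_sum by (rule nonzero_mult_div_cancel_left[OF \<open>of_int (e + 1) \<noteq> 0\<close>, symmetric])
  have e2: "of_int e = of_int (e + 1) - (1 :: 'a)" by simp
  have "of_int e / of_int (e + 1) = 1 - 1 / (of_int (e + 1) :: 'a)"
    unfolding e2 by (simp only: diff_divide_distrib divide_self[OF \<open>of_int (e + 1) \<noteq> 0\<close>])
  then show "lower_g i (raise_g j e F) a b M = (if i = j then of_int e else 0) * F a b M +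
    (of_int e / of_int (e + 1) * raise_g j (e + 1) (lower_g i F) a b M +
      (- 1 / of_int (e + 1)) * raise_f j (lower_f i e F) a b M)"
    unfolding lower_g_raise_g[of F, OF assms(1)] E by (simp add: add_divide_distrib left_diff_distrib)
qed

lemma inverse_mult_diff: "C \<noteq> 0 \<Longrightarrow> inverse C * (A - C * G) = inverse C * A - G" for C :: "'a::field"
  by (simp add: right_diff_distrib flip: mult.assoc)

text \<open>The scalar arithmetic of the induction step, with E the level and L = N. Writing A, B
  for \<open>psi\<close> of the lowered maps, X, Y, Z, U, V stand for f_i f_j A, f_j f_i A, f_j g_i
  B, f_i g_j B, g_i f_j B, and G for f_j \<open>psi\<close> F. The result exhibits the two
  relations.\<close>

lemma recursion_step_f:
  fixes X Y Z U V r s t :: "'n::finite \<Rightarrow> 'a::field_char_0"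
  assumes "E + 1 \<noteq> 0" "E + 2 \<noteq> 0" "L + 1 \<noteq> 0" "L + 2 \<noteq> 0"
    and G: "G = inverse ((E + 1) * (L + 1)) * (\<Sum>i\<in>UNIV. Y i + Z i)"
  shows "inverse ((E + 2) * (L + 2)) * (\<Sum>i\<in>UNIV. ((if i = j then (E + 2) * G else 0) +
      ((E + 2) / (E + 1) * (X i + r i) + 1 / (E + 1) * (U i + s i))) + (V i + t i)) - G =
    inverse ((E + 2) * (L + 2)) * (\<Sum>i\<in>UNIV. ((E + 2) / (E + 1) * (X i - Y i) +
      1 / (E + 1) * ((E + 1) * V i - (E + 2) * Z i + U i)) +
      ((E + 2) / (E + 1) * r i + 1 / (E + 1) * s i + t i))"
proof -
  define x y z u v r' s' t' where "x = sum X UNIV" "y = sum Y UNIV" "z = sum Z UNIV" "u = sum U UNIV"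
    "v = sum V UNIV" "r' = sum r UNIV" "s' = sum s UNIV" "t' = sum t UNIV"
  note defs = this
  have G': "G = (y + z) / ((E + 1) * (L + 1))"
    unfolding G by (simp add: sum.distrib defs divide_inverse mult.commute)
  have "(E + 2) * G + ((E + 2) / (E + 1) * (x + r') + 1 / (E + 1) * (u + s')) + (v + t') -
      ((E + 2) * (L + 2)) * G =
     ((E + 2) / (E + 1) * (x - y) + 1 / (E + 1) * ((E + 1) * v - (E + 2) * z + u)) +
      ((E + 2) / (E + 1) * r' + 1 / (E + 1) * s' + t')"
  proof -
    \<comment> \<open>The diagonal term supplies one of the L + 2 copies of (E + 2) G; the remaining
      L + 1 cancel the factor L + 1 in the denominator of \<open>G\<close>.\<close>
    have "(E + 2) * G - ((E + 2) * (L + 2)) * G = - ((E + 2) * ((L + 1) * G))" by (simp add: algebra_simps)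
    also have "(L + 1) * G = (y + z) / (E + 1)" unfolding G' using assms(3) by simp
    finally have "(E + 2) * G - ((E + 2) * (L + 2)) * G = - ((E + 2) * ((y + z) / (E + 1)))" .
    moreover have "1 / (E + 1) * ((E + 1) * v - (E + 2) * z + u) = v - (E + 2) * (z / (E + 1)) + u / (E + 1)"
      using assms(1) by (simp add: add_divide_distrib diff_divide_distrib del: distrib_right_numeral)
    ultimately show ?thesis
      by (simp add: algebra_simps add_divide_distrib diff_divide_distrib)
  qed
  then have "inverse ((E + 2) * (L + 2)) * ((E + 2) * G + ((E + 2) / (E + 1) * (x + r') + 1 / (E + 1) * (u + s')) + (v + t') -
      ((E + 2) * (L + 2)) * G) = inverse ((E + 2) * (L + 2)) *
     (((E + 2) / (E + 1) * (x - y) + 1 / (E + 1) * ((E + 1) * v - (E + 2) * z + u)) +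
      ((E + 2) / (E + 1) * r' + 1 / (E + 1) * s' + t'))" by simp
  moreover have "inverse ((E + 2) * (L + 2)) * (A - ((E + 2) * (L + 2)) * G) =
      inverse ((E + 2) * (L + 2)) * A - G" for A
    using assms(2,4) by (intro inverse_mult_diff) simp
  ultimately show ?thesis
    by (simp only: sum.distrib sum_subtractf defs sum_distrib_left[symmetric] sum.delta finite UNIV_I if_True)
qed

text \<open>The same for g_j: now X, Y, Z, U, V stand for g_i g_j B, g_j f_i A, g_j g_i B, f_i g_j
  A, g_i f_j A.\<close>

lemma recursion_step_g:
  fixes X Y Z U V r s t :: "'n::finite \<Rightarrow> 'a::field_char_0"
  assumes "E + 1 \<noteq> 0" "E \<noteq> 0" "L + 1 \<noteq> 0" "L + 2 \<noteq> 0"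
    and G: "G = inverse ((E + 1) * (L + 1)) * (\<Sum>i\<in>UNIV. Y i + Z i)"
  shows "inverse (E * (L + 2)) * (\<Sum>i\<in>UNIV. (U i + t i) + ((if i = j then E * G else 0) +
      (E / (E + 1) * (X i + s i) + (- 1 / (E + 1)) * (V i + r i)))) - G =
    inverse (E * (L + 2)) * (\<Sum>i\<in>UNIV. (E / (E + 1) * (X i - Z i) +
      (1 / (E + 1)) * ((E + 1) * U i - V i - E * Y i)) +
      (E / (E + 1) * s i + (- 1 / (E + 1)) * r i + t i))"
proof -
  define x y z u v r' s' t' where "x = sum X UNIV" "y = sum Y UNIV" "z = sum Z UNIV" "u = sum U UNIV"
    "v = sum V UNIV" "r' = sum r UNIV" "s' = sum s UNIV" "t' = sum t UNIV"
  note defs = this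
  have G': "G = (y + z) / ((E + 1) * (L + 1))"
    unfolding G by (simp add: sum.distrib defs divide_inverse mult.commute)
  have "(u + t') + (E * G + (E / (E + 1) * (x + s') + (- 1 / (E + 1)) * (v + r'))) - (E * (L + 2)) * G =
      (E / (E + 1) * (x - z) + (1 / (E + 1)) * ((E + 1) * u - v - E * y)) +
      (E / (E + 1) * s' + (- 1 / (E + 1)) * r' + t')"
  proof -
    have "E * G - (E * (L + 2)) * G = - (E * ((L + 1) * G))" by (simp add: algebra_simps)
    also have "(L + 1) * G = (y + z) / (E + 1)" unfolding G' using assms(3) by simp
    finally have "E * G - (E * (L + 2)) * G = - (E * ((y + z) / (E + 1)))" .
    moreover have "1 / (E + 1) * ((E + 1) * u - v - E * y) = u - v / (E + 1) - E * (y / (E + 1))"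
      using assms(1) by (simp add: add_divide_distrib diff_divide_distrib del: distrib_right_numeral)
    ultimately show ?thesis
      by (simp add: algebra_simps add_divide_distrib diff_divide_distrib)
  qed
  then have "inverse (E * (L + 2)) * ((u + t') + (E * G + (E / (E + 1) * (x + s') + (- 1 / (E + 1)) * (v + r'))) - (E * (L + 2)) * G) =
      inverse (E * (L + 2)) * ((E / (E + 1) * (x - z) + (1 / (E + 1)) * ((E + 1) * u - v - E * y)) +
      (E / (E + 1) * s' + (- 1 / (E + 1)) * r' + t'))" by simp
  moreover have "inverse (E * (L + 2)) * (A - (E * (L + 2)) * G) = inverse (E * (L + 2)) * A - G" for A
    using assms(2,4) by (intro inverse_mult_diff) simp
  ultimately show ?thesis
    by (simp only: sum.distrib sum_subtractf defs sum_distrib_left[symmetric] sum.delta finite UNIV_I if_True)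
qed

text \<open>
  The induction step expands both sides by the recursion of \<open>psi\<close>; their difference is a sum of
  multiples of the defining relations and of the errors \<open>r\<close>, \<open>s\<close>, \<open>t\<close> of the induction hypothesis.
\<close>

lemma psi_raise:
  fixes F :: "('a::field_char_0, 'n::finite) coeff_family"
  assumes "F \<in> hom_maps lam mu" "lam \<in> young (CARD('n) - 2)" "mu \<in> young (CARD('n) - 2)"
    and "int (fst mu) - int (fst lam) + (int (snd mu) - int (snd lam)) = int N"
  shows "\<forall>j. (fst mu + 1 \<le> CARD('n) - 2 \<longrightarrow>
      (\<lambda>\<pi>. psi (Suc N) lam (fst mu + 1, snd mu) (raise_f j F) \<pi> - fmul mu j (psi N lam mu F) \<pi>)
        \<in> tilting_ideal) \<and>
    (snd mu + 1 \<le> fst mu \<longrightarrow>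
      (\<lambda>\<pi>. psi (Suc N) lam (fst mu, snd mu + 1) (raise_g j (level mu) F) \<pi> - gmul mu j (psi N lam mu F) \<pi>)
        \<in> tilting_ideal)"
  using assms(1,3,4)
proof (induction N arbitrary: mu F)
  case 0
  let ?e = "level mu"
  have pf: "F a b \<in> poly_funs" for a b by (rule hom_maps_poly_funs[OF "0.prems"(1)])
  have pd: "pd v (F a b) M = 0" for v a b M
    by (rule equivariant_maps_degree_0_pd[OF "0.prems"(1)[unfolded hom_maps_def]]) (use "0.prems"(3) in simp)
  \<comment> \<open>A map of degree 0 is constant, so of the commutators only the term with i = j
    survives. Its factor cancels the coefficient of \<open>psi\<close>, and the congruence is an
    equality.\<close>
  have lower: "lower_f i e F = (\<lambda>_ _ _. 0)" "lower_g i F = (\<lambda>_ _ _. 0)" for i e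
    unfolding lower_f_def lower_g_def by (simp_all add: pd)
  show ?case
  proof (intro allI conjI impI)
    fix j :: 'n
    assume 1: "fst mu + 1 \<le> CARD('n) - 2"
    have e: "of_int (?e + 2) \<noteq> (0 :: 'a)" using "0.prems"(2) by (simp add: level_def young_def del: of_int_add of_int_diff)
    define dl where "dl i = (if i = j then of_int (?e + 2) else (0 :: 'a))" for i :: 'n
    have l1: "lower_f i (?e + 1) (raise_f j F) = (\<lambda>a b M. dl i * F a b M)" for i
      by (intro ext, subst lower_f_raise_f[of F, OF pf]) (simp add: pd lower raise_f_def dl_def)
    have l2: "lower_g i (raise_f j F) = (\<lambda>_ _ _. 0)" for i
      by (simp only: lower_g_raise_f[of F, OF pf] lower) (simp add: raise_f_def)
    have lev: "level (fst mu + 1, snd mu) = ?e + 1" and c: "(?e + 1 + 1) * (int 0 + 1) = ?e + 2"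
      by (simp_all add: level_def)
    have dl: "(\<Sum>i\<in>UNIV. dl i * h i) = of_int (?e + 2) * h j" for h
    proof -
      have "(\<Sum>i\<in>UNIV. dl i * h i) = (\<Sum>i\<in>UNIV. if i = j then of_int (?e + 2) * h i else 0)"
        by (rule sum.cong) (auto simp: dl_def)
      then show ?thesis by (simp del: of_int_add)
    qed
    have "psi (Suc 0) lam (fst mu + 1, snd mu) (raise_f j F) \<pi> =
        inverse (of_int (?e + 2)) * (of_int (?e + 2) * fmul mu j (psi 0 lam mu F) \<pi>)" for \<pi>
      by (subst psi.simps(2))
        (simp only: lev c fst_conv snd_conv add_diff_cancel_right' prod.collapse l1 l2
          psi_cmult[of F, OF pf] psi_zero fmul_linear gmul_linear add_0_right dl)
    then have "(\<lambda>\<pi>. psi (Suc 0) lam (fst mu + 1, snd mu) (raise_f j F) \<pi> - fmul mu j (psi 0 lam mu F) \<pi>) = (\<lambda>_. 0)"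
      using e by (intro ext) (simp del: psi.simps of_int_add)
    then show "(\<lambda>\<pi>. psi (Suc 0) lam (fst mu + 1, snd mu) (raise_f j F) \<pi> - fmul mu j (psi 0 lam mu F) \<pi>) \<in> tilting_ideal"
      by (simp only: tilting_ideal_zero)
  next
    fix j :: 'n
    assume 2: "snd mu + 1 \<le> fst mu"
    have e: "of_int ?e \<noteq> (0 :: 'a)" using 2 by (simp add: level_def del: of_int_diff)
    define dl where "dl i = (if i = j then of_int ?e else (0 :: 'a))" for i :: 'n
    have l1: "lower_g i (raise_g j ?e F) = (\<lambda>a b M. dl i * F a b M)" for i
      by (intro ext, subst lower_g_raise_g[of F, OF pf]) (simp add: pd lower raise_g_def dl_def)
    have l2: "lower_f i (?e - 1) (raise_g j ?e F) = (\<lambda>_ _ _. 0)" for i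
      by (simp only: lower_f_raise_g[of F, OF pf] lower) (simp add: raise_g_def)
    have lev: "level (fst mu, snd mu + 1) = ?e - 1" and c: "(?e - 1 + 1) * (int 0 + 1) = ?e"
      by (simp_all add: level_def)
    have dl: "(\<Sum>i\<in>UNIV. dl i * h i) = of_int ?e * h j" for h
    proof -
      have "(\<Sum>i\<in>UNIV. dl i * h i) = (\<Sum>i\<in>UNIV. if i = j then of_int ?e * h i else 0)"
        by (rule sum.cong) (auto simp: dl_def)
      then show ?thesis by simp
    qed
    have "psi (Suc 0) lam (fst mu, snd mu + 1) (raise_g j ?e F) \<pi> =
        inverse (of_int ?e) * (of_int ?e * gmul mu j (psi 0 lam mu F) \<pi>)" for \<pi>
      by (subst psi.simps(2))
        (simp only: lev c fst_conv snd_conv add_diff_cancel_right' prod.collapse l1 l2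
          psi_cmult[of F, OF pf] psi_zero fmul_linear gmul_linear add_0_left dl)
    then have "(\<lambda>\<pi>. psi (Suc 0) lam (fst mu, snd mu + 1) (raise_g j ?e F) \<pi> - gmul mu j (psi 0 lam mu F) \<pi>) = (\<lambda>_. 0)"
      using e by (intro ext) (simp del: psi.simps)
    then show "(\<lambda>\<pi>. psi (Suc 0) lam (fst mu, snd mu + 1) (raise_g j ?e F) \<pi> - gmul mu j (psi 0 lam mu F) \<pi>) \<in> tilting_ideal"
      by (simp only: tilting_ideal_zero)
  qed
next
  case (Suc N)
  let ?m = "CARD('n) - 2"
  let ?e = "level mu"
  note F = Suc.prems(1) and mu = Suc.prems(2)
  note IH1 = Suc.IH[THEN spec, THEN conjunct1, rule_format]
  note IH2 = Suc.IH[THEN spec, THEN conjunct2, rule_format]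
  have pf: "F a b \<in> poly_funs" for a b by (rule hom_maps_poly_funs[OF F])
  have pfs: "lower_f i e F a b \<in> poly_funs" "lower_g i F a b \<in> poly_funs" for i e a b
    by (rule lower_f_poly_funs[of F, OF pf], rule lower_g_poly_funs[of F, OF pf])
  have mu': "snd mu \<le> fst mu" "fst mu \<le> ?m" using mu by (auto simp: young_def)
  have e0: "?e + 1 \<noteq> 0" "?e + 2 \<noteq> 0" using mu' by (auto simp: level_def)
  have ne: "of_int ?e + 1 \<noteq> (0::'a)" "of_int ?e + 2 \<noteq> (0::'a)"
    using e0 of_int_eq_0_iff[of "?e + 1", where 'a = 'a] of_int_eq_0_iff[of "?e + 2", where 'a = 'a] by simp_all
  have nN: "of_nat N + 1 \<noteq> (0::'a)" "of_nat N + 2 \<noteq> (0::'a)"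
    using of_nat_eq_0_iff[of "N + 1", where 'a = 'a] of_nat_eq_0_iff[of "N + 2", where 'a = 'a] by (simp_all add: add_ac)
  define muf where "muf = (fst mu - 1, snd mu)"
  define mug where "mug = (fst mu, snd mu - 1)"
  define A where "A i = psi N lam muf (lower_f i ?e F)" for i
  define B where "B i = psi N lam mug (lower_g i F)" for i
  \<comment> \<open>Wherever a lowered vertex falls outside the quiver, the corresponding map is
    zero. The case distinctions below serve to avoid relations and induction hypotheses at such
    vertices.\<close>
  have A0: "A i = (\<lambda>_. 0)" and Af0: "lower_f i ?e F = (\<lambda>_ _ _. 0)" if "\<not> snd mu < fst mu" for i
    using lower_f_eq_0[OF F] that mu' by (auto simp: A_def psi_zero)
  have B0: "B i = (\<lambda>_. 0)" and Bg0: "lower_g i F = (\<lambda>_ _ _. 0)" if "\<not> 0 < snd mu" for i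
    using lower_g_eq_0[OF F] that by (auto simp: B_def psi_zero)
  have muf: "muf \<in> young ?m" "lower_f i ?e F \<in> hom_maps lam muf" "fst muf + 1 = fst mu" "snd muf = snd mu"
    "level muf = ?e - 1" "(fst muf + 1, snd muf) = mu"
    "int (fst muf) - int (fst lam) + (int (snd muf) - int (snd lam)) = int N"
    if "snd mu < fst mu" for i
    using mu' that Suc.prems(3) lower_f_hom_maps[OF F that, of i]
    by (auto simp: muf_def young_def level_def)
  have mug: "mug \<in> young ?m" "lower_g i F \<in> hom_maps lam mug" "snd mug + 1 = snd mu" "fst mug = fst mu"
    "level mug = ?e + 1" "(fst mug, snd mug + 1) = mu"
    "int (fst mug) - int (fst lam) + (int (snd mug) - int (snd lam)) = int N"
    if "0 < snd mu" for i
    using mu' that Suc.prems(3) lower_g_hom_maps[OF F that, of i]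
    by (auto simp: mug_def young_def level_def)
  have Ac: "A i \<in> carrier TP" if "snd mu < fst mu" for i
    unfolding A_def by (rule psi_closed[OF muf(2)[OF that] assms(2) muf(1)[OF that]])
  have Bc: "B i \<in> carrier TP" if "0 < snd mu" for i
    unfolding B_def by (rule psi_closed[OF mug(2)[OF that] assms(2) mug(1)[OF that]])
  have rec: "psi (Suc N) lam mu F = (\<lambda>\<pi>. inverse ((of_int ?e + 1) * (of_nat N + 1)) *
      (\<Sum>i\<in>UNIV. fmul muf i (A i) \<pi> + gmul mug i (B i) \<pi>))"
    by (simp add: A_def B_def muf_def mug_def)
  {
  fix j :: 'n
  define r where "r i \<pi> = psi (Suc N) lam mu (raise_f j (lower_f i ?e F)) \<pi> - fmul muf j (A i) \<pi>" for i \<pi>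
  define s where "s i \<pi> = psi (Suc N) lam mu (raise_g j (?e + 1) (lower_g i F)) \<pi> - gmul mug j (B i) \<pi>" for i \<pi>
  have rI: "r i \<in> tilting_ideal" for i
  proof (cases "snd mu < fst mu")
    case True
    note m = muf[OF True]
    have "(\<lambda>\<pi>. psi (Suc N) lam (fst muf + 1, snd muf) (raise_f j (lower_f i ?e F)) \<pi> -
        fmul muf j (psi N lam muf (lower_f i ?e F)) \<pi>) \<in> tilting_ideal"
      by (rule IH1) (use m mu' in simp_all)
    then show ?thesis unfolding m(6) A_def[symmetric] r_def[symmetric] .
  next
    case False
    have "raise_f j (lower_f i ?e F) = (\<lambda>_ _ _. 0)" unfolding Af0[OF False] by (simp add: raise_f_def)
    then have "r i = (\<lambda>_. 0)" by (intro ext) (simp add: r_def A0[OF False] psi_zero fmul_linear del: psi.simps)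
    then show ?thesis by (simp add: tilting_ideal_zero)
  qed
  have sI: "s i \<in> tilting_ideal" for i
  proof (cases "0 < snd mu")
    case True
    note m = mug[OF True]
    have "(\<lambda>\<pi>. psi (Suc N) lam (fst mug, snd mug + 1) (raise_g j (level mug) (lower_g i F)) \<pi> -
        gmul mug j (psi N lam mug (lower_g i F)) \<pi>) \<in> tilting_ideal"
      by (rule IH2) (use m mu' True in simp_all)
    then show ?thesis unfolding m(6) m(5) B_def[symmetric] s_def[symmetric] .
  next
    case False
    have "raise_g j (?e + 1) (lower_g i F) = (\<lambda>_ _ _. 0)" unfolding Bg0[OF False] by (simp add: raise_g_def)
    then have "s i = (\<lambda>_. 0)" by (intro ext) (simp add: s_def B0[OF False] psi_zero gmul_linear del: psi.simps)
    then show ?thesis by (simp add: tilting_ideal_zero)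
  qed
  have R: "psi (Suc N) lam mu (raise_f j (lower_f i ?e F)) = (\<lambda>\<pi>. fmul muf j (A i) \<pi> + r i \<pi>)"
    and S: "psi (Suc N) lam mu (raise_g j (?e + 1) (lower_g i F)) = (\<lambda>\<pi>. gmul mug j (B i) \<pi> + s i \<pi>)" for i
    by (simp_all add: r_def s_def fun_eq_iff del: psi.simps)
  {
    assume 1: "fst mu + 1 \<le> ?m"
    define mufg where "mufg = (fst mu + 1, snd mu - 1)"
    define t where "t i \<pi> = psi (Suc N) lam mufg (raise_f j (lower_g i F)) \<pi> - fmul mug j (B i) \<pi>" for i \<pi>
    have mufg: "mufg \<in> young ?m" "(fst mug + 1, snd mug) = mufg" "snd mufg + 1 \<le> fst mufg"
      if "0 < snd mu"
      using 1 mu' that by (auto simp: mufg_def mug_def young_def)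
    have tI: "t i \<in> tilting_ideal" for i
    proof (cases "0 < snd mu")
      case True
      note m = mug[OF True]
      have "(\<lambda>\<pi>. psi (Suc N) lam (fst mug + 1, snd mug) (raise_f j (lower_g i F)) \<pi> -
          fmul mug j (psi N lam mug (lower_g i F)) \<pi>) \<in> tilting_ideal"
        by (rule IH1) (use m mu' 1 True in simp_all)
      then show ?thesis unfolding mufg(2)[OF True] B_def[symmetric] t_def[symmetric] .
    next
      case False
      have "raise_f j (lower_g i F) = (\<lambda>_ _ _. 0)" unfolding Bg0[OF False] by (simp add: raise_f_def)
      then have "t i = (\<lambda>_. 0)" by (intro ext) (simp add: t_def B0[OF False] psi_zero fmul_linear del: psi.simps)
      then show ?thesis by (simp add: tilting_ideal_zero)
    qed
    have T: "psi (Suc N) lam mufg (raise_f j (lower_g i F)) = (\<lambda>\<pi>. fmul mug j (B i) \<pi> + t i \<pi>)" for i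
      by (simp add: t_def fun_eq_iff del: psi.simps)
    define ff where "ff i \<pi> = fmul mu i (fmul muf j (A i)) \<pi> - fmul mu j (fmul muf i (A i)) \<pi>" for i \<pi>
    define gf where "gf i \<pi> = (of_int ?e + 1) * gmul mufg i (fmul mug j (B i)) \<pi> -
      (of_int ?e + 2) * fmul mu j (gmul mug i (B i)) \<pi> + fmul mu i (gmul mug j (B i)) \<pi>" for i \<pi>
    have ffI: "ff i \<in> tilting_ideal" for i
    proof (cases "snd mu < fst mu")
      case True
      note m = muf[OF True]
      have "(\<lambda>\<pi>. fmul (fst muf + 1, snd muf) i (fmul muf j (A i)) \<pi> -
          fmul (fst muf + 1, snd muf) j (fmul muf i (A i)) \<pi>) \<in> tilting_ideal"
        by (rule relation_ff) (use m 1 Ac True in auto)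
      then show ?thesis unfolding m(6) ff_def[symmetric] .
    next
      case False
      then have "ff i = (\<lambda>_. 0)" by (intro ext) (simp add: ff_def A0 fmul_linear)
      then show ?thesis by (simp add: tilting_ideal_zero)
    qed
    have gfI: "gf i \<in> tilting_ideal" for i
    proof (cases "0 < snd mu")
      case True
      note m = mug[OF True]
      \<comment> \<open>Removing a box from the second row raises the level to e + 1, so the
        coefficients d and d + 1 of relation (iv) are e + 1 and e + 2.\<close>
      have lev: "of_nat (fst mug - snd mug) = of_int ?e + (1 :: 'a)"
        "of_nat (fst mug - snd mug + 1) = of_int ?e + (2 :: 'a)"
        using mu' True by (auto simp: mug_def level_def of_nat_diff)
      have "(\<lambda>\<pi>. of_nat (fst mug - snd mug) * gmul (fst mug + 1, snd mug) i (fmul mug j (B i)) \<pi> -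
          of_nat (fst mug - snd mug + 1) * fmul (fst mug, snd mug + 1) j (gmul mug i (B i)) \<pi> +
          fmul (fst mug, snd mug + 1) i (gmul mug j (B i)) \<pi>) \<in> tilting_ideal"
        by (rule relation_gf) (use m mu' 1 Bc True in auto)
      then show ?thesis unfolding m(6) lev mufg(2)[OF True] gf_def[symmetric] .
    next
      case False
      then have "gf i = (\<lambda>_. 0)" by (intro ext) (simp add: gf_def B0 fmul_linear gmul_linear)
      then show ?thesis by (simp add: tilting_ideal_zero)
    qed
    have lev: "level (fst mu + 1, snd mu) = ?e + 1" by (simp add: level_def)
    have step: "psi (Suc (Suc N)) lam (fst mu + 1, snd mu) (raise_f j F) \<pi> - fmul mu j (psi (Suc N) lam mu F) \<pi> =
      inverse ((of_int ?e + 2) * (of_nat N + 2)) * (\<Sum>i\<in>UNIV. ((of_int ?e + 2) / (of_int ?e + 1) * ff i \<pi> +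
      1 / (of_int ?e + 1) * gf i \<pi>) +
      ((of_int ?e + 2) / (of_int ?e + 1) * fmul mu i (r i) \<pi> + 1 / (of_int ?e + 1) * fmul mu i (s i) \<pi> +
       gmul mufg i (t i) \<pi>))" for \<pi>
    proof -
      let ?G = "fmul mu j (psi (Suc N) lam mu F) \<pi>"
      have "psi (Suc N) lam mu (lower_f i (?e + 1) (raise_f j F)) =
          (\<lambda>\<pi>. (if i = j then of_int (?e + 2) else 0) * psi (Suc N) lam mu F \<pi> +
          (of_int (?e + 2) / of_int (?e + 1) * (fmul muf j (A i) \<pi> + r i \<pi>) +
            1 / of_int (?e + 1) * (gmul mug j (B i) \<pi> + s i \<pi>)))" for i
        unfolding lower_f_raise_f'[of F, OF pf e0(1)]
        by (subst psi_add psi_cmult, (intro poly_funs_closed pf raise_f_poly_funs raise_g_poly_funs pfs)+)+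
          (simp only: R S)
      then have fi: "fmul mu i (psi (Suc N) lam mu (lower_f i (?e + 1) (raise_f j F))) \<pi> =
          (if i = j then (of_int ?e + 2) * ?G else 0) +
          ((of_int ?e + 2) / (of_int ?e + 1) * (fmul mu i (fmul muf j (A i)) \<pi> + fmul mu i (r i) \<pi>) +
          1 / (of_int ?e + 1) * (fmul mu i (gmul mug j (B i)) \<pi> + fmul mu i (s i) \<pi>))" for i
        by (simp only: fmul_linear of_int_add of_int_numeral of_int_1) simp
      have gi: "gmul mufg i (psi (Suc N) lam mufg (lower_g i (raise_f j F))) \<pi> =
          gmul mufg i (fmul mug j (B i)) \<pi> + gmul mufg i (t i) \<pi>" for i
        unfolding lower_g_raise_f[of F, OF pf] T by (simp add: gmul_linear)
      have G: "?G = inverse ((of_int ?e + 1) * (of_nat N + 1)) *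
          (\<Sum>i\<in>UNIV. fmul mu j (fmul muf i (A i)) \<pi> + fmul mu j (gmul mug i (B i)) \<pi>)"
        unfolding rec by (simp add: fmul_linear)
      have c: "of_int ((?e + 1 + 1) * (int (Suc N) + 1)) = (of_int ?e + 2) * (of_nat N + (2::'a))"
        by (simp add: add_ac)
      have "psi (Suc (Suc N)) lam (fst mu + 1, snd mu) (raise_f j F) \<pi> =
          inverse ((of_int ?e + 2) * (of_nat N + 2)) *
          (\<Sum>i\<in>UNIV. fmul mu i (psi (Suc N) lam mu (lower_f i (?e + 1) (raise_f j F))) \<pi> +
            gmul mufg i (psi (Suc N) lam mufg (lower_g i (raise_f j F))) \<pi>)"
        by (subst psi.simps(2))
          (simp only: lev c mufg_def fst_conv snd_conv add_diff_cancel_right' prod.collapse)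
      then show ?thesis
        unfolding fi gi ff_def gf_def using recursion_step_f[OF ne nN G] by simp
    qed
    have fmI: "fmul mu i x \<in> tilting_ideal" if "x \<in> tilting_ideal" for i and x :: "('a, 'n) path_element"
      by (rule tilting_ideal_fmul[OF mu 1 that])
    have gmI: "gmul mufg i (t i) \<in> tilting_ideal" for i
    proof (cases "0 < snd mu")
      case True
      then show ?thesis using mufg by (intro tilting_ideal_gmul tI) auto
    next
      case False
      have "raise_f j (lower_g i F) = (\<lambda>_ _ _. 0)" unfolding Bg0[OF False] by (simp add: raise_f_def)
      then have "t i = (\<lambda>_. 0)" by (intro ext) (simp add: t_def B0[OF False] psi_zero fmul_linear del: psi.simps)
      then show ?thesis by (simp add: tilting_ideal_zero gmul_linear)
    qed
    have "(\<lambda>\<pi>. psi (Suc (Suc N)) lam (fst mu + 1, snd mu) (raise_f j F) \<pi> -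
        fmul mu j (psi (Suc N) lam mu F) \<pi>) \<in> tilting_ideal"
      unfolding step
      by (intro tilting_ideal_scale tilting_ideal_sum tilting_ideal_add ffI gfI fmI rI sI gmI)
  } moreover {
    assume 2: "snd mu + 1 \<le> fst mu"
    define mufg where "mufg = (fst mu - 1, snd mu + 1)"
    have e2: "of_int ?e \<noteq> (0 :: 'a)" using 2 by (simp add: level_def del: of_int_diff)
    have lt: "snd mu < fst mu" using 2 by simp
    note m = muf[OF lt]
    \<comment> \<open>For e = 1 no g-arrow starts at \<open>muf\<close>; the term is replaced by
      zero, and the diagonal relation will account for the others.\<close>
    define U where "U i = (if snd mu + 2 \<le> fst mu then gmul muf j (A i) else (\<lambda>_. 0))" for i
    define t where "t i \<pi> = psi (Suc N) lam mufg (raise_g j (?e - 1) (lower_f i ?e F)) \<pi> - U i \<pi>" for i \<pi>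
    have mufg: "mufg \<in> young ?m" "(fst muf, snd muf + 1) = mufg" "fst mufg + 1 \<le> ?m"
      if "snd mu + 2 \<le> fst mu"
      using mu' that by (auto simp: mufg_def muf_def young_def)
    have t0: "t i = (\<lambda>_. 0)" if "\<not> snd mu + 2 \<le> fst mu" for i
    proof -
      \<comment> \<open>Raising from equal rows lands in degree -1, so the map vanishes in agreement
        with \<open>U i\<close>.\<close>
      have lm: "level (fst muf, snd muf + 1) = - 1" using that 2 m by (simp add: level_def)
      have "raise_g j (?e - 1) (lower_f i ?e F) a b = (\<lambda>_. 0)" for a b
        using equivariant_mapsD(2)[OF raise_g_hom_maps[OF m(2)[of i], of j, unfolded hom_maps_def], of a b]
        unfolding hom_maps_level m(5) lm by (cases "0 \<le> a") auto
      then have "raise_g j (?e - 1) (lower_f i ?e F) = (\<lambda>_ _ _. 0)" by (intro ext) simp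
      then show ?thesis using that by (intro ext) (simp add: t_def U_def psi_zero del: psi.simps)
    qed
    have tI: "t i \<in> tilting_ideal" for i
    proof (cases "snd mu + 2 \<le> fst mu")
      case True
      have "(\<lambda>\<pi>. psi (Suc N) lam (fst muf, snd muf + 1) (raise_g j (level muf) (lower_f i ?e F)) \<pi> -
          gmul muf j (psi N lam muf (lower_f i ?e F)) \<pi>) \<in> tilting_ideal"
        by (rule IH2) (use m mu' True in simp_all)
      moreover have "t i = (\<lambda>\<pi>. psi (Suc N) lam mufg (raise_g j (?e - 1) (lower_f i ?e F)) \<pi> - gmul muf j (A i) \<pi>)"
        using True by (simp add: t_def U_def fun_eq_iff del: psi.simps)
      ultimately show ?thesis unfolding mufg(2)[OF True] m(5) A_def[symmetric] by simp
    next
      case False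
      then show ?thesis by (simp add: t0 tilting_ideal_zero)
    qed
    have T: "psi (Suc N) lam mufg (raise_g j (?e - 1) (lower_f i ?e F)) = (\<lambda>\<pi>. U i \<pi> + t i \<pi>)" for i
      by (simp add: t_def fun_eq_iff del: psi.simps)
    define gg where "gg i \<pi> = gmul mu i (gmul mug j (B i)) \<pi> - gmul mu j (gmul mug i (B i)) \<pi>" for i \<pi>
    define gf where "gf i \<pi> = (of_int ?e + 1) * fmul mufg i (U i) \<pi> -
      gmul mu i (fmul muf j (A i)) \<pi> - of_int ?e * gmul mu j (fmul muf i (A i)) \<pi>" for i \<pi>
    have ggI: "gg i \<in> tilting_ideal" for i
    proof (cases "0 < snd mu")
      case True
      note m = mug[OF True]
      have "(\<lambda>\<pi>. gmul (fst mug, snd mug + 1) i (gmul mug j (B i)) \<pi> -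
          gmul (fst mug, snd mug + 1) j (gmul mug i (B i)) \<pi>) \<in> tilting_ideal"
        by (rule relation_gg) (use m 2 Bc True in auto)
      then show ?thesis unfolding m(6) gg_def[symmetric] .
    next
      case False
      then have "gg i = (\<lambda>_. 0)" by (intro ext) (simp add: gg_def B0 gmul_linear)
      then show ?thesis by (simp add: tilting_ideal_zero)
    qed
    have gfI: "gf i \<in> tilting_ideal" for i
    proof (cases "snd mu + 2 \<le> fst mu")
      case True
      \<comment> \<open>The row difference e - 1 at \<open>muf\<close>, positive in this case
        because e is at least 2.\<close>
      define D where "D = (of_nat (fst muf - snd muf) :: 'a)"
      have "D \<noteq> 0" unfolding D_def of_nat_eq_0_iff using True m(3,4) by simp
      then have D: "D = of_int ?e - 1" "D \<noteq> 0" "of_nat (fst muf - snd muf + 1) = D + 1"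
        using True by (auto simp: D_def level_def of_nat_diff muf_def)
      define rel where "rel k l \<pi> = D * gmul mu l (fmul muf k (A i)) \<pi> -
          (D + 1) * fmul mufg k (gmul muf l (A i)) \<pi> + fmul mufg l (gmul muf k (A i)) \<pi>" for k l \<pi>
      have rel: "rel k l \<in> tilting_ideal" for k l
      proof -
        have "(\<lambda>\<pi>. of_nat (fst muf - snd muf) * gmul (fst muf + 1, snd muf) l (fmul muf k (A i)) \<pi> -
            of_nat (fst muf - snd muf + 1) * fmul (fst muf, snd muf + 1) k (gmul muf l (A i)) \<pi> +
            fmul (fst muf, snd muf + 1) l (gmul muf k (A i)) \<pi>) \<in> tilting_ideal"
          by (rule relation_gf) (use m mu' True Ac[OF lt] in auto)
        then show ?thesis unfolding m(6) D(3) mufg(2)[OF True] D_def[symmetric] rel_def[symmetric] .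
      qed
      \<comment> \<open>Relation (iv) for (i, j) and for (j, i) is combined so that f_j g_i drops
        out; a factor D splits off what remains.\<close>
      have "gf i \<pi> = (- 1 / D) * ((D + 1) * rel i j \<pi> + rel j i \<pi>)" for \<pi>
      proof -
        have E: "of_int ?e = D + 1" using D(1) by simp
        have "D * gf i \<pi> = - ((D + 1) * rel i j \<pi> + rel j i \<pi>)"
          unfolding gf_def rel_def U_def E using True by (simp add: algebra_simps)
        then show ?thesis using D(2) by (simp add: field_simps)
      qed
      then have "gf i = (\<lambda>\<pi>. (- 1 / D) * ((D + 1) * rel i j \<pi> + rel j i \<pi>))" by blast
      then show ?thesis by (simp only: tilting_ideal_scale tilting_ideal_add rel)
    next
      case False
      \<comment> \<open>With e = 1 and \<open>U i = 0\<close> only -(g_i f_j + g_j f_i) is left,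
        which is the diagonal relation.\<close>
      have e1: "?e = 1" "fst muf = snd muf" using False 2 m by (auto simp: level_def)
      have "(\<lambda>\<pi>. gmul (fst muf + 1, snd muf) i (fmul muf j (A i)) \<pi> +
          gmul (fst muf + 1, snd muf) j (fmul muf i (A i)) \<pi>) \<in> tilting_ideal"
        by (rule relation_gf_diagonal) (use m mu' e1 Ac[OF lt] in auto)
      from tilting_ideal_scale[OF this, of "-1"] show ?thesis
        unfolding m(6) gf_def[abs_def] e1(1) U_def using False by (simp add: fmul_linear)
    qed
    have lev: "level (fst mu, snd mu + 1) = ?e - 1" by (simp add: level_def)
    have step: "psi (Suc (Suc N)) lam (fst mu, snd mu + 1) (raise_g j ?e F) \<pi> - gmul mu j (psi (Suc N) lam mu F) \<pi> =
      inverse (of_int ?e * (of_nat N + 2)) * (\<Sum>i\<in>UNIV. (of_int ?e / (of_int ?e + 1) * gg i \<pi> +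
      1 / (of_int ?e + 1) * gf i \<pi>) +
      (of_int ?e / (of_int ?e + 1) * gmul mu i (s i) \<pi> + (- 1 / (of_int ?e + 1)) * gmul mu i (r i) \<pi> +
       fmul mufg i (t i) \<pi>))" for \<pi>
    proof -
      let ?G = "gmul mu j (psi (Suc N) lam mu F) \<pi>"
      have "psi (Suc N) lam mu (lower_g i (raise_g j ?e F)) =
          (\<lambda>\<pi>. (if i = j then of_int ?e else 0) * psi (Suc N) lam mu F \<pi> +
          (of_int ?e / of_int (?e + 1) * (gmul mug j (B i) \<pi> + s i \<pi>) +
            (- 1 / of_int (?e + 1)) * (fmul muf j (A i) \<pi> + r i \<pi>)))" for i
        unfolding lower_g_raise_g'[of F, OF pf e0(1)]
        by (subst psi_add psi_cmult, (intro poly_funs_closed pf raise_f_poly_funs raise_g_poly_funs pfs)+)+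
          (simp only: R S)
      then have gi: "gmul mu i (psi (Suc N) lam mu (lower_g i (raise_g j ?e F))) \<pi> =
          (if i = j then of_int ?e * ?G else 0) +
          (of_int ?e / (of_int ?e + 1) * (gmul mu i (gmul mug j (B i)) \<pi> + gmul mu i (s i) \<pi>) +
          (- 1 / (of_int ?e + 1)) * (gmul mu i (fmul muf j (A i)) \<pi> + gmul mu i (r i) \<pi>))" for i
        by (simp only: gmul_linear of_int_add of_int_numeral of_int_1) simp
      have fi: "fmul mufg i (psi (Suc N) lam mufg (lower_f i (?e - 1) (raise_g j ?e F))) \<pi> =
          fmul mufg i (U i) \<pi> + fmul mufg i (t i) \<pi>" for i
        unfolding lower_f_raise_g[of F, OF pf] T by (simp add: fmul_linear)
      have G: "?G = inverse ((of_int ?e + 1) * (of_nat N + 1)) *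
          (\<Sum>i\<in>UNIV. gmul mu j (fmul muf i (A i)) \<pi> + gmul mu j (gmul mug i (B i)) \<pi>)"
        unfolding rec by (simp add: gmul_linear)
      have c: "of_int ((?e - 1 + 1) * (int (Suc N) + 1)) = of_int ?e * (of_nat N + (2::'a))"
        by (simp add: add_ac)
      have "psi (Suc (Suc N)) lam (fst mu, snd mu + 1) (raise_g j ?e F) \<pi> =
          inverse (of_int ?e * (of_nat N + 2)) *
          (\<Sum>i\<in>UNIV. fmul mufg i (psi (Suc N) lam mufg (lower_f i (?e - 1) (raise_g j ?e F))) \<pi> +
            gmul mu i (psi (Suc N) lam mu (lower_g i (raise_g j ?e F))) \<pi>)"
        by (subst psi.simps(2))
          (simp only: lev c mufg_def fst_conv snd_conv add_diff_cancel_right' prod.collapse)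
      then show ?thesis
        unfolding fi gi gg_def gf_def using recursion_step_g[OF ne(1) e2 nN G] by simp
    qed
    have gmI: "gmul mu i x \<in> tilting_ideal" if "x \<in> tilting_ideal" for i and x :: "('a, 'n) path_element"
      by (rule tilting_ideal_gmul[OF mu 2 that])
    have fmI: "fmul mufg i (t i) \<in> tilting_ideal" for i
    proof (cases "snd mu + 2 \<le> fst mu")
      case True
      then show ?thesis using mufg by (intro tilting_ideal_fmul tI) auto
    next
      case False
      then show ?thesis by (simp add: t0 tilting_ideal_zero fmul_linear)
    qed
    have "(\<lambda>\<pi>. psi (Suc (Suc N)) lam (fst mu, snd mu + 1) (raise_g j ?e F) \<pi> -
        gmul mu j (psi (Suc N) lam mu F) \<pi>) \<in> tilting_ideal"
      unfolding step
      by (intro tilting_ideal_scale tilting_ideal_sum tilting_ideal_add ggI gfI gmI rI sI fmI)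
  }
  ultimately have "(fst mu + 1 \<le> ?m \<longrightarrow> (\<lambda>\<pi>. psi (Suc (Suc N)) lam (fst mu + 1, snd mu) (raise_f j F) \<pi> -
        fmul mu j (psi (Suc N) lam mu F) \<pi>) \<in> tilting_ideal) \<and>
      (snd mu + 1 \<le> fst mu \<longrightarrow> (\<lambda>\<pi>. psi (Suc (Suc N)) lam (fst mu, snd mu + 1) (raise_g j ?e F) \<pi> -
        gmul mu j (psi (Suc N) lam mu F) \<pi>) \<in> tilting_ideal)" by blast
  }
  then show ?case by blast
qed

section \<open>The representation of the tilting quiver\<close>

text \<open>Elements of $\mathrm{Sym}^d k^2$ are polynomials of degree at most $d$, dehomogenised as in
  \<open>schur_matrix\<close>. On them \<open>contract u v d\<close> is $u\partial_y - v\partial_x$ at $x = 1$, where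
  $x\partial_x = d - y\partial_y$.\<close>

definition contract :: "'a::field_char_0 \<Rightarrow> 'a \<Rightarrow> nat \<Rightarrow> 'a poly \<Rightarrow> 'a poly" where
  "contract u v d h =
     Polynomial.smult u (pderiv h) - Polynomial.smult v (Polynomial.smult (of_nat d) h - pCons 0 (pderiv h))"

lemma coeff_contract:
  "coeff (contract u v d h) k = u * (of_nat k + 1) * coeff h (k + 1) - v * (of_nat d - of_nat k) * coeff h k"
  by (cases k) (simp_all add: contract_def coeff_pderiv algebra_simps)

lemma coeff_linear_mult:
  fixes h :: "'a::comm_ring_1 poly"
  shows "coeff ([:u, v:] * h) k = u * coeff h k + (case k of 0 \<Rightarrow> 0 | Suc l \<Rightarrow> v * coeff h l)"
  by (cases k) simp_all

lemma contract_linear: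
  "contract u v d (h + h') = contract u v d h + contract u v d h'"
  "contract u v d (Polynomial.smult s h) = Polynomial.smult s (contract u v d h)"
  "contract u v d 0 = 0"
  by (auto simp: poly_eq_iff coeff_contract algebra_simps)

text \<open>The Leibniz rule. The degrees have to be carried along because d_x is invisible after
  dehomogenisation and enters only through the degree.\<close>

lemma contract_mult:
  "contract u v (d + d') (P * Q) = contract u v d P * Q + P * contract u v d' Q"
proof -
  have "pCons 0 (R + S) = pCons 0 R + pCons 0 S" for R S :: "'a poly" by simp
  then show ?thesis
    unfolding contract_def pderiv_mult
    by (simp add: algebra_simps smult_add_left smult_add_right smult_diff_right del: add_pCons)
qed

lemma contract_power:
  "contract u v n (L ^ n) = Polynomial.smult (of_nat n) (contract u v 1 L * L ^ (n - 1))"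
proof (induction n)
  case 0
  then show ?case by (simp add: contract_def)
next
  case (Suc n)
  have "contract u v (Suc n) (L ^ Suc n) = contract u v (1 + n) (L * L ^ n)" by simp
  also have "\<dots> = contract u v 1 L * L ^ n + L * Polynomial.smult (of_nat n) (contract u v 1 L * L ^ (n - 1))"
    by (simp only: contract_mult Suc.IH)
  also have "\<dots> = contract u v 1 L * L ^ n + Polynomial.smult (of_nat n) (contract u v 1 L * L ^ n)"
    by (cases n) (simp_all add: mult_ac)
  finally show ?case by (simp add: smult_add_left)
qed

lemma contract_linear_poly: "contract u v (Suc 0) [:p, q:] = [:u * q - v * p:]"
  by (simp add: contract_def pderiv_pCons)

section \<open>The action of GL(2) on binary forms\<close>

definition gl2_det :: "(nat \<Rightarrow> nat \<Rightarrow> 'a::field_char_0) \<Rightarrow> 'a" where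
  "gl2_det g = g 1 1 * g 2 2 - g 1 2 * g 2 1"

text \<open>Substitution of the images of x and y under \<open>g\<close> into forms of degree
  \<open>d\<close>. Up to the power of the determinant its values on monomials are the columns of
  \<open>schur_matrix\<close>; coefficients beyond \<open>d\<close> are ignored.\<close>

definition sym_act :: "(nat \<Rightarrow> nat \<Rightarrow> 'a::field_char_0) \<Rightarrow> nat \<Rightarrow> 'a poly \<Rightarrow> 'a poly" where
  "sym_act g d h = (\<Sum>b\<le>d. Polynomial.smult (coeff h b) ([:g 1 1, g 2 1:] ^ (d - b) * [:g 1 2, g 2 2:] ^ b))"

definition gl2_act :: "(nat \<Rightarrow> nat \<Rightarrow> 'a::field_char_0) \<Rightarrow> ('n \<times> bool \<Rightarrow> 'a) \<Rightarrow> 'n \<times> bool \<Rightarrow> 'a" where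
  "gl2_act g M = (\<lambda>(i, s). if s then g 2 1 * M (i, False) + g 2 2 * M (i, True)
     else g 1 1 * M (i, False) + g 1 2 * M (i, True))"

lemma smult_sum_right: "Polynomial.smult s (\<Sum>i\<in>S. f i) = (\<Sum>i\<in>S. Polynomial.smult s (f i))"
  by (induction S rule: infinite_finite_induct) (simp_all add: smult_add_right)

lemma sym_act_linear:
  "sym_act g d (h + h') = sym_act g d h + sym_act g d h'"
  "sym_act g d (Polynomial.smult s h) = Polynomial.smult s (sym_act g d h)"
  "sym_act g d (\<Sum>i\<in>S. f i) = (\<Sum>i\<in>S. sym_act g d (f i))"
  "sym_act g d 0 = 0"
proof -
  show add: "sym_act g d (h + h') = sym_act g d h + sym_act g d h'" for h h'
    by (simp add: sym_act_def smult_add_left sum.distrib)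
  show "sym_act g d (Polynomial.smult s h) = Polynomial.smult s (sym_act g d h)"
    by (simp add: sym_act_def smult_sum_right)
  show 0: "sym_act g d 0 = 0" by (simp add: sym_act_def)
  show "sym_act g d (\<Sum>i\<in>S. f i) = (\<Sum>i\<in>S. sym_act g d (f i))"
    by (induction S rule: infinite_finite_induct) (simp_all add: add 0)
qed

lemma sym_act_monom:
  "b \<le> d \<Longrightarrow> sym_act g d (monom 1 b) = [:g 1 1, g 2 1:] ^ (d - b) * [:g 1 2, g 2 2:] ^ b"
  unfolding sym_act_def by (simp add: if_distrib[of "\<lambda>c. Polynomial.smult c _"] cong: if_cong)

lemma poly_sum_monom:
  fixes h :: "'a::field_char_0 poly"
  assumes "degree h \<le> d"
  shows "h = (\<Sum>b\<le>d. Polynomial.smult (coeff h b) (monom 1 b))"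
  using poly_as_sum_of_monoms'[OF assms] by (simp add: smult_monom)

lemma sym_act_eqI:
  fixes h :: "'a::field_char_0 poly"
  assumes "degree h \<le> d"
    and "\<And>h h'. S (h + h') = S h + S h'" "\<And>s h. S (Polynomial.smult s h) = Polynomial.smult s (S h)"
    and "\<And>h h'. T (h + h') = T h + T h'" "\<And>s h. T (Polynomial.smult s h) = Polynomial.smult s (T h)"
    and "\<And>b. b \<le> d \<Longrightarrow> S (monom 1 b) = T (monom 1 b)"
  shows "S h = T h"
proof -
  have 0: "S 0 = 0" "T 0 = 0" using assms(3)[of 0 0] assms(5)[of 0 0] by simp_all
  have "S (\<Sum>b\<in>B. Polynomial.smult (coeff h b) (monom 1 b)) = T (\<Sum>b\<in>B. Polynomial.smult (coeff h b) (monom 1 b))"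
    if "finite B" "B \<subseteq> {..d}" for B
    using that by (induction B rule: finite_induct) (simp_all add: assms(2-6) 0)
  from this[of "{..d}"] show ?thesis using poly_sum_monom[OF assms(1)] by simp
qed

text \<open>Substitution is multiplicative, and it takes the linear form with coefficient column (u,
  v) to the one with column g (u, v).\<close>

lemma sym_act_linear_mult:
  assumes "degree h \<le> d"
  shows "sym_act g (Suc d) ([:u, v:] * h) =
    [:g 1 1 * u + g 1 2 * v, g 2 1 * u + g 2 2 * v:] * sym_act g d h"
proof (rule sym_act_eqI[OF assms, where S = "\<lambda>h. sym_act g (Suc d) ([:u, v:] * h)"])
  fix b assume b: "b \<le> d"
  let ?A = "[:g 1 1, g 2 1:]" and ?B = "[:g 1 2, g 2 2:]"
  have "[:u, v:] * monom 1 b = Polynomial.smult u (monom 1 b) + Polynomial.smult v (monom 1 (Suc b))"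
    by (simp add: monom_Suc)
  then have "sym_act g (Suc d) ([:u, v:] * monom 1 b) =
      Polynomial.smult u (?A ^ (Suc d - b) * ?B ^ b) + Polynomial.smult v (?A ^ (Suc d - Suc b) * ?B ^ Suc b)"
    using b by (simp only: sym_act_linear sym_act_monom le_SucI Suc_le_mono)
  also have "\<dots> = (Polynomial.smult u ?A + Polynomial.smult v ?B) * (?A ^ (d - b) * ?B ^ b)"
    using b by (simp add: Suc_diff_le algebra_simps del: mult_pCons_left mult_pCons_right smult_pCons add_pCons)
  also have "Polynomial.smult u ?A + Polynomial.smult v ?B = [:g 1 1 * u + g 1 2 * v, g 2 1 * u + g 2 2 * v:]"
    by (simp add: mult.commute)
  finally show "sym_act g (Suc d) ([:u, v:] * monom 1 b) =
      [:g 1 1 * u + g 1 2 * v, g 2 1 * u + g 2 2 * v:] * sym_act g d (monom 1 b)"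
    using b by (simp add: sym_act_monom mult_ac del: mult_pCons_left mult_pCons_right)
qed (simp_all only: distrib_left mult_smult_right sym_act_linear)

text \<open>Contraction against a vector is the derivation that pairs linear forms with it by the
  area form, which \<open>g\<close> multiplies by its determinant. This factor is the twist that a
  g-arrow adds to the second row.\<close>

lemma sym_act_contract:
  assumes "degree h \<le> d" "0 < d"
  shows "contract (g 1 1 * u + g 1 2 * v) (g 2 1 * u + g 2 2 * v) d (sym_act g d h) =
    Polynomial.smult (gl2_det g) (sym_act g (d - 1) (contract u v d h))"
proof (rule sym_act_eqI[OF assms(1),
      where S = "\<lambda>h. contract (g 1 1 * u + g 1 2 * v) (g 2 1 * u + g 2 2 * v) d (sym_act g d h)"])
  fix b assume b: "b \<le> d"
  let ?A = "[:g 1 1, g 2 1:]" and ?B = "[:g 1 2, g 2 2:]"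
  let ?u = "g 1 1 * u + g 1 2 * v" and ?v = "g 2 1 * u + g 2 2 * v"
  have A: "contract ?u ?v 1 ?A = [:- v * gl2_det g:]" and B: "contract ?u ?v 1 ?B = [:u * gl2_det g:]"
    by (simp_all add: contract_linear_poly gl2_det_def algebra_simps)
  have "contract ?u ?v d (sym_act g d (monom 1 b)) = contract ?u ?v ((d - b) + b) (?A ^ (d - b) * ?B ^ b)"
    using b by (simp add: sym_act_monom)
  also have "\<dots> = Polynomial.smult (of_nat (d - b)) ([:- v * gl2_det g:] * ?A ^ (d - b - 1)) * ?B ^ b +
      ?A ^ (d - b) * Polynomial.smult (of_nat b) ([:u * gl2_det g:] * ?B ^ (b - 1))"
    unfolding contract_mult contract_power A B ..
  also have "\<dots> = Polynomial.smult (gl2_det g) (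
      Polynomial.smult (- v * of_nat (d - b)) (?A ^ (d - 1 - b) * ?B ^ b) +
      Polynomial.smult (u * of_nat b) (?A ^ (d - b) * ?B ^ (b - 1)))"
    by (simp add: smult_add_right smult_diff_right mult_ac diff_commute del: of_nat_diff)
  also have "Polynomial.smult (- v * of_nat (d - b)) (?A ^ (d - 1 - b) * ?B ^ b) =
      sym_act g (d - 1) (Polynomial.smult (- v * of_nat (d - b)) (monom 1 b))"
  \<comment> \<open>For b = d the exponent d - 1 - b is truncated, but the factor
    \<open>d - b\<close> is zero; the same happens below for b = 0.\<close>
  proof (cases "b = d")
    case False
    then have "b \<le> d - 1" using b by auto
    then show ?thesis by (simp only: sym_act_linear sym_act_monom)
  qed (simp add: sym_act_linear)
  also have "Polynomial.smult (u * of_nat b) (?A ^ (d - b) * ?B ^ (b - 1)) =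
      sym_act g (d - 1) (Polynomial.smult (u * of_nat b) (monom 1 (b - 1)))"
  proof (cases b)
    case (Suc c)
    then have "d - 1 - (b - 1) = d - b" "b - 1 \<le> d - 1" using b by auto
    then show ?thesis by (simp only: sym_act_linear sym_act_monom)
  qed (simp add: sym_act_linear)
  also have "sym_act g (d - 1) (Polynomial.smult (- v * of_nat (d - b)) (monom 1 b)) +
      sym_act g (d - 1) (Polynomial.smult (u * of_nat b) (monom 1 (b - 1))) =
      sym_act g (d - 1) (contract u v d (monom 1 b))"
    unfolding sym_act_linear(1)[symmetric]
  proof (rule arg_cong[of _ _ "sym_act g (d - 1)"], rule poly_eqI)
    fix k
    show "coeff (Polynomial.smult (- v * of_nat (d - b)) (monom 1 b) +
        Polynomial.smult (u * of_nat b) (monom 1 (b - 1))) k = coeff (contract u v d (monom 1 b)) k"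
      using b by (cases b; cases k) (auto simp: coeff_contract of_nat_diff algebra_simps)
  qed
  finally show "contract ?u ?v d (sym_act g d (monom 1 b)) =
      Polynomial.smult (gl2_det g) (sym_act g (d - 1) (contract u v d (monom 1 b)))" .
qed (simp_all add: contract_linear sym_act_linear smult_add_right mult.commute)

section \<open>The operators of arrows and paths\<close>

definition arrow_op :: "('n \<times> bool \<Rightarrow> 'a::field_char_0) \<Rightarrow> (nat \<times> nat) \<times> nat \<times> 'n \<Rightarrow> 'a poly \<Rightarrow> 'a poly" where
  "arrow_op M e h = (case e of (lam, i, \<rho>) \<Rightarrow>
     if i = 1 then [:M (\<rho>, False), M (\<rho>, True):] * h
     else contract (M (\<rho>, False)) (M (\<rho>, True)) (fst lam - snd lam) h)"

definition path_op ::
    "('n \<times> bool \<Rightarrow> 'a::field_char_0) \<Rightarrow> ((nat \<times> nat) \<times> nat \<times> 'n) list \<Rightarrow> 'a poly \<Rightarrow> 'a poly" where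
  "path_op M p h = fold (arrow_op M) p h"

lemma path_op_append: "path_op M (p @ q) h = path_op M q (path_op M p h)"
  by (simp add: path_op_def)

lemma path_op_snoc: "path_op M (p @ [e]) h = arrow_op M e (path_op M p h)"
  by (simp add: path_op_def)

lemma path_op_Nil: "path_op M [] h = h"
  by (simp add: path_op_def)

lemma arrow_op_linear:
  "arrow_op M e (h + h') = arrow_op M e h + arrow_op M e h'"
  "arrow_op M e (Polynomial.smult s h) = Polynomial.smult s (arrow_op M e h)"
  "arrow_op M e 0 = 0"
  by (auto simp: arrow_op_def contract_linear distrib_left smult_add_right split: prod.split)

lemma path_op_linear:
  "path_op M p (h + h') = path_op M p h + path_op M p h'"
  "path_op M p (Polynomial.smult s h) = Polynomial.smult s (path_op M p h)"
  "path_op M p 0 = 0"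
  by (induction p rule: rev_induct) (simp_all add: path_op_snoc path_op_Nil arrow_op_linear)

lemma path_op_expand:
  assumes "degree h \<le> d"
  shows "coeff (path_op M p h) a = (\<Sum>m\<le>d. coeff (path_op M p (monom 1 m)) a * coeff h m)"
proof -
  have "path_op M p (\<Sum>b\<in>B. Polynomial.smult (coeff h b) (monom 1 b)) =
      (\<Sum>b\<in>B. Polynomial.smult (coeff h b) (path_op M p (monom 1 b)))" if "finite B" for B
    using that by (induction B rule: finite_induct) (simp_all add: path_op_linear)
  from this[of "{..d}"] have "path_op M p h = (\<Sum>b\<le>d. Polynomial.smult (coeff h b) (path_op M p (monom 1 b)))"
    using poly_sum_monom[OF assms] by simp
  then show ?thesis by (simp add: coeff_sum mult.commute)
qed

abbreviation tilting_walk :: "nat \<times> nat \<Rightarrow> ((nat \<times> nat) \<times> nat \<times> 'n::finite) list \<Rightarrow> nat \<times> nat \<Rightarrow> bool" where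
  "tilting_walk \<equiv> pre_digraph.awalk tilting_quiver"

lemma tilting_walk_snoc_cases:
  assumes "tilting_walk lam (p @ [e]) nu"
  obtains j mu where "e = (mu, 1, j)" "tilting_walk lam p mu" "nu = (fst mu + 1, snd mu)"
      "mu \<in> young (CARD('n::finite) - 2)" "fst mu + 1 \<le> CARD('n) - 2"
    | j mu where "e = (mu, 2, j :: 'n)" "tilting_walk lam p mu" "nu = (fst mu, snd mu + 1)"
      "mu \<in> young (CARD('n) - 2)" "snd mu + 1 \<le> fst mu"
proof -
  obtain mu i j where e: "e = (mu, i, j)" by (metis prod_cases3)
  from assms have w: "tilting_walk lam p mu" and arc: "e \<in> arcs tilting_quiver" and nu: "nu = add_e mu i"
    by (auto simp: TQ.awalk_append_iff TQ.awalk_Cons_iff TQ.awalk_Nil_iff e tilting_quiver_sel)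
  have "i = 1 \<or> i = 2" "mu \<in> young (CARD('n) - 2)" "add_e mu i \<in> young (CARD('n) - 2)"
    using arc by (auto simp: e tilting_arcs_iff)
  then show ?thesis
    using that w nu e by (auto simp: add_e_simps young_def)
qed

lemma tilting_walk_young:
  assumes "tilting_walk lam (p :: (_ \<times> _ \<times> 'n::finite) list) mu"
  shows "lam \<in> young (CARD('n) - 2)" "mu \<in> young (CARD('n) - 2)"
  using assms TQ.awalk_def[of lam p mu] TQ.awlast_in_verts[of lam p]
  by (auto simp: tilting_quiver_sel)

lemma degree_linear_mult: "degree h \<le> d \<Longrightarrow> degree ([:u, v:] * h) \<le> Suc d"
  by (rule order_trans[OF degree_mult_le]) simp

lemma degree_contract:
  assumes "degree h \<le> d" "0 < d"
  shows "degree (contract u v d h) \<le> d - 1"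
proof (rule degree_le, intro allI impI)
  fix k assume "d - 1 < k"
  then have "k = d \<or> d < k" using assms(2) by auto
  then show "coeff (contract u v d h) k = 0"
    using assms by (auto simp: coeff_contract coeff_eq_0)
qed

lemma degree_path_op:
  assumes "tilting_walk lam p mu" "degree h \<le> fst lam - snd lam"
  shows "degree (path_op M p h) \<le> fst mu - snd mu"
  using assms(1)
proof (induction p arbitrary: mu rule: rev_induct)
  case Nil
  then show ?case using assms(2) by (simp add: path_op_Nil TQ.awalk_Nil_iff)
next
  case (snoc e p)
  from snoc.prems show ?case
  proof (cases rule: tilting_walk_snoc_cases)
    case (1 j nu)
    then show ?thesis
      using degree_linear_mult[OF snoc.IH[OF 1(2)]]
      by (simp add: path_op_snoc arrow_op_def young_def Suc_diff_le del: mult_pCons_left)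
  next
    case (2 j nu)
    then show ?thesis
      using degree_contract[OF snoc.IH[OF 2(2)]]
      by (simp add: path_op_snoc arrow_op_def)
  qed
qed

definition schur_act :: "(nat \<Rightarrow> nat \<Rightarrow> 'a::field_char_0) \<Rightarrow> nat \<times> nat \<Rightarrow> 'a poly \<Rightarrow> 'a poly" where
  "schur_act g lam h = Polynomial.smult (gl2_det g ^ snd lam) (sym_act g (fst lam - snd lam) h)"

lemma schur_matrix_eq:
  "b \<le> fst lam - snd lam \<Longrightarrow> schur_matrix lam g a b = coeff (schur_act g lam (monom 1 b)) a"
  by (simp add: schur_matrix_def schur_act_def sym_act_monom gl2_det_def)

text \<open>Induction on the path: an f-arrow leaves the determinant power unchanged, and a g-arrow
  yields one determinant, which is the difference between \<open>schur_act\<close> at its head and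
  at its tail.\<close>

lemma path_op_equivariant:
  assumes "tilting_walk lam p mu" "degree h \<le> fst lam - snd lam"
  shows "schur_act g mu (path_op M p h) = path_op (gl2_act g M) p (schur_act g lam h)"
  using assms(1)
proof (induction p arbitrary: mu rule: rev_induct)
  case Nil
  then show ?case by (simp add: path_op_Nil TQ.awalk_Nil_iff)
next
  case (snoc e p)
  from snoc.prems show ?case
  proof (cases rule: tilting_walk_snoc_cases)
    case (1 j nu)
    let ?h = "path_op M p h"
    have deg: "degree ?h \<le> fst nu - snd nu" by (rule degree_path_op[OF 1(2) assms(2)])
    have "fst mu - snd mu = Suc (fst nu - snd nu)" using 1 by (auto simp: young_def)
    then have "schur_act g mu (arrow_op M e ?h) =
        Polynomial.smult (gl2_det g ^ snd nu) (arrow_op (gl2_act g M) e (sym_act g (fst nu - snd nu) ?h))"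
      using 1 by (simp add: schur_act_def arrow_op_def sym_act_linear_mult[OF deg] gl2_act_def del: mult_pCons_left)
    then show ?thesis
      unfolding path_op_snoc snoc.IH[OF 1(2), symmetric] by (simp add: arrow_op_linear schur_act_def)
  next
    case (2 j nu)
    let ?h = "path_op M p h"
    have deg: "degree ?h \<le> fst nu - snd nu" by (rule degree_path_op[OF 2(2) assms(2)])
    have "fst mu - snd mu = fst nu - snd nu - 1" "0 < fst nu - snd nu" using 2 by auto
    then have "schur_act g mu (arrow_op M e ?h) =
        Polynomial.smult (gl2_det g ^ snd nu) (arrow_op (gl2_act g M) e (sym_act g (fst nu - snd nu) ?h))"
      using 2 sym_act_contract[OF deg, of g] by (simp add: schur_act_def arrow_op_def gl2_act_def mult.commute)
    then show ?thesis
      unfolding path_op_snoc snoc.IH[OF 2(2), symmetric] by (simp add: arrow_op_linear schur_act_def)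
  qed
qed

definition young_ix :: "nat \<Rightarrow> ((nat \<times> nat) \<times> nat) set" where
  "young_ix m = Sigma (young m) (\<lambda>lam. {..fst lam - snd lam})"

lemma finite_young_ix: "finite (young_ix m)"
  by (simp add: young_ix_def finite_young)

lemma young_ix_iff: "(lam, a) \<in> young_ix m \<longleftrightarrow> lam \<in> young m \<and> a \<le> fst lam - snd lam"
  by (simp add: young_ix_def)

lemma sum_young_ix_block:
  assumes "nu \<in> young m" "\<And>Z. Z \<in> young_ix m \<Longrightarrow> fst Z \<noteq> nu \<Longrightarrow> f Z = 0"
  shows "(\<Sum>Z\<in>young_ix m. f Z) = (\<Sum>a\<le>fst nu - snd nu. f (nu, a))"
proof -
  have "(\<Sum>Z\<in>young_ix m. f Z) = (\<Sum>Z\<in>Pair nu ` {..fst nu - snd nu}. f Z)"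
  proof (rule sum.mono_neutral_right)
    show "\<forall>Z\<in>young_ix m - Pair nu ` {..fst nu - snd nu}. f Z = 0"
    proof
      fix Z assume Z: "Z \<in> young_ix m - Pair nu ` {..fst nu - snd nu}"
      then have "fst Z \<noteq> nu" by (cases Z) (auto simp: young_ix_iff)
      then show "f Z = 0" using assms(2) Z by blast
    qed
  qed (use assms in \<open>auto simp: finite_young_ix young_ix_iff\<close>)
  then show ?thesis by (simp add: sum.reindex inj_on_def)
qed

type_synonym 'a ix_matrix = "(nat \<times> nat) \<times> nat \<Rightarrow> (nat \<times> nat) \<times> nat \<Rightarrow> 'a"

text \<open>An index pairs a summand with the exponent of y in a monomial. A path acts from the
  summand of its start to that of its end, so all other blocks are zero.\<close>

definition path_matrix ::
    "('n::finite \<times> bool \<Rightarrow> 'a::field_char_0) \<Rightarrow> (nat \<times> nat) \<times> ((nat \<times> nat) \<times> nat \<times> 'n) list \<Rightarrow> 'a ix_matrix" where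
  "path_matrix M \<pi> X Y =
     (if fst Y = fst \<pi> \<and> fst X = pre_digraph.awlast tilting_quiver (fst \<pi>) (snd \<pi>) \<and>
         X \<in> young_ix (CARD('n) - 2) \<and> Y \<in> young_ix (CARD('n) - 2)
      then coeff (path_op M (snd \<pi>) (monom 1 (snd Y))) (snd X) else 0)"

definition quiver_rep :: "('n::finite \<times> bool \<Rightarrow> 'a::field_char_0) \<Rightarrow> ('a, 'n) path_element \<Rightarrow> 'a ix_matrix" where
  "quiver_rep M x X Y = (\<Sum>\<pi>\<in>{\<pi>. x \<pi> \<noteq> 0}. x \<pi> * path_matrix M \<pi> X Y)"

lemma quiver_rep_superset:
  assumes "finite S" "{\<pi>. x \<pi> \<noteq> 0} \<subseteq> S"
  shows "quiver_rep M x X Y = (\<Sum>\<pi>\<in>S. x \<pi> * path_matrix M \<pi> X Y)"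
  unfolding quiver_rep_def by (rule sum.mono_neutral_left) (use assms in auto)

lemma quiver_rep_add:
  assumes "x \<in> carrier TP" "y \<in> carrier TP"
  shows "quiver_rep M (\<lambda>\<pi>. x \<pi> + y \<pi>) X Y = quiver_rep M x X Y + quiver_rep M y X Y"
proof -
  let ?S = "{\<pi>. x \<pi> \<noteq> 0} \<union> {\<pi>. y \<pi> \<noteq> 0}"
  have S: "finite ?S" using assms by (simp add: TQ.path_carrier)
  show ?thesis
    by (subst (1 2 3) quiver_rep_superset[OF S]) (auto simp: distrib_right sum.distrib)
qed

lemma quiver_rep_zero: "quiver_rep M (\<lambda>_. 0) X Y = 0"
  by (simp add: quiver_rep_def)

lemma quiver_rep_scale: "quiver_rep M (\<lambda>\<pi>. s * x \<pi>) X Y = s * quiver_rep M x X Y"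
  by (cases "s = 0") (simp_all add: quiver_rep_def sum_distrib_left mult_ac)

lemma quiver_rep_sum:
  "(\<And>i. i \<in> S \<Longrightarrow> h i \<in> carrier TP) \<Longrightarrow>
    quiver_rep M (\<lambda>\<pi>. \<Sum>i\<in>S. h i \<pi>) X Y = (\<Sum>i\<in>S. quiver_rep M (h i) X Y)"
  by (induction S rule: infinite_finite_induct)
    (simp_all add: quiver_rep_zero quiver_rep_add TQ.path_sum_closed)

lemma quiver_rep_single:
  fixes M :: "'n::finite \<times> bool \<Rightarrow> 'a::field_char_0"
  shows "quiver_rep M (TQ.single_path \<pi>) X Y = path_matrix M \<pi> X Y"
proof -
  have "{\<pi>'. TQ.single_path \<pi> \<pi>' \<noteq> (0 :: 'a)} = {\<pi>}" by (auto simp: TQ.single_path_def)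
  then show ?thesis by (simp add: quiver_rep_def TQ.single_path_def)
qed

lemma arrow_single_path: "arrow tilting_quiver (lam, i, \<rho>) = TQ.single_path (lam, [(lam, i, \<rho>)])"
  by (simp add: arrow_def TQ.single_path_def tilting_quiver_sel)

context fin_digraph
begin

lemma path_carrierD:
  "x \<in> carrier PA \<Longrightarrow> x \<pi> \<noteq> 0 \<Longrightarrow> \<pi> \<in> quiver_paths G"
  "x \<in> carrier PA \<Longrightarrow> finite {\<pi>. x \<pi> \<noteq> 0}"
  unfolding path_carrier by blast+

lemma path_carrier_expand:
  assumes "x \<in> carrier PA"
  shows "x = (\<lambda>\<pi>'. \<Sum>\<pi>\<in>{\<pi>. x \<pi> \<noteq> 0}. x \<pi> * single_path \<pi> \<pi>')"
proof
  fix \<pi>'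
  have "(\<Sum>\<pi>\<in>{\<pi>. x \<pi> \<noteq> 0}. x \<pi> * single_path \<pi> \<pi>') = (\<Sum>\<pi>\<in>{\<pi>. x \<pi> \<noteq> 0}. if \<pi> = \<pi>' then x \<pi> else 0)"
    by (rule sum.cong) (auto simp: single_path_def)
  also have "\<dots> = x \<pi>'" using assms by (simp add: path_carrier)
  finally show "x \<pi>' = (\<Sum>\<pi>\<in>{\<pi>. x \<pi> \<noteq> 0}. x \<pi> * single_path \<pi> \<pi>')" by simp
qed

lemma path_mult_sum_left: "(\<lambda>\<pi>. \<Sum>i\<in>S. h i \<pi>) \<otimes>\<^bsub>PA\<^esub> z = (\<lambda>\<pi>. \<Sum>i\<in>S. (h i \<otimes>\<^bsub>PA\<^esub> z) \<pi>)"
proof (induction S rule: infinite_finite_induct)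
  case (insert i S)
  then show ?case by (simp add: path_mult_add_left)
qed (auto simp: path_mult)

lemma single_path_mult:
  "single_path (v, q) \<otimes>\<^bsub>PA\<^esub> single_path (u, p) =
    (if awlast u p = v then single_path (u, p @ q) else (\<lambda>_. 0))"
proof
  fix \<pi> :: "'a \<times> 'b list"
  obtain w r where \<pi>: "\<pi> = (w, r)" by force
  have "(single_path (v, q) \<otimes>\<^bsub>PA\<^esub> single_path (u, p)) \<pi> =
      (\<Sum>k\<le>length r. if k = length p then (if awlast u p = v \<and> w = u \<and> r = p @ q then 1 else 0) else 0)"
    unfolding \<pi> path_mult
  proof (rule sum.cong)
    fix k assume "k \<in> {..length r}"
    then have "drop k r = q \<and> take k r = p \<longleftrightarrow> k = length p \<and> r = p @ q"
      by (metis append_eq_conv_conj append_take_drop_id atMost_iff length_take min.absorb2)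
    then show "single_path (v, q) (awlast w (take k r), drop k r) * single_path (u, p) (w, take k r) =
        (if k = length p then (if awlast u p = v \<and> w = u \<and> r = p @ q then 1 else 0) else 0)"
      by (cases "k = length p \<and> r = p @ q") (simp_all add: single_path_def, blast?)
  qed simp
  also have "\<dots> = (if awlast u p = v then single_path (u, p @ q) else (\<lambda>_. 0)) \<pi>"
    by (auto simp: \<pi> single_path_def)
  finally show "(single_path (v, q) \<otimes>\<^bsub>PA\<^esub> single_path (u, p)) \<pi> =
      (if awlast u p = v then single_path (u, p @ q) else (\<lambda>_. 0)) \<pi>" .
qed

end

lemma tilting_path_walk:
  "(u, p) \<in> quiver_paths tilting_quiver \<longleftrightarrow> tilting_walk u p (pre_digraph.awlast tilting_quiver u p)"
  by (rule TQ.quiver_paths_iff)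

text \<open>The sum over the middle index recovers the intermediate form from its coefficients,
  since \<open>degree_path_op\<close> keeps its degree within the block of the vertex
  \<open>v\<close>. If the paths do not compose, both sides vanish.\<close>

lemma path_matrix_mult:
  fixes p q :: "((nat \<times> nat) \<times> nat \<times> 'n::finite) list"
  assumes "(v, q) \<in> quiver_paths tilting_quiver" "(u, p) \<in> quiver_paths tilting_quiver"
  shows "quiver_rep M (TQ.single_path (v, q) \<otimes>\<^bsub>TP\<^esub> TQ.single_path (u, p)) X Y =
    (\<Sum>Z\<in>young_ix (CARD('n) - 2). path_matrix M (v, q) X Z * path_matrix M (u, p) Z Y)"
proof (cases "pre_digraph.awlast tilting_quiver u p = v")
  case True
  let ?m = "CARD('n) - 2"
  have w: "tilting_walk u p v" using assms(2) True by (simp add: tilting_path_walk)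
  show ?thesis
  proof (cases "fst Y = u \<and> fst X = pre_digraph.awlast tilting_quiver v q \<and> X \<in> young_ix ?m \<and> Y \<in> young_ix ?m")
    case XY: True
    then obtain b where Y: "Y = (u, b)" "b \<le> fst u - snd u" by (cases Y) (auto simp: young_ix_iff)
    have v: "v \<in> young ?m" by (rule tilting_walk_young[OF w])
    have deg: "degree (path_op M p (monom 1 b)) \<le> fst v - snd v"
      by (rule degree_path_op[OF w]) (use Y in \<open>simp add: degree_monom_eq\<close>)
    have "(\<Sum>Z\<in>young_ix ?m. path_matrix M (v, q) X Z * path_matrix M (u, p) Z Y) =
        (\<Sum>a\<le>fst v - snd v. path_matrix M (v, q) X (v, a) * path_matrix M (u, p) (v, a) Y)"
      by (rule sum_young_ix_block[OF v]) (simp add: path_matrix_def)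
    also have "\<dots> = (\<Sum>a\<le>fst v - snd v. coeff (path_op M q (monom 1 a)) (snd X) * coeff (path_op M p (monom 1 b)) a)"
      by (rule sum.cong) (use XY Y v True in \<open>auto simp: path_matrix_def young_ix_iff\<close>)
    also have "\<dots> = coeff (path_op M (p @ q) (monom 1 b)) (snd X)"
      unfolding path_op_append by (rule path_op_expand[OF deg, symmetric])
    finally show ?thesis
      using XY Y True by (simp add: TQ.single_path_mult quiver_rep_single path_matrix_def TQ.awlast_append)
  next
    case False
    then have "(\<Sum>Z\<in>young_ix ?m. path_matrix M (v, q) X Z * path_matrix M (u, p) Z Y) = 0"
      by (intro sum.neutral ballI) (auto simp: path_matrix_def)
    moreover have "path_matrix M (u, p @ q) X Y = 0"
      using False True by (auto simp: path_matrix_def TQ.awlast_append)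
    ultimately show ?thesis
      using True by (simp only: TQ.single_path_mult quiver_rep_single simp_thms if_True)
  qed
next
  case False
  then have "(\<Sum>Z\<in>young_ix (CARD('n) - 2). path_matrix M (v, q) X Z * path_matrix M (u, p) Z Y) = 0"
    by (intro sum.neutral ballI) (auto simp: path_matrix_def)
  with False show ?thesis by (simp only: TQ.single_path_mult quiver_rep_zero if_False)
qed

lemma quiver_rep_mult:
  fixes x y :: "('a::field_char_0, 'n::finite) path_element"
  assumes x: "x \<in> carrier TP" and y: "y \<in> carrier TP"
  shows "quiver_rep M (x \<otimes>\<^bsub>TP\<^esub> y) X Y =
    (\<Sum>Z\<in>young_ix (CARD('n) - 2). quiver_rep M x X Z * quiver_rep M y Z Y)"
proof -
  let ?S = "{\<pi>. x \<pi> \<noteq> 0}" and ?T = "{\<pi>. y \<pi> \<noteq> 0}"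
  let ?xy = "\<lambda>\<pi> \<pi>'. TQ.single_path \<pi> \<otimes>\<^bsub>TP\<^esub> TQ.single_path \<pi>' :: ('a, 'n) path_element"
  have S: "\<pi> \<in> quiver_paths tilting_quiver" if "\<pi> \<in> ?S" for \<pi> using TQ.path_carrierD(1)[OF x] that by blast
  have T: "\<pi> \<in> quiver_paths tilting_quiver" if "\<pi> \<in> ?T" for \<pi> using TQ.path_carrierD(1)[OF y] that by blast
  have "x \<otimes>\<^bsub>TP\<^esub> y = (\<lambda>\<pi>'. \<Sum>\<pi>\<in>?S. x \<pi> * TQ.single_path \<pi> \<pi>') \<otimes>\<^bsub>TP\<^esub>
      (\<lambda>\<pi>'. \<Sum>\<pi>\<in>?T. y \<pi> * TQ.single_path \<pi> \<pi>')"
    using TQ.path_carrier_expand[OF x] TQ.path_carrier_expand[OF y] by simp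
  also have "\<dots> = (\<lambda>\<rho>. \<Sum>\<pi>\<in>?S. \<Sum>\<pi>'\<in>?T. x \<pi> * (y \<pi>' * ?xy \<pi> \<pi>' \<rho>))"
    by (simp only: TQ.path_mult_sum_left TQ.path_mult_sum_right TQ.path_mult_scale_left
        TQ.path_mult_scale_right sum_distrib_left)
  finally have xy: "x \<otimes>\<^bsub>TP\<^esub> y = (\<lambda>\<rho>. \<Sum>\<pi>\<in>?S. \<Sum>\<pi>'\<in>?T. x \<pi> * (y \<pi>' * ?xy \<pi> \<pi>' \<rho>))" .
  have "quiver_rep M (x \<otimes>\<^bsub>TP\<^esub> y) X Y = (\<Sum>\<pi>\<in>?S. \<Sum>\<pi>'\<in>?T. quiver_rep M (\<lambda>\<rho>. x \<pi> * (y \<pi>' * ?xy \<pi> \<pi>' \<rho>)) X Y)"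
  proof -
    have c: "(\<lambda>\<rho>. x \<pi> * (y \<pi>' * ?xy \<pi> \<pi>' \<rho>)) \<in> carrier TP" if "\<pi> \<in> ?S" "\<pi>' \<in> ?T" for \<pi> \<pi>'
      by (intro TQ.path_scale_closed TQ.path_mult_closed TQ.single_path_closed S T that)
    show ?thesis
      unfolding xy by (subst quiver_rep_sum, rule TQ.path_sum_closed, erule (1) c, intro sum.cong refl quiver_rep_sum, erule (1) c)
  qed
  also have "\<dots> = (\<Sum>\<pi>\<in>?S. \<Sum>\<pi>'\<in>?T. x \<pi> * (y \<pi>' * quiver_rep M (?xy \<pi> \<pi>') X Y))"
    by (simp only: quiver_rep_scale)
  also have "\<dots> = (\<Sum>\<pi>\<in>?S. \<Sum>\<pi>'\<in>?T. x \<pi> * (y \<pi>' *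
      (\<Sum>Z\<in>young_ix (CARD('n) - 2). path_matrix M \<pi> X Z * path_matrix M \<pi>' Z Y)))"
  proof (intro sum.cong refl)
    fix \<pi> \<pi>' assume "\<pi> \<in> ?S" "\<pi>' \<in> ?T"
    then show "x \<pi> * (y \<pi>' * quiver_rep M (?xy \<pi> \<pi>') X Y) = x \<pi> * (y \<pi>' *
      (\<Sum>Z\<in>young_ix (CARD('n) - 2). path_matrix M \<pi> X Z * path_matrix M \<pi>' Z Y))"
      using path_matrix_mult[of "fst \<pi>" "snd \<pi>" "fst \<pi>'" "snd \<pi>'" M X Y] S[of \<pi>] T[of \<pi>'] by simp
  qed
  also have "\<dots> = (\<Sum>\<pi>\<in>?S. \<Sum>Z\<in>young_ix (CARD('n) - 2). \<Sum>\<pi>'\<in>?T.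
      (x \<pi> * path_matrix M \<pi> X Z) * (y \<pi>' * path_matrix M \<pi>' Z Y))"
    by (subst (2) sum.swap) (simp add: sum_distrib_left mult_ac)
  also have "\<dots> = (\<Sum>Z\<in>young_ix (CARD('n) - 2). \<Sum>\<pi>\<in>?S. \<Sum>\<pi>'\<in>?T.
      (x \<pi> * path_matrix M \<pi> X Z) * (y \<pi>' * path_matrix M \<pi>' Z Y))"
    by (rule sum.swap)
  also have "\<dots> = (\<Sum>Z\<in>young_ix (CARD('n) - 2). quiver_rep M x X Z * quiver_rep M y Z Y)"
    unfolding quiver_rep_def sum_product ..
  finally show ?thesis .
qed

lemma quiver_rep_one:
  "quiver_rep M (\<one>\<^bsub>TP\<^esub> :: ('a::field_char_0, 'n::finite) path_element) X Y =
    (if X = Y \<and> X \<in> young_ix (CARD('n) - 2) then 1 else 0)"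
proof -
  let ?V = "young (CARD('n) - 2)"
  have one: "(\<one>\<^bsub>TP\<^esub> :: ('a, 'n) path_element) (u, p) = (if u \<in> ?V \<and> p = [] then 1 else 0)" for u p
    by (simp add: TQ.path_one tilting_quiver_sel)
  have "quiver_rep M (\<one>\<^bsub>TP\<^esub> :: ('a, 'n) path_element) X Y =
      (\<Sum>\<pi>\<in>(\<lambda>u. (u, [])) ` ?V. (\<one>\<^bsub>TP\<^esub> :: ('a, 'n) path_element) \<pi> * path_matrix M \<pi> X Y)"
    by (rule quiver_rep_superset) (auto simp: finite_young one split: if_splits)
  also have "\<dots> = (\<Sum>u\<in>?V. path_matrix M (u, []) X Y)"
    by (subst sum.reindex) (auto simp: inj_on_def one)
  also have "\<dots> = (\<Sum>u\<in>?V. if u = fst Y then (if X = Y \<and> X \<in> young_ix (CARD('n) - 2) then 1 else 0) else 0)"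
    by (rule sum.cong, simp, cases X, cases Y) (auto simp: path_matrix_def path_op_Nil)
  also have "\<dots> = (if X = Y \<and> X \<in> young_ix (CARD('n) - 2) then 1 else 0)"
    by (cases Y) (auto simp: finite_young young_ix_iff)
  finally show ?thesis .
qed

lemma coeff_path_op_poly_funs: "(\<lambda>M. coeff (path_op M p h) k) \<in> poly_funs"
proof (induction p arbitrary: k rule: rev_induct)
  case Nil
  then show ?case by (simp add: path_op_Nil poly_funs.const)
next
  case (snoc e p)
  obtain lam i \<rho> where e: "e = (lam, i, \<rho>)" by (metis prod_cases3)
  show ?case
  proof (cases "i = 1")
    case True
    then show ?thesis
      by (cases k) (auto simp: path_op_snoc arrow_op_def e coeff_linear_mult
          intro!: poly_funs_closed snoc.IH simp del: mult_pCons_left)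
  next
    case False
    then show ?thesis
      by (auto simp: path_op_snoc arrow_op_def e coeff_contract intro!: poly_funs_closed snoc.IH)
  qed
qed

lemma poly_funs_if: "F \<in> poly_funs \<Longrightarrow> (\<lambda>M. if C then F M else 0) \<in> poly_funs"
  by (cases C) (simp_all add: poly_funs.const)

lemma quiver_rep_poly_funs: "(\<lambda>M. quiver_rep M x X Y) \<in> poly_funs"
proof -
  have "(\<lambda>M. path_matrix M \<pi> X Y) \<in> poly_funs" for \<pi>
    unfolding path_matrix_def by (rule poly_funs_if) (rule coeff_path_op_poly_funs)
  then show ?thesis
    unfolding quiver_rep_def by (intro poly_funs_sum poly_funs.mult poly_funs.const)
qed

definition frame_change :: "(nat \<Rightarrow> nat \<Rightarrow> 'a::field_char_0) \<Rightarrow> 'a ix_matrix" where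
  "frame_change g X Y = (if fst X = fst Y then schur_matrix (fst X) g (snd X) (snd Y) else 0)"

lemma degree_sym_act: "degree (sym_act g d h) \<le> d"
proof -
  have "degree ([:g 1 1, g 2 1:] ^ (d - b) * [:g 1 2, g 2 2:] ^ b) \<le> d" if "b \<le> d" for b
  proof -
    have "degree ([:g 1 1, g 2 1:] ^ (d - b)) \<le> d - b" "degree ([:g 1 2, g 2 2:] ^ b) \<le> b"
      using degree_power_le[of "[:g 1 1, g 2 1:]" "d - b"] degree_power_le[of "[:g 1 2, g 2 2:]" b]
      by (auto intro: order_trans split: if_splits)
    then show ?thesis using that degree_mult_le[of "[:g 1 1, g 2 1:] ^ (d - b)" "[:g 1 2, g 2 2:] ^ b"] by linarith
  qed
  then show ?thesis
    unfolding sym_act_def by (intro degree_sum_le) (auto intro: order_trans[OF degree_smult_le])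
qed

lemma schur_act_expand:
  assumes "degree h \<le> fst lam - snd lam"
  shows "coeff (schur_act g lam h) a = (\<Sum>m\<le>fst lam - snd lam. coeff (schur_act g lam (monom 1 m)) a * coeff h m)"
proof -
  have "sym_act g (fst lam - snd lam) h =
      (\<Sum>m\<le>fst lam - snd lam. Polynomial.smult (coeff h m) (sym_act g (fst lam - snd lam) (monom 1 m)))"
    by (subst poly_sum_monom[OF assms]) (simp only: sym_act_linear)
  then show ?thesis
    by (simp add: schur_act_def coeff_sum sum_distrib_left mult_ac)
qed

lemma path_matrix_equivariant:
  fixes M :: "'n::finite \<times> bool \<Rightarrow> 'a::field_char_0"
  assumes "\<pi> \<in> quiver_paths tilting_quiver" "X \<in> young_ix (CARD('n) - 2)" "Y \<in> young_ix (CARD('n) - 2)"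
  shows "(\<Sum>Z\<in>young_ix (CARD('n) - 2). path_matrix (gl2_act g M) \<pi> X Z * frame_change g Z Y) =
    (\<Sum>Z\<in>young_ix (CARD('n) - 2). frame_change g X Z * path_matrix M \<pi> Z Y)"
proof -
  let ?m = "CARD('n) - 2"
  obtain lam p where \<pi>: "\<pi> = (lam, p)" by (cases \<pi>)
  define mu where "mu = pre_digraph.awlast tilting_quiver lam p"
  have w: "tilting_walk lam p mu" using assms(1) by (simp add: \<pi> tilting_path_walk mu_def)
  note y = tilting_walk_young[OF w]
  show ?thesis
  proof (cases "fst X = mu \<and> fst Y = lam")
    case False
    then have "(\<Sum>Z\<in>young_ix ?m. path_matrix (gl2_act g M) \<pi> X Z * frame_change g Z Y) = 0"
      by (intro sum.neutral ballI) (auto simp: path_matrix_def frame_change_def \<pi> mu_def)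
    moreover have "(\<Sum>Z\<in>young_ix ?m. frame_change g X Z * path_matrix M \<pi> Z Y) = 0"
      using False by (intro sum.neutral ballI) (auto simp: path_matrix_def frame_change_def \<pi> mu_def)
    ultimately show ?thesis by simp
  next
    case True
    then obtain a b where X: "X = (mu, a)" "a \<le> fst mu - snd mu" and Y: "Y = (lam, b)" "b \<le> fst lam - snd lam"
      using assms by (cases X; cases Y) (auto simp: young_ix_iff)
    have "(\<Sum>Z\<in>young_ix ?m. path_matrix (gl2_act g M) \<pi> X Z * frame_change g Z Y) =
        (\<Sum>c\<le>fst lam - snd lam. path_matrix (gl2_act g M) \<pi> X (lam, c) * frame_change g (lam, c) Y)"
      by (rule sum_young_ix_block[OF y(1)]) (simp add: path_matrix_def \<pi>)
    also have "\<dots> = (\<Sum>c\<le>fst lam - snd lam. coeff (path_op (gl2_act g M) p (monom 1 c)) a *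
        coeff (schur_act g lam (monom 1 b)) c)"
      by (rule sum.cong) (use y X Y in \<open>auto simp: path_matrix_def frame_change_def \<pi> young_ix_iff
          schur_matrix_eq mu_def[symmetric]\<close>)
    also have "\<dots> = coeff (path_op (gl2_act g M) p (schur_act g lam (monom 1 b))) a"
      by (rule path_op_expand[symmetric])
        (auto simp: schur_act_def intro: order_trans[OF degree_smult_le] degree_sym_act)
    also have "\<dots> = coeff (schur_act g mu (path_op M p (monom 1 b))) a"
      by (subst path_op_equivariant[OF w]) (use Y in \<open>simp_all add: degree_monom_eq\<close>)
    also have "\<dots> = (\<Sum>c\<le>fst mu - snd mu. coeff (schur_act g mu (monom 1 c)) a *
        coeff (path_op M p (monom 1 b)) c)"
      by (rule schur_act_expand[OF degree_path_op[OF w]]) (use Y in \<open>simp add: degree_monom_eq\<close>)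
    also have "\<dots> = (\<Sum>c\<le>fst mu - snd mu. frame_change g X (mu, c) * path_matrix M \<pi> (mu, c) Y)"
      by (rule sum.cong) (use y X Y in \<open>auto simp: path_matrix_def frame_change_def \<pi> young_ix_iff
          schur_matrix_eq mu_def[symmetric]\<close>)
    also have "\<dots> = (\<Sum>Z\<in>young_ix ?m. frame_change g X Z * path_matrix M \<pi> Z Y)"
      by (rule sum_young_ix_block[OF y(2), symmetric]) (simp add: path_matrix_def \<pi> mu_def)
    finally show ?thesis .
  qed
qed

lemma quiver_rep_equivariant:
  fixes M :: "'n::finite \<times> bool \<Rightarrow> 'a::field_char_0"
  assumes "x \<in> carrier TP" "X \<in> young_ix (CARD('n) - 2)" "Y \<in> young_ix (CARD('n) - 2)"
  shows "(\<Sum>Z\<in>young_ix (CARD('n) - 2). quiver_rep (gl2_act g M) x X Z * frame_change g Z Y) =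
    (\<Sum>Z\<in>young_ix (CARD('n) - 2). frame_change g X Z * quiver_rep M x Z Y)"
proof -
  let ?S = "{\<pi>. x \<pi> \<noteq> 0}"
  have "(\<Sum>Z\<in>young_ix (CARD('n) - 2). quiver_rep (gl2_act g M) x X Z * frame_change g Z Y) =
      (\<Sum>\<pi>\<in>?S. x \<pi> * (\<Sum>Z\<in>young_ix (CARD('n) - 2). path_matrix (gl2_act g M) \<pi> X Z * frame_change g Z Y))"
    unfolding quiver_rep_def sum_distrib_right sum_distrib_left by (subst sum.swap) (simp add: mult_ac)
  also have "\<dots> = (\<Sum>\<pi>\<in>?S. x \<pi> * (\<Sum>Z\<in>young_ix (CARD('n) - 2). frame_change g X Z * path_matrix M \<pi> Z Y))"
    by (intro sum.cong refl) (simp add: path_matrix_equivariant[OF TQ.path_carrierD(1)[OF assms(1)] assms(2,3)])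
  also have "\<dots> = (\<Sum>Z\<in>young_ix (CARD('n) - 2). frame_change g X Z * quiver_rep M x Z Y)"
    unfolding quiver_rep_def sum_distrib_left by (subst sum.swap) (simp add: mult_ac)
  finally show ?thesis .
qed

lemma quiver_rep_off_ix:
  "X \<notin> young_ix (CARD('n) - 2) \<or> Y \<notin> young_ix (CARD('n) - 2) \<Longrightarrow>
    quiver_rep M (x :: ('a::field_char_0, 'n::finite) path_element) X Y = 0"
  unfolding quiver_rep_def by (rule sum.neutral) (auto simp: path_matrix_def)

lemma quiver_rep_diff:
  assumes "x \<in> carrier TP" "y \<in> carrier TP"
  shows "quiver_rep M (\<lambda>\<pi>. x \<pi> - y \<pi>) X Y = quiver_rep M x X Y - quiver_rep M y X Y"
  using quiver_rep_add[OF assms(1) TQ.path_scale_closed[OF assms(2), of "-1"], of M X Y]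
    quiver_rep_scale[of M "-1" y X Y] by simp

lemma two_step_path:
  "add_e lam i = mu \<Longrightarrow> arrow tilting_quiver (mu, i', j) \<otimes>\<^bsub>TP\<^esub> arrow tilting_quiver (lam, i, k) =
    TQ.single_path (lam, [(lam, i, k), (mu, i', j)])"
  unfolding arrow_single_path[of lam]
  by (subst TQ.arrow_mult_single) (simp_all add: tilting_quiver_sel pre_digraph.awalk_verts.simps)

lemma quiver_rep_two_step:
  fixes M :: "'n::finite \<times> bool \<Rightarrow> 'a::field_char_0"
  assumes "add_e lam i = mu" "add_e mu i' = nu"
  shows "quiver_rep M (arrow tilting_quiver (mu, i', j) \<otimes>\<^bsub>TP\<^esub> arrow tilting_quiver (lam, i, k)) X Y =
    (if fst Y = lam \<and> fst X = nu \<and> X \<in> young_ix (CARD('n) - 2) \<and> Y \<in> young_ix (CARD('n) - 2)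
     then coeff (arrow_op M (mu, i', j) (arrow_op M (lam, i, k) (monom 1 (snd Y)))) (snd X) else 0)"
  unfolding two_step_path[OF assms(1)] quiver_rep_single path_matrix_def
  by (simp add: tilting_quiver_sel pre_digraph.awalk_verts.simps assms path_op_def)

lemma arrow_op_simps:
  "arrow_op M (lam, 1, j) h = [:M (j, False), M (j, True):] * h"
  "arrow_op M (lam, 2, j) h = contract (M (j, False)) (M (j, True)) (fst lam - snd lam) h"
  by (simp_all add: arrow_op_def)

section \<open>The representation satisfies the relations\<close>

lemma contract_commute:
  assumes "2 \<le> d"
  shows "contract u v (d - 1) (contract u' v' d h) = contract u' v' (d - 1) (contract u v d h)"
  using assms by (intro poly_eqI) (simp add: coeff_contract of_nat_diff algebra_simps)

lemma contract_linear_mult_antisym: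
  "contract u v 1 ([:u', v':] * monom 1 0) + contract u' v' 1 ([:u, v:] * monom 1 0) = 0"
  by (simp add: contract_linear_poly monom_0)

text \<open>By the Leibniz rule the first term contributes d (u v' - v u') h. The remaining products
  of linear forms and contractions leave (v u' - u v') (x d_x + y d_y) h, and Euler's identity for
  degree \<open>d\<close> makes the two cancel.\<close>

lemma contract_linear_mult:
  assumes "1 \<le> d"
  shows "Polynomial.smult (of_nat d) (contract u v (d + 1) ([:u', v':] * h)) -
    Polynomial.smult (of_nat (d + 1)) ([:u', v':] * contract u v d h) + [:u, v:] * contract u' v' d h = 0"
proof (rule poly_eqI)
  fix k
  show "coeff (Polynomial.smult (of_nat d) (contract u v (d + 1) ([:u', v':] * h)) -
    Polynomial.smult (of_nat (d + 1)) ([:u', v':] * contract u v d h) + [:u, v:] * contract u' v' d h) k = coeff 0 k"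
    unfolding coeff_add coeff_diff coeff_smult coeff_contract coeff_linear_mult
    by (cases k) (simp_all add: coeff_contract algebra_simps)
qed

lemma quiver_rep_relation:
  fixes r :: "('a::field_char_0, 'n::finite) path_element"
  assumes "r \<in> tilting_relations"
  shows "quiver_rep M r X Y = 0"
proof -
  let ?m = "CARD('n) - 2"
  from assms obtain lam \<mu> where P2: "(lam, \<mu>) \<in> P2 ?m" and r: "r \<in> K_set lam \<mu>"
    by (auto simp: tilting_relations_def)
  note closed = TQ.path_mult_closed fmul_arrow_closed gmul_arrow_closed TQ.path_scale_closed
  from P2 show ?thesis
  proof (cases rule: P2_cases)
    case 1
    let ?lf = "(fst lam + 1, snd lam)"
    have c: "fmul ?lf j (arrow tilting_quiver (lam, 1, i)) \<in> (carrier TP :: ('a, 'n) path_element set)" for i j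
      unfolding fmul_def by (intro closed) (use 1 in \<open>auto simp: young_def\<close>)
    from r obtain i j where "r = (\<lambda>\<pi>. fmul ?lf j (arrow tilting_quiver (lam, 1, i)) \<pi> -
        fmul ?lf i (arrow tilting_quiver (lam, 1, j)) \<pi>)"
      unfolding 1(3) K_set_ff[OF 1(1-2)] by blast
    then have "quiver_rep M r X Y = quiver_rep M (fmul ?lf j (arrow tilting_quiver (lam, 1, i))) X Y -
        quiver_rep M (fmul ?lf i (arrow tilting_quiver (lam, 1, j))) X Y"
      by (simp only: quiver_rep_diff c)
    then show ?thesis
      unfolding fmul_def quiver_rep_two_step[OF add_e_simps(1) refl] arrow_op_simps
      by (simp add: mult.left_commute del: mult_pCons_left mult_pCons_right One_nat_def)
  next
    case 2
    let ?lg = "(fst lam, snd lam + 1)"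
    have c: "gmul ?lg j (arrow tilting_quiver (lam, 2, i)) \<in> (carrier TP :: ('a, 'n) path_element set)" for i j
      unfolding gmul_def by (intro closed) (use 2 in \<open>auto simp: young_def\<close>)
    from r obtain i j where "r = (\<lambda>\<pi>. gmul ?lg j (arrow tilting_quiver (lam, 2, i)) \<pi> -
        gmul ?lg i (arrow tilting_quiver (lam, 2, j)) \<pi>)"
      unfolding 2(3) K_set_gg[OF 2(1-2)] by blast
    then have "quiver_rep M r X Y = quiver_rep M (gmul ?lg j (arrow tilting_quiver (lam, 2, i))) X Y -
        quiver_rep M (gmul ?lg i (arrow tilting_quiver (lam, 2, j))) X Y"
      by (simp only: quiver_rep_diff c)
    moreover have "fst ?lg - snd ?lg = fst lam - snd lam - 1" by simp
    ultimately show ?thesis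
      unfolding gmul_def quiver_rep_two_step[OF add_e_simps(2) refl] arrow_op_simps
      using contract_commute[of "fst lam - snd lam" "M (j, False)" "M (j, True)" "M (i, False)" "M (i, True)"
          "monom 1 (snd Y)"] 2(2) by simp
  next
    case 3
    let ?lf = "(fst lam + 1, snd lam)"
    have c: "gmul ?lf j (arrow tilting_quiver (lam, 1, i)) \<in> (carrier TP :: ('a, 'n) path_element set)" for i j
      unfolding gmul_def by (intro closed) (use 3 in \<open>auto simp: young_def\<close>)
    from r obtain i j where "r = (\<lambda>\<pi>. gmul ?lf j (arrow tilting_quiver (lam, 1, i)) \<pi> +
        gmul ?lf i (arrow tilting_quiver (lam, 1, j)) \<pi>)"
      unfolding 3(4) K_set_gf_diagonal[OF 3(3)] by blast
    then have "quiver_rep M r X Y = quiver_rep M (gmul ?lf j (arrow tilting_quiver (lam, 1, i))) X Y +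
        quiver_rep M (gmul ?lf i (arrow tilting_quiver (lam, 1, j))) X Y"
      by (simp only: quiver_rep_add c)
    \<comment> \<open>On the diagonal the source summand has rank one, so only the constant monomial
      has to be tested.\<close>
    moreover have "snd Y = 0" if "fst Y = lam" "Y \<in> young_ix ?m"
      using that 3(3) by (cases Y) (auto simp: young_ix_iff)
    moreover have "fst ?lf - snd ?lf = 1" using 3 by simp
    ultimately show ?thesis
      unfolding gmul_def quiver_rep_two_step[OF add_e_simps(1) refl] arrow_op_simps
      using contract_linear_mult_antisym[of "M (j, False)" "M (j, True)" "M (i, False)" "M (i, True)"]
      by (auto simp flip: coeff_add simp del: mult_pCons_left mult_pCons_right One_nat_def)
  next
    case 4
    let ?lf = "(fst lam + 1, snd lam)" and ?lg = "(fst lam, snd lam + 1)"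
    let ?d = "fst lam - snd lam"
    have c: "gmul ?lf j (arrow tilting_quiver (lam, 1, i)) \<in> (carrier TP :: ('a, 'n) path_element set)"
      "fmul ?lg j (arrow tilting_quiver (lam, 2, i)) \<in> (carrier TP :: ('a, 'n) path_element set)" for i j
      unfolding gmul_def fmul_def by (intro closed; use 4 in \<open>auto simp: young_def\<close>)+
    from r obtain i j where r: "r = (\<lambda>\<pi>. of_nat ?d * gmul ?lf j (arrow tilting_quiver (lam, 1, i)) \<pi> -
        of_nat (?d + 1) * fmul ?lg i (arrow tilting_quiver (lam, 2, j)) \<pi> +
        fmul ?lg j (arrow tilting_quiver (lam, 2, i)) \<pi>)"
      unfolding 4(4) K_set_gf[OF 4(1-3)] by blast
    have diff: "(\<lambda>\<pi>. x \<pi> - y \<pi>) \<in> carrier TP" if "x \<in> carrier TP" "y \<in> carrier TP"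
      for x y :: "('a, 'n) path_element"
      using TQ.path_add_closed[OF that(1) TQ.path_scale_closed[OF that(2), of "-1"]] by simp
    have *: "quiver_rep M r X Y =
        of_nat ?d * quiver_rep M (gmul ?lf j (arrow tilting_quiver (lam, 1, i))) X Y -
        of_nat (?d + 1) * quiver_rep M (fmul ?lg i (arrow tilting_quiver (lam, 2, j))) X Y +
        quiver_rep M (fmul ?lg j (arrow tilting_quiver (lam, 2, i))) X Y"
      unfolding r by (simp only: quiver_rep_add quiver_rep_diff quiver_rep_scale diff c TQ.path_scale_closed)
    have d: "fst ?lf - snd ?lf = ?d + 1" "1 \<le> ?d" using 4 by auto
    have "of_nat ?d * coeff (contract (M (j, False)) (M (j, True)) (?d + 1) ([:M (i, False), M (i, True):] * h)) k -
        of_nat (?d + 1) * coeff ([:M (i, False), M (i, True):] * contract (M (j, False)) (M (j, True)) ?d h) k +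
        coeff ([:M (j, False), M (j, True):] * contract (M (i, False)) (M (i, True)) ?d h) k = 0" for h k
      using arg_cong[OF contract_linear_mult[OF d(2)], of "\<lambda>h. coeff h k"]
      by (simp only: coeff_add coeff_diff coeff_smult coeff_0)
    then show ?thesis
      unfolding * gmul_def fmul_def quiver_rep_two_step[OF add_e_simps(1) refl]
        quiver_rep_two_step[OF add_e_simps(2) refl] arrow_op_simps d(1)
      by (simp add: add_e_simps del: mult_pCons_left mult_pCons_right One_nat_def of_nat_add)
  qed
qed

lemma quiver_rep_arrow_mult:
  fixes M :: "'n::finite \<times> bool \<Rightarrow> 'a::field_char_0"
  assumes arc: "(nu, i, j) \<in> arcs tilting_quiver" and x: "x \<in> carrier TP"
    and rep: "\<And>Z Y. quiver_rep M x Z Y = (if fst Z = nu \<and> fst Y = lam \<and> Z \<in> young_ix (CARD('n) - 2) \<and>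
      Y \<in> young_ix (CARD('n) - 2) then h Y (snd Z) else 0)"
  shows "quiver_rep M (arrow tilting_quiver (nu, i, j) \<otimes>\<^bsub>TP\<^esub> x) X Y =
    (if fst X = add_e nu i \<and> fst Y = lam \<and> X \<in> young_ix (CARD('n) - 2) \<and> Y \<in> young_ix (CARD('n) - 2)
     then coeff (arrow_op M (nu, i, j) (\<Sum>m\<le>fst nu - snd nu. monom (h Y m) m)) (snd X) else 0)"
proof -
  let ?m = "CARD('n) - 2" and ?l = "fst nu - snd nu"
  let ?H = "\<Sum>m\<le>?l. monom (h Y m) m"
  have nu: "nu \<in> young ?m" using arc by (simp add: tilting_arcs_iff)
  have pm: "path_matrix M (nu, [(nu, i, j)]) X Z = (if fst Z = nu \<and> fst X = add_e nu i \<and>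
      X \<in> young_ix ?m \<and> Z \<in> young_ix ?m then coeff (path_op M [(nu, i, j)] (monom 1 (snd Z))) (snd X) else 0)" for Z
    by (simp add: path_matrix_def tilting_quiver_sel pre_digraph.awalk_verts.simps)
  have "quiver_rep M (arrow tilting_quiver (nu, i, j) \<otimes>\<^bsub>TP\<^esub> x) X Y =
      (\<Sum>Z\<in>young_ix ?m. path_matrix M (nu, [(nu, i, j)]) X Z * quiver_rep M x Z Y)"
    using quiver_rep_mult[OF TQ.arrow_closed[OF arc] x, of M X Y]
    by (simp add: arrow_single_path quiver_rep_single)
  also have "\<dots> = (\<Sum>m\<le>?l. path_matrix M (nu, [(nu, i, j)]) X (nu, m) * quiver_rep M x (nu, m) Y)"
    by (rule sum_young_ix_block[OF nu]) (simp add: rep)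
  also have "\<dots> = (if fst X = add_e nu i \<and> fst Y = lam \<and> X \<in> young_ix ?m \<and> Y \<in> young_ix ?m
      then (\<Sum>m\<le>?l. coeff (path_op M [(nu, i, j)] (monom 1 m)) (snd X) * coeff ?H m) else 0)"
    by (auto simp: pm rep young_ix_iff nu coeff_sum intro!: sum.cong)
  also have "(\<Sum>m\<le>?l. coeff (path_op M [(nu, i, j)] (monom 1 m)) (snd X) * coeff ?H m) =
      coeff (path_op M [(nu, i, j)] ?H) (snd X)"
    by (rule path_op_expand[symmetric]) (auto intro!: degree_sum_le order_trans[OF degree_monom_le])
  finally show ?thesis by (simp add: path_op_def)
qed

section \<open>The map \<open>psi\<close> as a section of the representation, and the kernel\<close>

definition block_rep ::
    "('n::finite \<times> bool \<Rightarrow> 'a::field_char_0) \<Rightarrow> nat \<times> nat \<Rightarrow> nat \<times> nat \<Rightarrow> ('a, 'n) coeff_family \<Rightarrow> 'a ix_matrix" where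
  "block_rep M lam mu F X Y = (if fst X = mu \<and> fst Y = lam \<and> X \<in> young_ix (CARD('n) - 2) \<and>
     Y \<in> young_ix (CARD('n) - 2) then F (int (snd X)) (int (snd Y)) M else 0)"

lemma hom_maps_outside:
  assumes "F \<in> hom_maps lam mu" "\<not> (0 \<le> a \<and> a \<le> level mu \<and> 0 \<le> b \<and> b \<le> level lam)"
  shows "F a b M = 0"
  using equivariant_mapsD(2)[OF assms(1)[unfolded hom_maps_def], of a b] assms(2)
  unfolding hom_maps_level by (metis (full_types))

lemma coeff_block_poly:
  fixes F :: "('a::field_char_0, 'n::finite) coeff_family"
  assumes "F \<in> hom_maps lam nu" "snd nu \<le> fst nu"
  shows "coeff (\<Sum>m\<le>fst nu - snd nu. monom (F (int m) b M) m) k = F (int k) b M"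
proof -
  have "coeff (\<Sum>m\<le>fst nu - snd nu. monom (F (int m) b M) m) k =
      (if k \<le> fst nu - snd nu then F (int k) b M else 0)"
    by (simp add: coeff_sum)
  moreover have "F (int k) b M = 0" if "\<not> k \<le> fst nu - snd nu"
    by (rule hom_maps_outside[OF assms(1)]) (use that assms(2) in \<open>auto simp: level_def\<close>)
  ultimately show ?thesis by auto
qed

lemma quiver_rep_fmul:
  fixes F :: "('a::field_char_0, 'n::finite) coeff_family"
  assumes F: "F \<in> hom_maps lam nu" and nu: "nu \<in> young (CARD('n) - 2)" "fst nu + 1 \<le> CARD('n) - 2"
    and x: "x \<in> carrier TP" "\<And>X Y. quiver_rep M x X Y = block_rep M lam nu F X Y"
  shows "quiver_rep M (fmul nu j x) X Y = block_rep M lam (fst nu + 1, snd nu) (raise_f j F) X Y"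
proof -
  have nu': "snd nu \<le> fst nu" using nu by (simp add: young_def)
  have F0: "F (- 1) b M = 0" for b by (rule hom_maps_outside[OF F]) simp
  have "quiver_rep M (fmul nu j x) X Y =
    (if fst X = add_e nu 1 \<and> fst Y = lam \<and> X \<in> young_ix (CARD('n) - 2) \<and> Y \<in> young_ix (CARD('n) - 2)
     then coeff (arrow_op M (nu, 1, j) (\<Sum>m\<le>fst nu - snd nu. monom (F (int m) (int (snd Y)) M) m)) (snd X) else 0)"
    unfolding fmul_def
    by (rule quiver_rep_arrow_mult) (use nu x in \<open>auto simp: tilting_arcs_iff add_e_simps young_def block_rep_def\<close>)
  then show ?thesis
    unfolding arrow_op_simps coeff_linear_mult coeff_block_poly[OF F nu']
    by (simp add: block_rep_def raise_f_def add_e_simps F0 split: nat.split)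
qed

lemma quiver_rep_gmul:
  fixes F :: "('a::field_char_0, 'n::finite) coeff_family"
  assumes F: "F \<in> hom_maps lam nu" and nu: "nu \<in> young (CARD('n) - 2)" "snd nu + 1 \<le> fst nu"
    and x: "x \<in> carrier TP" "\<And>X Y. quiver_rep M x X Y = block_rep M lam nu F X Y"
  shows "quiver_rep M (gmul nu j x) X Y = block_rep M lam (fst nu, snd nu + 1) (raise_g j (level nu) F) X Y"
proof -
  have nu': "snd nu \<le> fst nu" using nu by (simp add: young_def)
  have "quiver_rep M (gmul nu j x) X Y =
    (if fst X = add_e nu 2 \<and> fst Y = lam \<and> X \<in> young_ix (CARD('n) - 2) \<and> Y \<in> young_ix (CARD('n) - 2)
     then coeff (arrow_op M (nu, 2, j) (\<Sum>m\<le>fst nu - snd nu. monom (F (int m) (int (snd Y)) M) m)) (snd X) else 0)"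
    unfolding gmul_def
    by (rule quiver_rep_arrow_mult) (use nu x in \<open>auto simp: tilting_arcs_iff add_e_simps young_def block_rep_def\<close>)
  then show ?thesis
    unfolding arrow_op_simps coeff_contract coeff_block_poly[OF F nu']
    using nu' by (simp add: block_rep_def raise_g_def add_e_simps level_def of_nat_diff algebra_simps)
qed

text \<open>Under the representation \<open>fmul\<close> and \<open>gmul\<close> become
  \<open>raise_f\<close> and \<open>raise_g\<close>, so the recursion of \<open>psi\<close> turns
  into the Euler identity; Schur's lemma settles degree 0.\<close>

lemma quiver_rep_psi:
  fixes F :: "('a::field_char_0, 'n::finite) coeff_family"
  assumes "F \<in> hom_maps lam mu" "lam \<in> young (CARD('n) - 2)" "mu \<in> young (CARD('n) - 2)"
    and "int (fst mu) - int (fst lam) + (int (snd mu) - int (snd lam)) = int N"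
  shows "quiver_rep M (psi N lam mu F) X Y = block_rep M lam mu F X Y"
  using assms(1,3,4)
proof (induction N arbitrary: mu F X Y)
  case 0
  show ?case
  proof (cases "lam = mu")
    case True
    have F: "F \<in> equivariant_maps (level lam) 0 0" using "0.prems"(1) True by (simp add: hom_maps_def)
    define c where "c = F 0 0 (\<lambda>_. 0)"
    have psi: "psi 0 lam mu F = (\<lambda>\<pi>. c * TQ.single_path (lam, []) \<pi>)"
      using True by (simp add: c_def)
    have pm: "path_matrix M (lam, []) X Y = (if fst X = lam \<and> fst Y = lam \<and> X \<in> young_ix (CARD('n) - 2) \<and>
        Y \<in> young_ix (CARD('n) - 2) then if snd X = snd Y then 1 else 0 else 0)"
      by (auto simp: path_matrix_def pre_digraph.awalk_verts.simps path_op_Nil)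
    have "F (int (snd X)) (int (snd Y)) M = (if snd X = snd Y \<and> int (snd Y) \<le> level lam then c else 0)"
      unfolding c_def by (subst equivariant_maps_scalar[OF F]) simp
    moreover have "int (snd Y) \<le> level lam" if "fst Y = lam" "Y \<in> young_ix (CARD('n) - 2)"
      using that by (cases Y) (auto simp: young_ix_iff young_def level_def)
    ultimately show ?thesis
      unfolding psi quiver_rep_scale quiver_rep_single pm block_rep_def using True by simp
  next
    case False
    have "F a b M' = 0" for a b M'
      by (rule equivariant_maps_degree_0_eq_0[OF "0.prems"(1)[unfolded hom_maps_def]])
        (use "0.prems"(3) False in \<open>auto simp: prod_eq_iff\<close>)
    with False show ?thesis by (simp add: quiver_rep_zero block_rep_def)
  qed
next
  case (Suc N)
  let ?m = "CARD('n) - 2"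
  let ?e = "level mu"
  note F = Suc.prems(1) and mu = Suc.prems(2)
  have mu': "snd mu \<le> fst mu" "fst mu \<le> ?m" using mu by (auto simp: young_def)
  define muf where "muf = (fst mu - 1, snd mu)"
  define mug where "mug = (fst mu, snd mu - 1)"
  define A where "A i = fmul muf i (psi N lam muf (lower_f i ?e F))" for i
  define B where "B i = gmul mug i (psi N lam mug (lower_g i F))" for i
  have A: "A i \<in> carrier TP" "quiver_rep M (A i) X Y = block_rep M lam mu (raise_f i (lower_f i ?e F)) X Y" for i X Y
  proof -
    have "A i \<in> carrier TP \<and> quiver_rep M (A i) X Y = block_rep M lam mu (raise_f i (lower_f i ?e F)) X Y"
    proof (cases "snd mu < fst mu")
      case True
      note lf = lower_f_hom_maps[OF F True, of i, folded muf_def]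
      have y: "muf \<in> young ?m" "fst muf + 1 \<le> ?m" "(fst muf + 1, snd muf) = mu"
        "int (fst muf) - int (fst lam) + (int (snd muf) - int (snd lam)) = int N"
        using mu' True Suc.prems(3) by (auto simp: muf_def young_def)
      have c: "psi N lam muf (lower_f i ?e F) \<in> carrier TP" by (rule psi_closed[OF lf assms(2) y(1)])
      have "quiver_rep M (A i) X Y = block_rep M lam mu (raise_f i (lower_f i ?e F)) X Y"
        using quiver_rep_fmul[OF lf y(1,2) c Suc.IH[OF lf y(1,4)]] unfolding y(3) A_def by blast
      with c y show ?thesis by (simp add: A_def fmul_closed)
    next
      case False
      then have "lower_f i ?e F = (\<lambda>_ _ _. 0)" using lower_f_eq_0[OF F] mu' by auto
      then show ?thesis
        by (simp add: A_def psi_zero fmul_linear TQ.path_zero_closed quiver_rep_zero block_rep_def raise_f_def)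
    qed
    then show "A i \<in> carrier TP" "quiver_rep M (A i) X Y = block_rep M lam mu (raise_f i (lower_f i ?e F)) X Y"
      by blast+
  qed
  have B: "B i \<in> carrier TP" "quiver_rep M (B i) X Y = block_rep M lam mu (raise_g i (?e + 1) (lower_g i F)) X Y" for i X Y
  proof -
    have "B i \<in> carrier TP \<and> quiver_rep M (B i) X Y = block_rep M lam mu (raise_g i (?e + 1) (lower_g i F)) X Y"
    proof (cases "0 < snd mu")
      case True
      note lg = lower_g_hom_maps[OF F True, of i, folded mug_def]
      have y: "mug \<in> young ?m" "snd mug + 1 \<le> fst mug" "(fst mug, snd mug + 1) = mu"
        "int (fst mug) - int (fst lam) + (int (snd mug) - int (snd lam)) = int N" "level mug = ?e + 1"
        using mu' True Suc.prems(3) by (auto simp: mug_def young_def level_def)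
      have c: "psi N lam mug (lower_g i F) \<in> carrier TP" by (rule psi_closed[OF lg assms(2) y(1)])
      have "quiver_rep M (B i) X Y = block_rep M lam mu (raise_g i (?e + 1) (lower_g i F)) X Y"
        using quiver_rep_gmul[OF lg y(1,2) c Suc.IH[OF lg y(1,4)]] unfolding y(3,5) B_def by blast
      with c y show ?thesis by (simp add: B_def gmul_closed)
    next
      case False
      then have "lower_g i F = (\<lambda>_ _ _. 0)" using lower_g_eq_0[OF F] by auto
      then show ?thesis
        by (simp add: B_def psi_zero gmul_linear TQ.path_zero_closed quiver_rep_zero block_rep_def raise_g_def)
    qed
    then show "B i \<in> carrier TP" "quiver_rep M (B i) X Y = block_rep M lam mu (raise_g i (?e + 1) (lower_g i F)) X Y"
      by blast+
  qed
  let ?c = "of_int ((?e + 1) * (int N + 1)) :: 'a"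
  have "?e + 1 \<noteq> 0" using mu' by (simp add: level_def)
  then have "(?e + 1) * (int N + 1) \<noteq> 0" by simp
  then have c: "?c \<noteq> 0" by (simp only: of_int_eq_0_iff not_False_eq_True)
  have sum: "(\<Sum>i\<in>UNIV. raise_f i (lower_f i ?e F) a b M + raise_g i (?e + 1) (lower_g i F) a b M) = ?c * F a b M" for a b
  proof -
    have e: "?e = level lam + (int (fst mu) - int (fst lam)) - (int (snd mu) - int (snd lam))"
      unfolding hom_maps_level ..
    have N: "int (fst mu) - int (fst lam) + (int (snd mu) - int (snd lam)) = int N + 1"
      using Suc.prems(3) by simp
    show ?thesis
      using equivariant_maps_lower_sum[OF F[unfolded hom_maps_def] e, of a b M] unfolding N by simp
  qed
  have "psi (Suc N) lam mu F = (\<lambda>\<pi>. inverse ?c * (\<Sum>i\<in>UNIV. A i \<pi> + B i \<pi>))"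
    by (simp only: psi.simps(2) A_def B_def muf_def mug_def)
  then have "quiver_rep M (psi (Suc N) lam mu F) X Y = inverse ?c * (\<Sum>i\<in>UNIV. quiver_rep M (A i) X Y + quiver_rep M (B i) X Y)"
    by (simp only: quiver_rep_scale quiver_rep_sum quiver_rep_add A(1) B(1) TQ.path_add_closed)
  also have "\<dots> = inverse ?c * (\<Sum>i\<in>UNIV. block_rep M lam mu (raise_f i (lower_f i ?e F)) X Y +
      block_rep M lam mu (raise_g i (?e + 1) (lower_g i F)) X Y)"
    by (simp only: A(2) B(2))
  also have "\<dots> = block_rep M lam mu F X Y"
  proof (cases "fst X = mu \<and> fst Y = lam \<and> X \<in> young_ix ?m \<and> Y \<in> young_ix ?m")
    case True
    show ?thesis
      unfolding block_rep_def if_P[OF True] sum mult.assoc[symmetric] left_inverse[OF c] mult_1 ..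
  next
    case False
    show ?thesis
      unfolding block_rep_def if_not_P[OF False] by simp
  qed
  finally show ?case .
qed

text \<open>Reads the family of maps off the representing matrices, so that a linear dependence
  among the matrices of paths becomes one among families, to which \<open>psi\<close> can be
  applied.\<close>

definition rep_block :: "('a::field_char_0, 'n::finite) path_element \<Rightarrow> nat \<times> nat \<Rightarrow> nat \<times> nat \<Rightarrow>
    ('a, 'n) coeff_family" where
  "rep_block x lam mu = (\<lambda>a b M. if 0 \<le> a \<and> 0 \<le> b then quiver_rep M x (mu, nat a) (lam, nat b) else 0)"

lemma rep_block_eqI:
  fixes F :: "('a::field_char_0, 'n::finite) coeff_family"
  assumes F: "F \<in> hom_maps lam mu" and "lam \<in> young (CARD('n) - 2)" "mu \<in> young (CARD('n) - 2)"
    and rep: "\<And>M X Y. quiver_rep M x X Y = block_rep M lam mu F X Y"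
  shows "rep_block x lam mu = F"
proof (intro ext)
  fix a b M
  show "rep_block x lam mu a b M = F a b M"
  proof (cases "0 \<le> a \<and> a \<le> level mu \<and> 0 \<le> b \<and> b \<le> level lam")
    case True
    then have "nat a \<le> fst mu - snd mu" "nat b \<le> fst lam - snd lam" by (auto simp: level_def)
    then show ?thesis
      using True assms(2,3) by (simp add: rep_block_def rep block_rep_def young_ix_iff)
  next
    case False
    then have "F a b M = 0" by (rule hom_maps_outside[OF F])
    then show ?thesis by (simp add: rep_block_def rep block_rep_def)
  qed
qed

lemma identity_hom_maps: "(\<lambda>a b _. if a = b \<and> 0 \<le> b \<and> b \<le> level lam then 1 else 0) \<in> hom_maps lam lam"
  using identity_equivariant[of "level lam"] by (simp add: hom_maps_def)

lemma tilting_walk_awlast: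
  "tilting_walk lam (p :: (_ \<times> _ \<times> 'n::finite) list) mu \<Longrightarrow> pre_digraph.awlast tilting_quiver lam p = mu"
  by (erule TQ.awalkE)

text \<open>Appending an arrow raises the represented map and multiplies the path on the left;
  \<open>psi_raise\<close> compares the two modulo the ideal, and the earlier congruence is
  multiplied by the arrow.\<close>

lemma psi_single_path:
  fixes p :: "((nat \<times> nat) \<times> nat \<times> 'n::finite) list"
  assumes "tilting_walk lam p mu"
  shows "\<exists>F :: ('a::field_char_0, 'n) coeff_family. F \<in> hom_maps lam mu \<and>
    (\<forall>M X Y. quiver_rep M (TQ.single_path (lam, p)) X Y = block_rep M lam mu F X Y) \<and>
    int (fst mu) - int (fst lam) + (int (snd mu) - int (snd lam)) = int (length p) \<and>
    (\<lambda>\<pi>. psi (length p) lam mu F \<pi> - TQ.single_path (lam, p) \<pi>) \<in> tilting_ideal"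
  using assms
proof (induction p arbitrary: mu rule: rev_induct)
  case Nil
  then have mu: "mu = lam" "lam \<in> young (CARD('n) - 2)"
    by (auto simp: TQ.awalk_Nil_iff tilting_quiver_sel)
  let ?F = "\<lambda>a b _. if a = b \<and> 0 \<le> b \<and> b \<le> level lam then 1 else (0 :: 'a)"
  have "quiver_rep M (TQ.single_path (lam, [])) X Y = block_rep M lam lam ?F X Y"
    for M :: "'n \<times> bool \<Rightarrow> 'a" and X Y
  proof -
    have "int (snd Y) \<le> level lam" if "fst Y = lam" "Y \<in> young_ix (CARD('n) - 2)"
      using that by (cases Y) (auto simp: young_ix_iff young_def level_def)
    then show ?thesis
      by (auto simp: quiver_rep_single path_matrix_def block_rep_def pre_digraph.awalk_verts.simps path_op_Nil)
  qed
  moreover have lv: "0 \<le> level lam" using mu(2) by (simp add: level_def young_def)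
  then have "psi (length ([] :: ((nat \<times> nat) \<times> nat \<times> 'n) list)) lam lam ?F = TQ.single_path (lam, [])"
    by (simp add: fun_eq_iff)
  ultimately show ?case
    unfolding mu(1) using identity_hom_maps[of lam] lv by (intro exI[of _ ?F]) (simp add: tilting_ideal_zero)
next
  case (snoc e p)
  from snoc.prems show ?case
  proof (cases rule: tilting_walk_snoc_cases)
    case (1 j nu)
    obtain F :: "('a, 'n) coeff_family" where F: "F \<in> hom_maps lam nu"
      and rep: "\<And>M X Y. quiver_rep M (TQ.single_path (lam, p)) X Y = block_rep M lam nu F X Y"
      and len: "int (fst nu) - int (fst lam) + (int (snd nu) - int (snd lam)) = int (length p)"
      and I: "(\<lambda>\<pi>. psi (length p) lam nu F \<pi> - TQ.single_path (lam, p) \<pi>) \<in> tilting_ideal"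
      using snoc.IH[OF 1(2)] by blast
    have last: "pre_digraph.awlast tilting_quiver lam p = nu" by (rule tilting_walk_awlast[OF 1(2)])
    have sp: "TQ.single_path (lam, p @ [e]) = fmul nu j (TQ.single_path (lam, p) :: ('a, 'n) path_element)"
      unfolding fmul_def 1(1) by (rule TQ.arrow_mult_single[symmetric]) (simp add: last tilting_quiver_sel)
    have lam: "lam \<in> young (CARD('n) - 2)" using tilting_walk_young[OF 1(2)] by blast
    have c: "TQ.single_path (lam, p) \<in> (carrier TP :: ('a, 'n) path_element set)"
      by (rule TQ.single_path_closed) (use 1(2) last in \<open>simp add: tilting_path_walk\<close>)
    have "(\<lambda>\<pi>. psi (Suc (length p)) lam mu (raise_f j F) \<pi> - fmul nu j (psi (length p) lam nu F) \<pi>) \<in> tilting_ideal"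
      using psi_raise[OF F lam 1(4) len] 1(3,5) by auto
    from tilting_ideal_add[OF this tilting_ideal_fmul[OF 1(4,5) I, of j]]
    have "(\<lambda>\<pi>. psi (length (p @ [e])) lam mu (raise_f j F) \<pi> - TQ.single_path (lam, p @ [e]) \<pi>) \<in> tilting_ideal"
      unfolding sp fmul_linear by simp
    moreover have "quiver_rep M (TQ.single_path (lam, p @ [e])) X Y = block_rep M lam mu (raise_f j F) X Y"
      for M :: "'n \<times> bool \<Rightarrow> 'a" and X Y
      unfolding sp 1(3) by (rule quiver_rep_fmul[OF F 1(4,5) c rep])
    moreover have "raise_f j F \<in> hom_maps lam mu" unfolding 1(3) by (rule raise_f_hom_maps[OF F])
    ultimately show ?thesis using len 1(3) by (intro exI[of _ "raise_f j F"]) (simp del: psi.simps)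
  next
    case (2 j nu)
    obtain F :: "('a, 'n) coeff_family" where F: "F \<in> hom_maps lam nu"
      and rep: "\<And>M X Y. quiver_rep M (TQ.single_path (lam, p)) X Y = block_rep M lam nu F X Y"
      and len: "int (fst nu) - int (fst lam) + (int (snd nu) - int (snd lam)) = int (length p)"
      and I: "(\<lambda>\<pi>. psi (length p) lam nu F \<pi> - TQ.single_path (lam, p) \<pi>) \<in> tilting_ideal"
      using snoc.IH[OF 2(2)] by blast
    have last: "pre_digraph.awlast tilting_quiver lam p = nu" by (rule tilting_walk_awlast[OF 2(2)])
    have sp: "TQ.single_path (lam, p @ [e]) = gmul nu j (TQ.single_path (lam, p) :: ('a, 'n) path_element)"
      unfolding gmul_def 2(1) by (rule TQ.arrow_mult_single[symmetric]) (simp add: last tilting_quiver_sel)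
    have lam: "lam \<in> young (CARD('n) - 2)" using tilting_walk_young[OF 2(2)] by blast
    have c: "TQ.single_path (lam, p) \<in> (carrier TP :: ('a, 'n) path_element set)"
      by (rule TQ.single_path_closed) (use 2(2) last in \<open>simp add: tilting_path_walk\<close>)
    have "(\<lambda>\<pi>. psi (Suc (length p)) lam mu (raise_g j (level nu) F) \<pi> - gmul nu j (psi (length p) lam nu F) \<pi>) \<in> tilting_ideal"
      using psi_raise[OF F lam 2(4) len] 2(3,5) by auto
    from tilting_ideal_add[OF this tilting_ideal_gmul[OF 2(4,5) I, of j]]
    have "(\<lambda>\<pi>. psi (length (p @ [e])) lam mu (raise_g j (level nu) F) \<pi> - TQ.single_path (lam, p @ [e]) \<pi>) \<in> tilting_ideal"
      unfolding sp gmul_linear by simp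
    moreover have "quiver_rep M (TQ.single_path (lam, p @ [e])) X Y = block_rep M lam mu (raise_g j (level nu) F) X Y"
      for M :: "'n \<times> bool \<Rightarrow> 'a" and X Y
      unfolding sp 2(3) by (rule quiver_rep_gmul[OF F 2(4,5) c rep])
    moreover have "raise_g j (level nu) F \<in> hom_maps lam mu" unfolding 2(3) by (rule raise_g_hom_maps[OF F])
    ultimately show ?thesis using len 2(3) by (intro exI[of _ "raise_g j (level nu) F"]) (simp del: psi.simps)
  qed
qed

text \<open>Modulo the ideal each path is \<open>psi\<close> of its map. For fixed end points
  \<open>psi\<close> is linear, and there the maps, weighted by the coefficients of
  \<open>x\<close>, sum to zero; hence so do their values under \<open>psi\<close>.\<close>

lemma quiver_rep_eq_0_imp_ideal:
  fixes x :: "('a::field_char_0, 'n::finite) path_element"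
  assumes x: "x \<in> carrier TP" and rep: "\<And>M X Y. quiver_rep M x X Y = 0"
  shows "x \<in> tilting_ideal"
proof -
  let ?S = "{\<pi>. x \<pi> \<noteq> 0}"
  \<comment> \<open>Paths are grouped by their end points. These determine the length, so one
    \<open>psi\<close> with step count \<open>N\<close> serves a whole group.\<close>
  define key where "key \<pi> = (fst \<pi>, pre_digraph.awlast tilting_quiver (fst \<pi>) (snd \<pi>))"
    for \<pi> :: "(nat \<times> nat) \<times> ((nat \<times> nat) \<times> nat \<times> 'n) list"
  define sp where "sp \<pi> = (TQ.single_path \<pi> :: ('a, 'n) path_element)" for \<pi>
  define F where "F \<pi> = rep_block (sp \<pi>) (fst (key \<pi>)) (snd (key \<pi>))" for \<pi>
  define N where "N k = nat (int (fst (snd k)) - int (fst (fst k)) + (int (snd (snd k)) - int (snd (fst k))))"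
    for k :: "(nat \<times> nat) \<times> (nat \<times> nat)"
  have S: "finite ?S" by (rule TQ.path_carrierD(2)[OF x])
  have path: "F \<pi> \<in> hom_maps (fst (key \<pi>)) (snd (key \<pi>)) \<and>
      (\<forall>M X Y. quiver_rep M (sp \<pi>) X Y = block_rep M (fst (key \<pi>)) (snd (key \<pi>)) (F \<pi>) X Y) \<and>
      (\<lambda>\<rho>. psi (N (key \<pi>)) (fst (key \<pi>)) (snd (key \<pi>)) (F \<pi>) \<rho> - sp \<pi> \<rho>) \<in> tilting_ideal" if "\<pi> \<in> ?S" for \<pi>
  proof -
    obtain lam p where \<pi>: "\<pi> = (lam, p)" by (cases \<pi>)
    define mu where "mu = pre_digraph.awlast tilting_quiver lam p"
    have w: "tilting_walk lam p mu"
      using TQ.path_carrierD(1)[OF x, of \<pi>] that unfolding \<pi> tilting_path_walk mu_def by blast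
    obtain G :: "('a, 'n) coeff_family" where G: "G \<in> hom_maps lam mu"
      and rep: "\<And>M X Y. quiver_rep M (TQ.single_path (lam, p)) X Y = block_rep M lam mu G X Y"
      and len: "int (fst mu) - int (fst lam) + (int (snd mu) - int (snd lam)) = int (length p)"
      and I: "(\<lambda>\<pi>. psi (length p) lam mu G \<pi> - TQ.single_path (lam, p) \<pi>) \<in> tilting_ideal"
      using psi_single_path[OF w] by blast
    have key: "key \<pi> = (lam, mu)" "N (lam, mu) = length p" by (simp_all add: key_def \<pi> mu_def[symmetric] N_def len)
    have "F \<pi> = G"
      unfolding F_def key sp_def fst_conv snd_conv unfolding \<pi>
      by (rule rep_block_eqI[OF G tilting_walk_young[OF w] rep])
    then show ?thesis
      unfolding key(1) fst_conv snd_conv key(2) by (simp only: sp_def \<pi> G rep I simp_thms)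
  qed
  have pf: "F \<pi> a b \<in> poly_funs" if "\<pi> \<in> ?S" for \<pi> a b
    using path[OF that] hom_maps_poly_funs by blast
  have "(\<Sum>\<pi>\<in>?S. x \<pi> * psi (N (key \<pi>)) (fst (key \<pi>)) (snd (key \<pi>)) (F \<pi>) \<rho>) = 0" for \<rho>
  proof -
    have "(\<Sum>\<pi>\<in>{\<pi>\<in>?S. key \<pi> = k}. x \<pi> * psi (N (key \<pi>)) (fst (key \<pi>)) (snd (key \<pi>)) (F \<pi>) \<rho>) = 0" for k
    proof -
      let ?K = "{\<pi>\<in>?S. key \<pi> = k}"
      have "(\<Sum>\<pi>\<in>?K. x \<pi> * F \<pi> a b M) = 0" for a b M
      proof (cases "0 \<le> a \<and> 0 \<le> b")
        case False
        then have "F \<pi> a b M = 0" for \<pi> by (auto simp: F_def rep_block_def)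
        then show ?thesis by simp
      next
        case True
        have "(\<Sum>\<pi>\<in>?K. x \<pi> * F \<pi> a b M) = (\<Sum>\<pi>\<in>?K. x \<pi> * path_matrix M \<pi> (snd k, nat a) (fst k, nat b))"
          by (rule sum.cong) (use True in \<open>auto simp: F_def rep_block_def sp_def quiver_rep_single\<close>)
        also have "\<dots> = (\<Sum>\<pi>\<in>?S. x \<pi> * path_matrix M \<pi> (snd k, nat a) (fst k, nat b))"
        proof (rule sum.mono_neutral_left)
          show "\<forall>\<pi>\<in>?S - ?K. x \<pi> * path_matrix M \<pi> (snd k, nat a) (fst k, nat b) = 0"
            by (auto simp: path_matrix_def key_def prod_eq_iff)
        qed (use S in auto)
        also have "\<dots> = 0" using rep[of M "(snd k, nat a)" "(fst k, nat b)"] by (simp add: quiver_rep_def)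
        finally show ?thesis .
      qed
      then have zero: "(\<lambda>a b M. \<Sum>\<pi>\<in>?K. x \<pi> * F \<pi> a b M) = (\<lambda>_ _ _. 0)" by (intro ext)
      have "(\<Sum>\<pi>\<in>?K. x \<pi> * psi (N (key \<pi>)) (fst (key \<pi>)) (snd (key \<pi>)) (F \<pi>) \<rho>) =
          (\<Sum>\<pi>\<in>?K. psi (N k) (fst k) (snd k) (\<lambda>a b M. x \<pi> * F \<pi> a b M) \<rho>)"
        by (rule sum.cong) (use pf in \<open>auto simp: psi_cmult simp del: psi.simps\<close>)
      also have "\<dots> = psi (N k) (fst k) (snd k) (\<lambda>a b M. \<Sum>\<pi>\<in>?K. x \<pi> * F \<pi> a b M) \<rho>"
        by (subst psi_sum) (use pf in \<open>auto intro!: poly_funs_closed simp del: psi.simps\<close>)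
      also have "\<dots> = 0" unfolding zero psi_zero ..
      finally show ?thesis .
    qed
    then show ?thesis by (subst sum.image_gen[OF S, of _ key]) simp
  qed
  \<comment> \<open>As the \<open>psi\<close> terms sum to zero, they may be added freely; this
    turns \<open>x\<close> into a combination of the differences known to lie in the ideal.\<close>
  then have x_eq: "x = (\<lambda>\<rho>. \<Sum>\<pi>\<in>?S. (- x \<pi>) * (psi (N (key \<pi>)) (fst (key \<pi>)) (snd (key \<pi>)) (F \<pi>) \<rho> - sp \<pi> \<rho>))"
    using TQ.path_carrier_expand[OF x] unfolding sp_def
    by (simp add: right_diff_distrib sum_subtractf sum_negf del: psi.simps)
  show ?thesis
    by (subst x_eq, intro tilting_ideal_sum tilting_ideal_scale) (use path in blast)
qed

text \<open>The elements represented by zero form an ideal containing the relations, hence also the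
  ideal generated by them.\<close>

lemma quiver_rep_ideal:
  fixes x :: "('a::field_char_0, 'n::finite) path_element"
  assumes "x \<in> tilting_ideal"
  shows "quiver_rep M x X Y = 0"
proof -
  let ?J = "{x \<in> carrier TP. \<forall>M X Y. quiver_rep M x X Y = (0 :: 'a)} :: ('a, 'n) path_element set"
  interpret R: ring "TP :: ('a, ('a, 'n) path_element) module" by (rule TQ.path_algebra_ring)
  have "ideal ?J TP"
  proof (rule idealI)
    show "subgroup ?J (add_monoid TP)"
    proof (rule R.add.subgroupI)
      show "?J \<noteq> {}" using TQ.path_zero_closed quiver_rep_zero by blast
      fix a b assume a: "a \<in> ?J" and b: "b \<in> ?J"
      have "\<ominus>\<^bsub>TP\<^esub> a = (\<lambda>\<pi>. - 1 * a \<pi>)"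
        using a by (intro R.minus_equality TQ.path_scale_closed) (simp_all add: TQ.path_add TQ.path_zero)
      then show "\<ominus>\<^bsub>TP\<^esub> a \<in> ?J"
        using a by (simp only: mem_Collect_eq quiver_rep_scale TQ.path_scale_closed) simp
      show "a \<oplus>\<^bsub>TP\<^esub> b \<in> ?J"
        using a b by (simp add: TQ.path_add TQ.path_add_closed quiver_rep_add)
    qed auto
  qed (simp_all add: TQ.path_mult_closed quiver_rep_mult R.ring_axioms del: split_paired_All)
  moreover have "tilting_relations \<subseteq> ?J"
    using tilting_relations_closed quiver_rep_relation by blast
  ultimately have "tilting_ideal \<subseteq> ?J"
    unfolding tilting_ideal_def by (rule R.genideal_minimal)
  then show ?thesis using assms by blast
qed

section \<open>Frames and charts\<close>

definition mat2 :: "'a \<Rightarrow> 'a \<Rightarrow> 'a \<Rightarrow> 'a \<Rightarrow> nat \<Rightarrow> nat \<Rightarrow> 'a" where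
  "mat2 p q r s a b = (if a = 1 then if b = 1 then p else q else if b = 1 then r else s)"

lemma mat2_simps [simp]:
  "mat2 p q r s (Suc 0) (Suc 0) = p" "mat2 p q r s (Suc 0) 2 = q"
  "mat2 p q r s 2 (Suc 0) = r" "mat2 p q r s 2 2 = s"
  by (simp_all add: mat2_def)

definition mat2_mult :: "(nat \<Rightarrow> nat \<Rightarrow> 'a::field_char_0) \<Rightarrow> (nat \<Rightarrow> nat \<Rightarrow> 'a) \<Rightarrow> nat \<Rightarrow> nat \<Rightarrow> 'a" where
  "mat2_mult g h a b = g a 1 * h 1 b + g a 2 * h 2 b"

lemma gl2_det_mult: "gl2_det (mat2_mult g h) = gl2_det g * gl2_det h"
  by (simp add: gl2_det_def mat2_mult_def algebra_simps)

lemma gl2_act_mult: "gl2_act (mat2_mult g h) M = gl2_act g (gl2_act h M)"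
  by (auto simp: gl2_act_def mat2_mult_def algebra_simps fun_eq_iff)

lemma sym_act_linear_power_mult:
  assumes "degree h \<le> d"
  shows "sym_act g (k + d) ([:u, v:] ^ k * h) =
    [:g 1 1 * u + g 1 2 * v, g 2 1 * u + g 2 2 * v:] ^ k * sym_act g d h"
proof (induction k)
  case (Suc k)
  have "degree ([:u, v:] ^ k * h) \<le> k + d"
  proof -
    have "degree ([:u, v:] ^ k) \<le> k"
      using degree_power_le[of "[:u, v:]" k] by (auto intro: order_trans split: if_splits)
    then show ?thesis using assms degree_mult_le[of "[:u, v:] ^ k" h] by linarith
  qed
  from sym_act_linear_mult[OF this, of g u v] show ?case
    by (simp add: Suc.IH mult.assoc del: mult_pCons_left)
qed simp

lemma schur_act_mult:
  assumes "b \<le> fst lam - snd lam"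
  shows "schur_act (mat2_mult g h) lam (monom 1 b) = schur_act g lam (schur_act h lam (monom 1 b))"
proof -
  let ?d = "fst lam - snd lam"
  have "sym_act g ?d (sym_act h ?d (monom 1 b)) =
      sym_act g ((?d - b) + b) ([:h 1 1, h 2 1:] ^ (?d - b) * [:h 1 2, h 2 2:] ^ b)"
    by (simp only: sym_act_monom[OF assms] le_add_diff_inverse2[OF assms])
  also have "\<dots> = [:g 1 1 * h 1 1 + g 1 2 * h 2 1, g 2 1 * h 1 1 + g 2 2 * h 2 1:] ^ (?d - b) *
      sym_act g b ([:h 1 2, h 2 2:] ^ b)"
  proof (rule sym_act_linear_power_mult)
    show "degree ([:h 1 2, h 2 2:] ^ b) \<le> b"
      using degree_power_le[of "[:h 1 2, h 2 2:]" b] by (auto intro: order_trans split: if_splits)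
  qed
  also have "sym_act g b ([:h 1 2, h 2 2:] ^ b) =
      [:g 1 1 * h 1 2 + g 1 2 * h 2 2, g 2 1 * h 1 2 + g 2 2 * h 2 2:] ^ b"
    using sym_act_linear_power_mult[of 1 0 g b "h 1 2" "h 2 2"] by (simp add: sym_act_def)
  also have "[:g 1 1 * h 1 1 + g 1 2 * h 2 1, g 2 1 * h 1 1 + g 2 2 * h 2 1:] ^ (?d - b) * \<dots> =
      sym_act (mat2_mult g h) ?d (monom 1 b)"
    using assms by (simp add: sym_act_monom mat2_mult_def)
  finally show ?thesis
    by (simp add: schur_act_def gl2_det_mult sym_act_linear power_mult_distrib)
qed

lemma frame_change_mult:
  assumes "X \<in> young_ix m" "Y \<in> young_ix m"
  shows "(\<Sum>Z\<in>young_ix m. frame_change g X Z * frame_change h Z Y) = frame_change (mat2_mult g h) X Y"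
proof -
  obtain mu a lam b where XY: "X = (mu, a)" "Y = (lam, b)" by (metis surj_pair)
  have mu: "mu \<in> young m" "a \<le> fst mu - snd mu" and lam: "lam \<in> young m" "b \<le> fst lam - snd lam"
    using assms by (simp_all add: XY young_ix_iff)
  have "(\<Sum>Z\<in>young_ix m. frame_change g X Z * frame_change h Z Y) =
      (\<Sum>c\<le>fst mu - snd mu. frame_change g X (mu, c) * frame_change h (mu, c) Y)"
    by (rule sum_young_ix_block[OF mu(1)]) (simp add: frame_change_def XY)
  also have "\<dots> = frame_change (mat2_mult g h) X Y"
  proof (cases "mu = lam")
    case True
    have "(\<Sum>c\<le>fst mu - snd mu. frame_change g X (mu, c) * frame_change h (mu, c) Y) =
        (\<Sum>c\<le>fst lam - snd lam. coeff (schur_act g lam (monom 1 c)) a * coeff (schur_act h lam (monom 1 b)) c)"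
      using lam True by (intro sum.cong) (simp_all add: frame_change_def XY schur_matrix_eq)
    also have "\<dots> = coeff (schur_act g lam (schur_act h lam (monom 1 b))) a"
      by (rule schur_act_expand[symmetric])
        (auto simp: schur_act_def intro: order_trans[OF degree_smult_le] degree_sym_act)
    finally show ?thesis
      using lam True by (simp add: frame_change_def XY schur_matrix_eq schur_act_mult)
  qed (simp add: frame_change_def XY)
  finally show ?thesis .
qed

lemma frame_change_id:
  assumes "X \<in> young_ix m" "Y \<in> young_ix m"
  shows "frame_change (mat2 1 0 0 1) X Y = (if X = Y then 1 else (0 :: 'a::field_char_0))"
proof -
  obtain mu a lam b where XY: "X = (mu, a)" "Y = (lam, b)" by (metis surj_pair)
  have b: "b \<le> fst lam - snd lam" using assms by (simp add: XY young_ix_iff)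
  have "[:0, 1 :: 'a:] ^ b = monom 1 b" by (simp add: monom_altdef)
  then show ?thesis
    using b by (auto simp: XY frame_change_def schur_matrix_def one_pCons[symmetric])
qed

text \<open>A 2 x 2 matrix is a function on natural numbers of which only the four values at 1 and 2
  matter; two such functions may differ elsewhere.\<close>

lemma frame_change_cong:
  assumes "g 1 1 = h 1 1" "g 1 2 = h 1 2" "g 2 1 = h 2 1" "g 2 2 = h 2 2"
  shows "frame_change g = frame_change h"
  using assms by (intro ext) (simp add: frame_change_def schur_matrix_def)

section \<open>Matrices of points in charts\<close>

text \<open>Among the 2 x n matrices with kernel \<open>K\<close> this is the one normalised to have
  the unit matrix in the two columns of \<open>c\<close>.\<close>

definition chart_mat :: "'n \<times> 'n \<Rightarrow> ('a::field ^ 'n) set \<Rightarrow> 'n \<times> bool \<Rightarrow> 'a" where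
  "chart_mat c K = (\<lambda>(\<rho>, s). frame_coord c K (axis \<rho> 1) (if s then 2 else 1))"

definition minor :: "'n \<times> 'n \<Rightarrow> ('n \<times> bool \<Rightarrow> 'a::field) \<Rightarrow> 'a" where
  "minor c M = M (fst c, False) * M (snd c, True) - M (snd c, False) * M (fst c, True)"

definition ker_mat :: "('n \<times> bool \<Rightarrow> 'a::field) \<Rightarrow> ('a ^ 'n::finite) set" where
  "ker_mat M = {v. \<forall>s. (\<Sum>\<rho>\<in>UNIV. v $ \<rho> * M (\<rho>, s)) = 0}"

definition frame_mat :: "'n \<times> 'n \<Rightarrow> ('n \<times> bool \<Rightarrow> 'a) \<Rightarrow> nat \<Rightarrow> nat \<Rightarrow> 'a" where
  "frame_mat c M = mat2 (M (fst c, False)) (M (snd c, False)) (M (fst c, True)) (M (snd c, True))"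

definition frame_inv :: "'n \<times> 'n \<Rightarrow> ('n \<times> bool \<Rightarrow> 'a::field) \<Rightarrow> nat \<Rightarrow> nat \<Rightarrow> 'a" where
  "frame_inv c M = mat2 (M (snd c, True) / minor c M) (- M (snd c, False) / minor c M)
     (- M (fst c, True) / minor c M) (M (fst c, False) / minor c M)"

lemma has_frame_coords_The:
  assumes "K \<in> chart c"
  shows "has_frame_coords c K v p \<longleftrightarrow> p = (THE p. has_frame_coords c K v p)"
proof -
  have "\<exists>!p. has_frame_coords c K v p" using assms by (simp add: chart_def)
  then show ?thesis by (metis theI')
qed

lemma has_frame_coords_iff:
  assumes "K \<in> chart c"
  shows "has_frame_coords c K v p \<longleftrightarrow> p = (frame_coord c K v 1, frame_coord c K v 2)"
  by (subst has_frame_coords_The[OF assms]) (simp add: frame_coord_def Let_def)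

lemma chart_subspace: "K \<in> chart c \<Longrightarrow> vec.subspace K"
  by (simp add: chart_def grassmannian_def)

text \<open>Summing the congruences for the basis vectors modulo the subspace \<open>K\<close> gives
  coordinates of \<open>v\<close>; they are the right ones by uniqueness.\<close>

lemma frame_coord_expand:
  fixes K :: "('a::field ^ 'n::finite) set"
  assumes K: "K \<in> chart c" and s: "s = (a \<noteq> 1)"
  shows "frame_coord c K v a = (\<Sum>\<rho>\<in>UNIV. v $ \<rho> * chart_mat c K (\<rho>, s))"
proof -
  let ?m = "chart_mat c K"
  let ?p = "\<lambda>s. \<Sum>\<rho>\<in>UNIV. v $ \<rho> * ?m (\<rho>, s)"
  have "axis \<rho> 1 - (?m (\<rho>, False) *s axis (fst c) 1 + ?m (\<rho>, True) *s axis (snd c) 1) \<in> K" for \<rho>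
    using has_frame_coords_iff[OF K, of "axis \<rho> 1" "(?m (\<rho>, False), ?m (\<rho>, True))"]
    by (simp add: has_frame_coords_def chart_mat_def)
  then have "(\<Sum>\<rho>\<in>UNIV. v $ \<rho> *s (axis \<rho> 1 - (?m (\<rho>, False) *s axis (fst c) 1 + ?m (\<rho>, True) *s axis (snd c) 1))) \<in> K"
    by (intro vec.subspace_sum[OF chart_subspace[OF K]] vec.subspace_scale[OF chart_subspace[OF K]])
  also have "(\<Sum>\<rho>\<in>UNIV. v $ \<rho> *s (axis \<rho> 1 - (?m (\<rho>, False) *s axis (fst c) 1 + ?m (\<rho>, True) *s axis (snd c) 1))) =
      v - (?p False *s axis (fst c) 1 + ?p True *s axis (snd c) 1)"
    by (simp add: basis_expansion vec.scale_right_diff_distrib vec.scale_right_distrib sum_subtractf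
        sum.distrib vec.scale_sum_left)
  finally have "has_frame_coords c K v (?p False, ?p True)" by (simp add: has_frame_coords_def)
  then have "frame_coord c K v 1 = ?p False" "frame_coord c K v 2 = ?p True"
    using has_frame_coords_iff[OF K] by auto
  moreover have "frame_coord c K v a = frame_coord c K v (if a = 1 then 1 else 2)"
    by (simp add: frame_coord_def)
  ultimately show ?thesis by (simp add: s)
qed

lemma chart_mat_frame:
  assumes K: "K \<in> chart c"
  shows "chart_mat c K (fst c, False) = 1" "chart_mat c K (fst c, True) = 0"
    "chart_mat c K (snd c, False) = 0" "chart_mat c K (snd c, True) = 1"
proof -
  have "has_frame_coords c K (axis (fst c) 1) (1, 0)" "has_frame_coords c K (axis (snd c) 1) (0, 1)"
    using vec.subspace_0[OF chart_subspace[OF K]] by (simp_all add: has_frame_coords_def)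
  then have "(frame_coord c K (axis (fst c) 1) 1, frame_coord c K (axis (fst c) 1) 2) = (1, 0)"
    "(frame_coord c K (axis (snd c) 1) 1, frame_coord c K (axis (snd c) 1) 2) = (0, 1)"
    by (simp_all only: has_frame_coords_iff[OF K])
  then show "chart_mat c K (fst c, False) = 1" "chart_mat c K (fst c, True) = 0"
    "chart_mat c K (snd c, False) = 0" "chart_mat c K (snd c, True) = 1"
    by (simp_all add: chart_mat_def)
qed

lemma minor_chart_mat: "K \<in> chart c \<Longrightarrow> minor c (chart_mat c K) = 1"
  by (simp add: minor_def chart_mat_frame)

lemma ker_mat_chart_mat:
  assumes K: "K \<in> chart c"
  shows "ker_mat (chart_mat c K) = K"
proof -
  have "v \<in> ker_mat (chart_mat c K) \<longleftrightarrow> v \<in> K" for v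
  proof -
    have "v \<in> K \<longleftrightarrow> has_frame_coords c K v (0, 0)" by (simp add: has_frame_coords_def)
    also have "\<dots> \<longleftrightarrow> frame_coord c K v 1 = 0 \<and> frame_coord c K v 2 = 0"
      by (auto simp: has_frame_coords_iff[OF K])
    also have "\<dots> \<longleftrightarrow> v \<in> ker_mat (chart_mat c K)"
      by (auto simp: ker_mat_def frame_coord_expand[OF K refl] all_bool_eq)
    finally show ?thesis by simp
  qed
  then show ?thesis by blast
qed

lemma frame_mat_chart_mat: "K \<in> chart c \<Longrightarrow> frame_mat c (chart_mat c K) = mat2 1 0 0 1"
  by (simp add: frame_mat_def chart_mat_frame)

lemma frame_inv_chart_mat: "K \<in> chart c \<Longrightarrow> frame_inv c (chart_mat c K) = mat2 1 0 0 1"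
  by (simp add: frame_inv_def chart_mat_frame minor_chart_mat)

definition taut_transition :: "'n \<times> 'n \<Rightarrow> 'n \<times> 'n \<Rightarrow> ('a::field ^ 'n::finite) set \<Rightarrow> nat \<Rightarrow> nat \<Rightarrow> 'a" where
  "taut_transition c d K = frame_mat d (chart_mat c K)"

text \<open>Each u_\<rho> is congruent modulo \<open>K\<close> to a combination of the frame vectors
  of \<open>d\<close>; taking coordinates with respect to \<open>c\<close> on both sides is the
  matrix product.\<close>

lemma chart_mat_transition:
  fixes K :: "('a::field_char_0 ^ 'n::finite) set"
  assumes c: "K \<in> chart c" and d: "K \<in> chart d"
  shows "chart_mat c K = gl2_act (taut_transition c d K) (chart_mat d K)"
proof
  fix x :: "'n \<times> bool"
  obtain \<rho> s where x: "x = (\<rho>, s)" by force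
  define a :: nat where "a = (if s then 2 else 1)"
  let ?p = "chart_mat d K (\<rho>, False)" and ?q = "chart_mat d K (\<rho>, True)"
  let ?w = "?p *s axis (fst d) 1 + ?q *s axis (snd d) 1"
  have "axis \<rho> 1 - ?w \<in> K"
    using has_frame_coords_iff[OF d, of "axis \<rho> 1" "(?p, ?q)"]
    by (simp add: has_frame_coords_def chart_mat_def)
  then have "axis \<rho> 1 - ?w \<in> ker_mat (chart_mat c K)"
    by (simp only: ker_mat_chart_mat[OF c])
  then have "(\<Sum>\<sigma>\<in>UNIV. (axis \<rho> 1 - ?w) $ \<sigma> * chart_mat c K (\<sigma>, s)) = 0"
    unfolding ker_mat_def by blast
  moreover have "(\<Sum>\<sigma>\<in>UNIV. axis \<tau> 1 $ \<sigma> * h \<sigma>) = h \<tau>" for \<tau> :: 'n and h :: "'n \<Rightarrow> 'a"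
    by (simp add: axis_def if_distrib[of "\<lambda>x. x * _"] cong: if_cong)
  ultimately have "chart_mat c K (\<rho>, s) = ?p * chart_mat c K (fst d, s) + ?q * chart_mat c K (snd d, s)"
    by (simp add: left_diff_distrib distrib_right sum_subtractf sum.distrib mult.assoc flip: sum_distrib_left)
  then show "chart_mat c K x = gl2_act (taut_transition c d K) (chart_mat d K) x"
    by (simp add: x gl2_act_def taut_transition_def frame_mat_def mult.commute)
qed

lemma cramer2:
  fixes m11 m12 m21 m22 :: "'a::field"
  assumes "m11 * m22 - m12 * m21 \<noteq> 0"
  shows "m11 * p + m12 * q = y \<and> m21 * p + m22 * q = z \<longleftrightarrow>
    p = (y * m22 - m12 * z) / (m11 * m22 - m12 * m21) \<and> q = (m11 * z - y * m21) / (m11 * m22 - m12 * m21)"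
proof -
  let ?D = "m11 * m22 - m12 * m21"
  have "m11 * p + m12 * q = y \<and> m21 * p + m22 * q = z \<longleftrightarrow> ?D * p = y * m22 - m12 * z \<and> ?D * q = m11 * z - y * m21"
  proof
    assume "m11 * p + m12 * q = y \<and> m21 * p + m22 * q = z"
    then show "?D * p = y * m22 - m12 * z \<and> ?D * q = m11 * z - y * m21"
      by (auto simp: algebra_simps)
  next
    assume *: "?D * p = y * m22 - m12 * z \<and> ?D * q = m11 * z - y * m21"
    have "?D * (m11 * p + m12 * q) = m11 * (?D * p) + m12 * (?D * q)"
      "?D * (m21 * p + m22 * q) = m21 * (?D * p) + m22 * (?D * q)" by (simp_all add: algebra_simps)
    then have "?D * (m11 * p + m12 * q) = m11 * (y * m22 - m12 * z) + m12 * (m11 * z - y * m21)"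
      "?D * (m21 * p + m22 * q) = m21 * (y * m22 - m12 * z) + m22 * (m11 * z - y * m21)"
      unfolding conjunct1[OF *] conjunct2[OF *] by blast+
    then have "?D * (m11 * p + m12 * q) = ?D * y" "?D * (m21 * p + m22 * q) = ?D * z"
      by (simp_all add: algebra_simps)
    then show "m11 * p + m12 * q = y \<and> m21 * p + m22 * q = z" using assms by simp
  qed
  then show ?thesis using assms by (simp add: eq_divide_eq mult.commute)
qed

lemma ker_mat_coords:
  fixes M :: "'n::finite \<times> bool \<Rightarrow> 'a::field"
  assumes "minor c M \<noteq> 0"
  shows "has_frame_coords c (ker_mat M) v p \<longleftrightarrow>
    p = (((\<Sum>\<rho>\<in>UNIV. v $ \<rho> * M (\<rho>, False)) * M (snd c, True) - M (snd c, False) * (\<Sum>\<rho>\<in>UNIV. v $ \<rho> * M (\<rho>, True))) / minor c M,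
      (M (fst c, False) * (\<Sum>\<rho>\<in>UNIV. v $ \<rho> * M (\<rho>, True)) - (\<Sum>\<rho>\<in>UNIV. v $ \<rho> * M (\<rho>, False)) * M (fst c, True)) / minor c M)"
proof -
  have ax: "(\<Sum>\<sigma>\<in>UNIV. axis \<tau> 1 $ \<sigma> * h \<sigma>) = h \<tau>" for \<tau> :: 'n and h :: "'n \<Rightarrow> 'a"
    by (simp add: axis_def if_distrib[of "\<lambda>x. x * _"] cong: if_cong)
  have "(\<Sum>\<rho>\<in>UNIV. (v - (fst p *s axis (fst c) 1 + snd p *s axis (snd c) 1)) $ \<rho> * M (\<rho>, s)) =
      (\<Sum>\<rho>\<in>UNIV. v $ \<rho> * M (\<rho>, s)) - (fst p * M (fst c, s) + snd p * M (snd c, s))" for s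
    by (simp add: left_diff_distrib distrib_right sum_subtractf sum.distrib mult.assoc ax flip: sum_distrib_left)
  then have "has_frame_coords c (ker_mat M) v p \<longleftrightarrow>
      M (fst c, False) * fst p + M (snd c, False) * snd p = (\<Sum>\<rho>\<in>UNIV. v $ \<rho> * M (\<rho>, False)) \<and>
      M (fst c, True) * fst p + M (snd c, True) * snd p = (\<Sum>\<rho>\<in>UNIV. v $ \<rho> * M (\<rho>, True))"
    by (auto simp: has_frame_coords_def ker_mat_def all_bool_eq mult.commute)
  then show ?thesis
    using cramer2[of "M (fst c, False)" "M (snd c, True)" "M (snd c, False)" "M (fst c, True)" "fst p" "snd p"] assms
    by (auto simp: minor_def prod_eq_iff)
qed

text \<open>Existence and uniqueness of frame coordinates say that the kernel and the span of u_i
  and u_j are complementary, so the dimension formula gives codimension 2.\<close>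

lemma ker_mat_chart:
  fixes M :: "'n::finite \<times> bool \<Rightarrow> 'a::field"
  assumes M: "minor c M \<noteq> 0"
  shows "ker_mat M \<in> chart c"
proof -
  let ?K = "ker_mat M" and ?W = "{x :: 'a ^ 'n. \<forall>i. i \<notin> {fst c, snd c} \<longrightarrow> x $ i = 0}"
  have K: "vec.subspace ?K"
    by (auto simp: vec.subspace_def ker_mat_def distrib_right sum.distrib mult.assoc simp flip: sum_distrib_left)
  have W: "vec.subspace ?W" by (auto simp: vec.subspace_def)
  have ex: "\<exists>!p. has_frame_coords c ?K v p" for v unfolding ker_mat_coords[OF M] by simp
  have "fst c \<noteq> snd c" using M by (auto simp: minor_def)
  have "{x + y | x y. x \<in> ?K \<and> y \<in> ?W} = UNIV"
  proof -
    have "\<exists>x y. v = x + y \<and> x \<in> ?K \<and> y \<in> ?W" for v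
    proof -
      obtain p where "has_frame_coords c ?K v p" using ex by blast
      then show ?thesis
        by (intro exI[of _ "v - (fst p *s axis (fst c) 1 + snd p *s axis (snd c) 1)"]
            exI[of _ "fst p *s axis (fst c) 1 + snd p *s axis (snd c) 1"])
          (auto simp: has_frame_coords_def axis_def)
    qed
    then show ?thesis by blast
  qed
  moreover have "?K \<inter> ?W = {0}"
  proof -
    have "x = 0" if "x \<in> ?K" "x \<in> ?W" for x
    proof -
      have x: "x = x $ fst c *s axis (fst c) 1 + x $ snd c *s axis (snd c) 1"
        using that(2) \<open>fst c \<noteq> snd c\<close> by (auto simp: vec_eq_iff axis_def)
      have "has_frame_coords c ?K x (x $ fst c, x $ snd c)" "has_frame_coords c ?K x (0, 0)"
        using that(1) x vec.subspace_0[OF K] by (simp_all add: has_frame_coords_def)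
      then have "x $ fst c = 0 \<and> x $ snd c = 0" using ex[of x] by blast
      then show ?thesis using x by simp
    qed
    then show ?thesis using vec.subspace_0[OF K] by auto
  qed
  moreover have "vec.dim {x + y | x y. x \<in> ?K \<and> y \<in> ?W} + vec.dim (?K \<inter> ?W) = vec.dim ?K + vec.dim ?W"
    by (rule vec.dim_sums_Int[OF K W])
  ultimately have "vec.dim (UNIV :: ('a ^ 'n) set) + vec.dim ({0} :: ('a ^ 'n) set) = vec.dim ?K + vec.dim ?W"
    by (simp only:)
  then have "CARD('n) + 0 = vec.dim ?K + vec.dim ?W"
    unfolding vec_dim_card by simp
  moreover have "vec.dim ?W = 2"
    using dim_substandard_cart[of "{fst c, snd c}", where 'a = 'a] \<open>fst c \<noteq> snd c\<close> by simp
  ultimately have "?K \<in> grassmannian" using K by (simp add: grassmannian_def)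
  then show ?thesis using ex by (simp add: chart_def)
qed

text \<open>Cramer's rule: normalising \<open>M\<close> means multiplying it by the inverse of its
  square block in the columns of \<open>c\<close>.\<close>

lemma chart_mat_ker_mat:
  fixes M :: "'n::finite \<times> bool \<Rightarrow> 'a::field_char_0"
  assumes M: "minor c M \<noteq> 0"
  shows "chart_mat c (ker_mat M) = gl2_act (frame_inv c M) M"
proof
  fix x :: "'n \<times> bool"
  obtain \<rho> s where x: "x = (\<rho>, s)" by force
  have ax: "(\<Sum>\<sigma>\<in>UNIV. axis \<rho> 1 $ \<sigma> * M (\<sigma>, t)) = M (\<rho>, t)" for t
    by (simp add: axis_def if_distrib[of "\<lambda>x. x * _"] cong: if_cong)
  have "(THE p. has_frame_coords c (ker_mat M) (axis \<rho> 1) p) =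
      ((M (\<rho>, False) * M (snd c, True) - M (snd c, False) * M (\<rho>, True)) / minor c M,
       (M (fst c, False) * M (\<rho>, True) - M (\<rho>, False) * M (fst c, True)) / minor c M)"
    unfolding ker_mat_coords[OF M] ax by simp
  then show "chart_mat c (ker_mat M) x = gl2_act (frame_inv c M) M x"
    by (simp add: x chart_mat_def frame_coord_def gl2_act_def frame_inv_def diff_divide_distrib mult.commute)
qed

lemma mat2_mult_mat2:
  "mat2_mult (mat2 p q r s) (mat2 p' q' r' s') =
    mat2 (p * p' + q * r') (p * q' + q * s') (r * p' + s * r') (r * q' + s * s')"
  by (auto simp: mat2_mult_def mat2_def fun_eq_iff)

lemma frame_mat_inv:
  fixes M :: "'n::finite \<times> bool \<Rightarrow> 'a::field_char_0"
  assumes "minor c M \<noteq> 0"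
  shows "mat2_mult (frame_mat c M) (frame_inv c M) = mat2 1 0 0 1"
    "mat2_mult (frame_inv c M) (frame_mat c M) = mat2 1 0 0 1"
proof -
  have "(M (fst c, False) * M (snd c, True) - M (snd c, False) * M (fst c, True)) / minor c M = 1"
    using assms by (simp add: minor_def)
  then have e: "M (fst c, False) * M (snd c, True) / minor c M - M (snd c, False) * M (fst c, True) / minor c M = 1"
    by (simp add: diff_divide_distrib)
  then show "mat2_mult (frame_mat c M) (frame_inv c M) = mat2 1 0 0 1"
    "mat2_mult (frame_inv c M) (frame_mat c M) = mat2 1 0 0 1"
    unfolding frame_mat_def frame_inv_def mat2_mult_mat2 by (simp_all add: mult.commute)
qed

lemma gl2_act_id: "gl2_act (mat2 1 0 0 1) M = M"
  by (auto simp: gl2_act_def fun_eq_iff)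

lemma gl2_act_frame_mat:
  fixes M :: "'n::finite \<times> bool \<Rightarrow> 'a::field_char_0"
  assumes "minor c M \<noteq> 0"
  shows "M = gl2_act (frame_mat c M) (chart_mat c (ker_mat M))"
  unfolding chart_mat_ker_mat[OF assms] gl2_act_mult[symmetric] frame_mat_inv[OF assms] gl2_act_id ..

lemma frame_mat_gl2_act: "frame_mat c (gl2_act g M) = mat2_mult (mat2 (g 1 1) (g 1 2) (g 2 1) (g 2 2)) (frame_mat c M)"
  by (simp add: frame_mat_def mat2_mult_mat2 gl2_act_def)

lemma minor_gl2_act: "minor c (gl2_act g M) = gl2_det g * minor c M"
  by (simp add: minor_def gl2_act_def gl2_det_def algebra_simps)

lemma frame_inv_gl2_act:
  fixes M :: "'n::finite \<times> bool \<Rightarrow> 'a::field_char_0"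
  assumes "gl2_det (mat2 p q r s) \<noteq> 0"
  shows "mat2_mult (frame_inv c (gl2_act (mat2 p q r s) M)) (mat2 p q r s) = frame_inv c M"
proof -
  let ?D = "gl2_det (mat2 p q r s)"
  have e: "x / (?D * minor c M) * y + z / (?D * minor c M) * w = t / minor c M"
    if "x * y + z * w = ?D * t" for x y z w t
  proof -
    have "x / (?D * minor c M) * y + z / (?D * minor c M) * w = (x * y + z * w) / (?D * minor c M)"
      by (simp add: add_divide_distrib)
    then show ?thesis using that assms by simp
  qed
  have cong: "mat2 A B C E = mat2 A' B' C' E'" if "A = A'" "B = B'" "C = C'" "E = E'"
    for A B C E A' B' C' E' :: 'a
    using that by simp
  show ?thesis
    unfolding frame_inv_def minor_gl2_act mat2_mult_mat2
    by (intro cong e) (simp_all add: gl2_act_def gl2_det_def algebra_simps)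
qed

lemma ker_mat_gl2_act:
  fixes M :: "'n::finite \<times> bool \<Rightarrow> 'a::field_char_0"
  assumes "gl2_det g \<noteq> 0"
  shows "ker_mat (gl2_act g M) = ker_mat M"
proof -
  have "v \<in> ker_mat (gl2_act g M) \<longleftrightarrow> v \<in> ker_mat M" for v
  proof -
    let ?y = "\<Sum>\<rho>\<in>UNIV. v $ \<rho> * M (\<rho>, False)" and ?z = "\<Sum>\<rho>\<in>UNIV. v $ \<rho> * M (\<rho>, True)"
    have "(\<Sum>\<rho>\<in>UNIV. v $ \<rho> * gl2_act g M (\<rho>, False)) = g 1 1 * ?y + g 1 2 * ?z"
      "(\<Sum>\<rho>\<in>UNIV. v $ \<rho> * gl2_act g M (\<rho>, True)) = g 2 1 * ?y + g 2 2 * ?z"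
      by (simp_all add: gl2_act_def sum_distrib_left sum.distrib algebra_simps)
    then have "v \<in> ker_mat (gl2_act g M) \<longleftrightarrow> g 1 1 * ?y + g 1 2 * ?z = 0 \<and> g 2 1 * ?y + g 2 2 * ?z = 0"
      by (simp add: ker_mat_def all_bool_eq conj_commute)
    also have "\<dots> \<longleftrightarrow> ?y = 0 \<and> ?z = 0"
      using cramer2[of "g 1 1" "g 2 2" "g 1 2" "g 2 1" ?y ?z 0 0] assms by (simp add: gl2_det_def)
    finally show ?thesis by (simp add: ker_mat_def all_bool_eq conj_commute)
  qed
  then show ?thesis by blast
qed

section \<open>Extension of equivariant functions to all matrices\<close>

text \<open>The localisation of the polynomial functions at \<open>D\<close>, as functions
  constrained only where \<open>D\<close> does not vanish; values elsewhere are arbitrary.\<close>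

definition rational_over :: "(('v \<Rightarrow> 'a::field_char_0) \<Rightarrow> 'a) \<Rightarrow> (('v \<Rightarrow> 'a) \<Rightarrow> 'a) set" where
  "rational_over D = {h. \<exists>P\<in>poly_funs. \<exists>k. \<forall>M. D M \<noteq> 0 \<longrightarrow> h M * D M ^ k = P M}"

lemma rational_over_poly: "P \<in> poly_funs \<Longrightarrow> P \<in> rational_over D"
  unfolding rational_over_def by (intro CollectI bexI[of _ P] exI[of _ 0]) auto

lemma rational_over_add:
  assumes "D \<in> poly_funs" "h \<in> rational_over D" "h' \<in> rational_over D"
  shows "(\<lambda>M. h M + h' M) \<in> rational_over D"
proof -
  obtain P k Q l where P: "P \<in> poly_funs" "\<forall>M. D M \<noteq> 0 \<longrightarrow> h M * D M ^ k = P M"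
    and Q: "Q \<in> poly_funs" "\<forall>M. D M \<noteq> 0 \<longrightarrow> h' M * D M ^ l = Q M"
    using assms(2,3) unfolding rational_over_def by blast
  have "(h M + h' M) * D M ^ (k + l) = P M * D M ^ l + Q M * D M ^ k" if "D M \<noteq> 0" for M
  proof -
    have "(h M + h' M) * D M ^ (k + l) = (h M * D M ^ k) * D M ^ l + (h' M * D M ^ l) * D M ^ k"
      by (simp add: power_add algebra_simps)
    then show ?thesis using P(2) Q(2) that by simp
  qed
  then show ?thesis
    unfolding rational_over_def
    by (intro CollectI bexI[of _ "\<lambda>M. P M * D M ^ l + Q M * D M ^ k"] exI[of _ "k + l"] allI impI)
      (auto intro!: poly_funs_closed P Q assms(1))
qed

lemma rational_over_mult:
  assumes "D \<in> poly_funs" "h \<in> rational_over D" "h' \<in> rational_over D"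
  shows "(\<lambda>M. h M * h' M) \<in> rational_over D"
proof -
  obtain P k Q l where P: "P \<in> poly_funs" "\<forall>M. D M \<noteq> 0 \<longrightarrow> h M * D M ^ k = P M"
    and Q: "Q \<in> poly_funs" "\<forall>M. D M \<noteq> 0 \<longrightarrow> h' M * D M ^ l = Q M"
    using assms(2,3) unfolding rational_over_def by blast
  have "(h M * h' M) * D M ^ (k + l) = P M * Q M" if "D M \<noteq> 0" for M
  proof -
    have "(h M * h' M) * D M ^ (k + l) = (h M * D M ^ k) * (h' M * D M ^ l)"
      by (simp add: power_add algebra_simps)
    then show ?thesis using P(2) Q(2) that by simp
  qed
  then show ?thesis
    unfolding rational_over_def
    by (intro CollectI bexI[of _ "\<lambda>M. P M * Q M"] exI[of _ "k + l"] allI impI)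
      (auto intro!: poly_funs_closed P Q)
qed

lemma rational_over_divide:
  assumes "P \<in> poly_funs"
  shows "(\<lambda>M. P M / D M) \<in> rational_over D"
  unfolding rational_over_def by (intro CollectI bexI[of _ P] exI[of _ 1]) (auto simp: assms)

lemma rational_over_sum:
  assumes "D \<in> poly_funs" "\<And>i. i \<in> S \<Longrightarrow> h i \<in> rational_over D"
  shows "(\<lambda>M. \<Sum>i\<in>S. h i M) \<in> rational_over D"
  using assms(2)
  by (induction S rule: infinite_finite_induct)
    (simp_all add: rational_over_add[OF assms(1)] rational_over_poly poly_funs.const)

lemma rational_over_cong:
  assumes "h \<in> rational_over D" "\<And>M. D M \<noteq> 0 \<Longrightarrow> h M = h' M"
  shows "h' \<in> rational_over D"
  using assms unfolding rational_over_def by auto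

lemma rational_over_coeff_mult:
  assumes "D \<in> poly_funs" "\<And>k. (\<lambda>M. coeff (p M) k) \<in> rational_over D"
    "\<And>k. (\<lambda>M. coeff (q M) k) \<in> rational_over D"
  shows "(\<lambda>M. coeff (p M * q M) k) \<in> rational_over D"
  unfolding coeff_mult by (intro rational_over_sum rational_over_mult assms)

lemma rational_over_coeff_power:
  assumes "D \<in> poly_funs" "\<And>k. (\<lambda>M. coeff (p M) k) \<in> rational_over D"
  shows "(\<lambda>M. coeff (p M ^ n) k) \<in> rational_over D"
proof (induction n arbitrary: k)
  case 0
  show ?case by (simp add: rational_over_poly poly_funs.const)
next
  case (Suc n)
  then show ?case unfolding power_Suc by (intro rational_over_coeff_mult assms)
qed

lemma rational_over_coeff_linear:
  assumes "f \<in> rational_over D" "g \<in> rational_over D"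
  shows "(\<lambda>M. coeff [:f M, g M:] k) \<in> rational_over D"
proof -
  consider "k = 0" | "k = 1" | "k \<ge> 2" by linarith
  then show ?thesis
  proof cases
    case 3
    then have "(\<lambda>M. coeff [:f M, g M:] k) = (\<lambda>_. 0)" by (intro ext coeff_eq_0) (simp add: degree_pCons_eq_if)
    then show ?thesis by (simp add: rational_over_poly poly_funs.const)
  qed (use assms in simp_all)
qed

lemma rational_over_power:
  assumes "D \<in> poly_funs" "h \<in> rational_over D"
  shows "(\<lambda>M. h M ^ n) \<in> rational_over D"
  by (induction n) (simp_all add: rational_over_mult[OF assms] rational_over_poly poly_funs.const)

lemma rational_over_diff:
  assumes "D \<in> poly_funs" "h \<in> rational_over D" "h' \<in> rational_over D"
  shows "(\<lambda>M. h M - h' M) \<in> rational_over D"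
  using rational_over_add[OF assms(1,2) rational_over_mult[OF assms(1) rational_over_poly[OF poly_funs.const[of "-1"]] assms(3)]]
  by simp

lemma rational_over_if: "h \<in> rational_over D \<Longrightarrow> (\<lambda>M. if C then h M else 0) \<in> rational_over D"
  by (cases C) (simp_all add: rational_over_poly poly_funs.const)

lemma rational_over_frame_change:
  assumes "D \<in> poly_funs" "(\<lambda>M. p M) \<in> rational_over D" "(\<lambda>M. q M) \<in> rational_over D"
    "(\<lambda>M. r M) \<in> rational_over D" "(\<lambda>M. s M) \<in> rational_over D"
  shows "(\<lambda>M. frame_change (mat2 (p M) (q M) (r M) (s M)) X Y) \<in> rational_over D"
proof -
  have "mat2 p q r s 1 1 = p" "mat2 p q r s 1 2 = q" "mat2 p q r s 2 1 = r" "mat2 p q r s 2 2 = s"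
    for p q r s :: 'b by simp_all
  note mat2 = this
  show ?thesis
  unfolding frame_change_def schur_matrix_def mat2
  by (intro rational_over_mult rational_over_power rational_over_diff rational_over_coeff_mult
      rational_over_coeff_power rational_over_coeff_linear assms rational_over_if
      rational_over_poly[OF poly_funs.const])
qed

lemma poly_funs_poly: "F \<in> poly_funs \<Longrightarrow> (\<lambda>M. poly q (F M)) \<in> poly_funs"
  by (induction q) (auto intro: poly_funs_closed)

lemma poly_funs_fun_upd: "F \<in> poly_funs \<Longrightarrow> (\<lambda>M. F (M(v := s))) \<in> poly_funs"
proof (erule poly_funs_substitute)
  show "(\<lambda>M. (M(v := s)) w) \<in> poly_funs" for w
    by (cases "w = v") (auto intro: poly_funs.intros)
qed

lemma minor_poly_funs: "minor c \<in> poly_funs"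
proof -
  have "(\<lambda>M. M (fst c, False) * M (snd c, True) - M (snd c, False) * M (fst c, True)) \<in> poly_funs"
    by (intro poly_funs_closed)
  then show ?thesis by (simp add: minor_def[abs_def])
qed

text \<open>
  The Hartogs extension: the loci where the two minors vanish have no common component. As the
  minors involve different variables, the numerator of \<open>h\<close> can be recovered by Lagrange
  interpolation in the variables of the second minor at nodes where that minor does not vanish.
\<close>

lemma rational_over_two_minors:
  fixes h h' :: "('n::finite \<times> bool \<Rightarrow> 'a::field_char_0) \<Rightarrow> 'a"
  assumes h: "h \<in> rational_over (minor (i, j))" and h': "h' \<in> rational_over (minor (k, l))"
    and distinct: "distinct [i, j, k, l]"
    and eq: "\<And>M. minor (i, j) M \<noteq> 0 \<Longrightarrow> minor (k, l) M \<noteq> 0 \<Longrightarrow> h M = h' M"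
  obtains Q where "Q \<in> poly_funs" "\<And>M. minor (i, j) M \<noteq> 0 \<Longrightarrow> h M = Q M"
proof -
  let ?D = "minor (i, j)" and ?D' = "minor (k, l)"
  obtain P n P' n' where P: "P \<in> poly_funs" "\<And>M. ?D M \<noteq> 0 \<Longrightarrow> h M * ?D M ^ n = P M"
    and P': "P' \<in> poly_funs" "\<And>M. ?D' M \<noteq> 0 \<Longrightarrow> h' M * ?D' M ^ n' = P' M"
    using h h' unfolding rational_over_def by blast
  obtain N where N: "\<And>M v. degree (axis_poly P M v) \<le> N" using poly_fun_degree_bound[OF P(1)] by blast
  \<comment> \<open>Interpolation needs N + 1 nodes per variable. Those for the diagonal entries of
    the second minor exceed those for the other two, so the minor is nonzero at every combination of
    nodes.\<close>
  define S1 where "S1 = (of_nat :: nat \<Rightarrow> 'a) ` {N + 1..2 * N + 1}"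
  define S2 where "S2 = (of_nat :: nat \<Rightarrow> 'a) ` {0..N}"
  have card: "card S1 = N + 1" "card S2 = N + 1" "finite S1" "finite S2"
    by (simp_all add: S1_def S2_def card_image)
  have ne: "s * t - s' * t' \<noteq> 0" if st: "s \<in> S1" "t \<in> S1" "s' \<in> S2" "t' \<in> S2" for s t s' t'
  proof -
    obtain a b a' b' where ab: "s = of_nat a" "t = of_nat b" "s' = of_nat a'" "t' = of_nat b'"
      "N < a" "N < b" "a' \<le> N" "b' \<le> N"
      using st by (auto simp: S1_def S2_def)
    have "a' * b' < a * b" using ab by (intro mult_strict_mono') auto
    then have "(of_nat (a' * b') :: 'a) \<noteq> of_nat (a * b)" by (simp only: of_nat_eq_iff)
    then show ?thesis by (simp add: ab)
  qed
  have ip: "P M = (\<Sum>s\<in>S. poly (lagrange S s) (M v) * P (M(v := s)))" if "finite S" "card S = N + 1" for S M v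
    using poly_fun_interpolation[OF P(1) that(1), of M v] N that(2) by (simp add: le_imp_less_Suc)
  define U where "U M s t s' t' = M((k, False) := s, (l, True) := t, (l, False) := s', (k, True) := t')"
    for M :: "'n \<times> bool \<Rightarrow> 'a" and s t s' t'
  define L where "L M s t s' t' = poly (lagrange S1 s) (M (k, False)) * (poly (lagrange S1 t) (M (l, True)) *
    (poly (lagrange S2 s') (M (l, False)) * poly (lagrange S2 t') (M (k, True))))"
    for M :: "'n \<times> bool \<Rightarrow> 'a" and s t s' t'
  \<comment> \<open>The numerator of \<open>h\<close> interpolated, with its values at the nodes
    expressed through \<open>h'\<close> and the power of the first minor removed. The only
    denominators are constants, so \<open>Q\<close> is polynomial.\<close>
  define Q where "Q M = (\<Sum>s\<in>S1. \<Sum>t\<in>S1. \<Sum>s'\<in>S2. \<Sum>t'\<in>S2.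
    L M s t s' t' * (P' (U M s t s' t') * (1 / (s * t - s' * t') ^ n')))" for M
  have kl: "k \<noteq> l" "i \<noteq> k" "i \<noteq> l" "j \<noteq> k" "j \<noteq> l" using distinct by auto
  have PL: "P M = (\<Sum>s\<in>S1. \<Sum>t\<in>S1. \<Sum>s'\<in>S2. \<Sum>t'\<in>S2. L M s t s' t' * P (U M s t s' t'))" for M
  proof -
    have 1: "P M = (\<Sum>s\<in>S1. poly (lagrange S1 s) (M (k, False)) * P (M((k, False) := s)))"
      by (rule ip[OF card(3,1)])
    have 2: "P (M((k, False) := s)) = (\<Sum>t\<in>S1. poly (lagrange S1 t) (M (l, True)) *
        P (M((k, False) := s, (l, True) := t)))" for s
      using ip[OF card(3,1), of "M((k, False) := s)" "(l, True)"] by simp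
    have 3: "P (M((k, False) := s, (l, True) := t)) = (\<Sum>s'\<in>S2. poly (lagrange S2 s') (M (l, False)) *
        P (M((k, False) := s, (l, True) := t, (l, False) := s')))" for s t
      using ip[OF card(4,2), of "M((k, False) := s, (l, True) := t)" "(l, False)"] kl by simp
    have 4: "P (M((k, False) := s, (l, True) := t, (l, False) := s')) =
        (\<Sum>t'\<in>S2. poly (lagrange S2 t') (M (k, True)) * P (U M s t s' t'))" for s t s'
      using ip[OF card(4,2), of "M((k, False) := s, (l, True) := t, (l, False) := s')" "(k, True)"] kl
      by (simp add: U_def)
    show ?thesis
      unfolding L_def by (subst 1, subst 2, subst 3, subst 4) (simp only: sum_distrib_left mult.assoc)
  qed
  have "h M = Q M" if M: "?D M \<noteq> 0" for M
  proof -
    have "P (U M s t s' t') = ?D M ^ n * (P' (U M s t s' t') * (1 / (s * t - s' * t') ^ n'))"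
      if st: "s \<in> S1" "t \<in> S1" "s' \<in> S2" "t' \<in> S2" for s t s' t'
    proof -
      \<comment> \<open>The first minor does not involve the interpolated variables, so its power is
        a common factor of all terms.\<close>
      have D: "?D (U M s t s' t') = ?D M" using kl by (simp add: U_def minor_def)
      have D': "?D' (U M s t s' t') = s * t - s' * t'" using kl by (simp add: U_def minor_def)
      have ne': "(s * t - s' * t') ^ n' \<noteq> 0" using ne[OF st] by simp
      have "h' (U M s t s' t') * (s * t - s' * t') ^ n' = P' (U M s t s' t')"
        using P'(2)[of "U M s t s' t'"] ne[OF st] by (simp add: D')
      then have "h' (U M s t s' t') = P' (U M s t s' t') * (1 / (s * t - s' * t') ^ n')"
        using ne' by (simp add: field_simps)
      moreover have "h (U M s t s' t') = h' (U M s t s' t')" using eq M ne[OF st] by (simp add: D D')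
      ultimately show ?thesis
        using P(2)[of "U M s t s' t'"] M by (simp add: D mult.commute)
    qed
    then have "P M = (\<Sum>s\<in>S1. \<Sum>t\<in>S1. \<Sum>s'\<in>S2. \<Sum>t'\<in>S2.
        L M s t s' t' * (?D M ^ n * (P' (U M s t s' t') * (1 / (s * t - s' * t') ^ n'))))"
      by (subst PL) (intro sum.cong refl, simp)
    also have "\<dots> = ?D M ^ n * Q M"
      unfolding Q_def sum_distrib_left by (intro sum.cong refl) (simp add: mult_ac)
    finally have "?D M ^ n * h M = ?D M ^ n * Q M" using P(2)[OF M] by (simp add: mult.commute)
    then show ?thesis using M by simp
  qed
  moreover have "Q \<in> poly_funs"
    unfolding Q_def[abs_def] L_def U_def
    by (intro poly_funs_sum poly_funs.mult poly_funs.const poly_funs_poly poly_funs.var)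
      (intro poly_funs_fun_upd[of "\<lambda>M. P' (M(_ := _, _ := _, _ := _))"]
        poly_funs_fun_upd[of "\<lambda>M. P' (M(_ := _, _ := _))"] poly_funs_fun_upd[of "\<lambda>M. P' (M(_ := _))"]
        poly_funs_fun_upd P'(1))
  ultimately show ?thesis using that by blast
qed

definition ix_mult :: "nat \<Rightarrow> 'a::field_char_0 ix_matrix \<Rightarrow> 'a ix_matrix \<Rightarrow> 'a ix_matrix" where
  "ix_mult m A B X Y = (\<Sum>Z\<in>young_ix m. A X Z * B Z Y)"

lemma ix_mult_assoc: "ix_mult m (ix_mult m A B) C = ix_mult m A (ix_mult m B C)"
proof (intro ext)
  fix X Y
  have "ix_mult m (ix_mult m A B) C X Y = (\<Sum>Z\<in>young_ix m. \<Sum>W\<in>young_ix m. A X W * (B W Z * C Z Y))"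
    by (simp add: ix_mult_def sum_distrib_right mult.assoc)
  also have "\<dots> = (\<Sum>W\<in>young_ix m. \<Sum>Z\<in>young_ix m. A X W * (B W Z * C Z Y))" by (rule sum.swap)
  also have "\<dots> = ix_mult m A (ix_mult m B C) X Y" by (simp add: ix_mult_def sum_distrib_left)
  finally show "ix_mult m (ix_mult m A B) C X Y = ix_mult m A (ix_mult m B C) X Y" .
qed

text \<open>Cutting off outside the index set turns the rule for \<open>frame_change\<close> into an
  identity of matrices under \<open>ix_mult\<close>, free of membership conditions.\<close>

definition frame_matrix :: "nat \<Rightarrow> (nat \<Rightarrow> nat \<Rightarrow> 'a::field_char_0) \<Rightarrow> 'a ix_matrix" where
  "frame_matrix m g X Y = (if X \<in> young_ix m \<and> Y \<in> young_ix m then frame_change g X Y else 0)"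

lemma frame_matrix_mult: "ix_mult m (frame_matrix m g) (frame_matrix m h) = frame_matrix m (mat2_mult g h)"
proof (intro ext)
  fix X Y
  show "ix_mult m (frame_matrix m g) (frame_matrix m h) X Y = frame_matrix m (mat2_mult g h) X Y"
  proof (cases "X \<in> young_ix m \<and> Y \<in> young_ix m")
    case True
    then show ?thesis by (simp add: ix_mult_def frame_matrix_def flip: frame_change_mult[of X m Y g h])
  next
    case False
    then show ?thesis unfolding ix_mult_def by (subst sum.neutral) (auto simp: frame_matrix_def)
  qed
qed

definition ix_supported :: "nat \<Rightarrow> 'a::field_char_0 ix_matrix \<Rightarrow> bool" where
  "ix_supported m A \<longleftrightarrow> (\<forall>X Y. A X Y \<noteq> 0 \<longrightarrow> X \<in> young_ix m \<and> Y \<in> young_ix m)"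

lemma ix_supportedD: "ix_supported m A \<Longrightarrow> X \<notin> young_ix m \<or> Y \<notin> young_ix m \<Longrightarrow> A X Y = 0"
  unfolding ix_supported_def by blast

lemma frame_matrix_id:
  assumes "ix_supported m A"
  shows "ix_mult m (frame_matrix m (mat2 1 0 0 1)) A = A" "ix_mult m A (frame_matrix m (mat2 1 0 0 1)) = A"
proof -
  have id: "frame_matrix m (mat2 1 0 0 1) X Z = (if X = Z \<and> X \<in> young_ix m then 1 else 0)" for X Z
    by (auto simp: frame_matrix_def frame_change_id)
  show "ix_mult m (frame_matrix m (mat2 1 0 0 1)) A = A"
  proof (intro ext)
    fix X Y
    have "ix_mult m (frame_matrix m (mat2 1 0 0 1)) A X Y = (\<Sum>Z\<in>young_ix m. if Z = X then A X Y else 0)"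
      unfolding ix_mult_def id by (rule sum.cong) auto
    then show "ix_mult m (frame_matrix m (mat2 1 0 0 1)) A X Y = A X Y"
      using ix_supportedD[OF assms, of X Y] by (auto simp: finite_young_ix)
  qed
  show "ix_mult m A (frame_matrix m (mat2 1 0 0 1)) = A"
  proof (intro ext)
    fix X Y
    have "ix_mult m A (frame_matrix m (mat2 1 0 0 1)) X Y = (\<Sum>Z\<in>young_ix m. if Z = Y then A X Y else 0)"
      unfolding ix_mult_def id by (rule sum.cong) auto
    then show "ix_mult m A (frame_matrix m (mat2 1 0 0 1)) X Y = A X Y"
      using ix_supportedD[OF assms, of X Y] by (auto simp: finite_young_ix)
  qed
qed

lemma mat2_mult_assoc: "mat2_mult (mat2_mult g h) k = mat2_mult g (mat2_mult h k)"
  by (intro ext) (simp add: mat2_mult_def algebra_simps)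

text \<open>By Cramer's rule a chart coordinate of the kernel of \<open>M\<close> is a 2 x 2 minor
  of \<open>M\<close> divided by the minor of the chart.\<close>

lemma chart_polys_rational:
  fixes p :: "('a::field_char_0 ^ 'n::finite) set \<Rightarrow> 'a"
  assumes "p \<in> chart_polys c"
  shows "(\<lambda>M. p (ker_mat M)) \<in> rational_over (minor c)"
  using assms
proof induction
  case (const x)
  show ?case by (rule rational_over_poly[OF poly_funs.const])
next
  case (coord \<rho> a)
  let ?N = "\<lambda>M. if a = 1 then M (\<rho>, False) * M (snd c, True) - M (snd c, False) * M (\<rho>, True)
    else M (fst c, False) * M (\<rho>, True) - M (\<rho>, False) * M (fst c, True)"
  have eq: "frame_coord c (ker_mat M) (axis \<rho> 1) a = ?N M / minor c M" if "minor c M \<noteq> 0" for M :: "'n \<times> bool \<Rightarrow> 'a"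
  proof -
    have "frame_coord c (ker_mat M) (axis \<rho> 1) a = chart_mat c (ker_mat M) (\<rho>, a \<noteq> 1)"
      by (simp add: chart_mat_def frame_coord_def)
    then show ?thesis
      unfolding chart_mat_ker_mat[OF that]
      by (simp add: gl2_act_def frame_inv_def diff_divide_distrib mult.commute)
  qed
  have rat: "(\<lambda>M :: 'n \<times> bool \<Rightarrow> 'a. ?N M / minor c M) \<in> rational_over (minor c)"
    by (rule rational_over_divide) (cases "a = 1"; simp; intro poly_funs_closed)
  show ?case by (rule rational_over_cong[OF rat eq[symmetric]])
next
  case (add p q)
  show ?case by (rule rational_over_add[OF minor_poly_funs add(3,4)])
next
  case (mult p q)
  show ?case by (rule rational_over_mult[OF minor_poly_funs mult(3,4)])
qed

text \<open>The transition matrices of the bundle are the Schur functors applied block by block to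
  those of the tautological quotient.\<close>

lemma tilting_endos_iff:
  fixes \<phi> :: "('a::field_char_0, 'n::finite, (nat \<times> nat) \<times> nat) local_matrices"
  shows "\<phi> \<in> bundle_endos tilting_bundle \<longleftrightarrow>
    (\<forall>c X Y. regular_on_chart c (\<lambda>K. \<phi> c K X Y)) \<and>
    (\<forall>c d. \<forall>K\<in>chart c \<inter> chart d. \<forall>X\<in>young_ix (CARD('n) - 2). \<forall>Y\<in>young_ix (CARD('n) - 2).
      (\<Sum>Z\<in>young_ix (CARD('n) - 2). \<phi> c K X Z * frame_change (taut_transition c d K) Z Y) =
      (\<Sum>Z\<in>young_ix (CARD('n) - 2). frame_change (taut_transition c d K) X Z * \<phi> d K Z Y)) \<and>
    (\<forall>c K X Y. \<phi> c K X Y \<noteq> 0 \<longrightarrow> K \<in> chart c \<and> X \<in> young_ix (CARD('n) - 2) \<and> Y \<in> young_ix (CARD('n) - 2))"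
proof -
  let ?B = "tilting_bundle :: ('a, 'n, (nat \<times> nat) \<times> nat) vec_bundle"
  let ?W = "taut_quotient_bundle :: ('a, 'n, nat) vec_bundle"
  have ix: "frame_ix ?B = young_ix (CARD('n) - 2)"
    by (simp add: tilting_bundle_def direct_sum_bundle_def schur_bundle_def young_ix_def)
  have "frame_change (transition ?W c d K) = frame_change (taut_transition c d K)" for c d K
    by (rule frame_change_cong)
      (simp_all add: taut_quotient_bundle_def taut_transition_def frame_mat_def chart_mat_def)
  moreover have "transition ?B c d K X Y = frame_change (transition ?W c d K) X Y" for c d K X Y
    by (simp add: tilting_bundle_def direct_sum_bundle_def schur_bundle_def frame_change_def)
  ultimately have tr: "transition ?B c d K = frame_change (taut_transition c d K)" for c d K
    by (intro ext) (simp only:)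
  show ?thesis unfolding bundle_endos_def ix tr by simp
qed

text \<open>
  A matrix \<open>M\<close> with \<open>minor c M \<noteq> 0\<close> is \<open>frame_mat c M\<close> times the matrix of its kernel in the
  chart \<open>c\<close>, so this is the only equivariant extension of \<open>\<phi>\<close> to such matrices.
\<close>

definition endo_on_matrices ::
    "('a::field_char_0, 'n::finite, (nat \<times> nat) \<times> nat) local_matrices \<Rightarrow> 'n \<times> 'n \<Rightarrow> ('n \<times> bool \<Rightarrow> 'a) \<Rightarrow> 'a ix_matrix" where
  "endo_on_matrices \<phi> c M = ix_mult (CARD('n) - 2)
     (ix_mult (CARD('n) - 2) (frame_matrix (CARD('n) - 2) (frame_mat c M)) (\<phi> c (ker_mat M)))
     (frame_matrix (CARD('n) - 2) (frame_inv c M))"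

lemma tilting_endosD:
  fixes \<phi> :: "('a::field_char_0, 'n::finite, (nat \<times> nat) \<times> nat) local_matrices"
  assumes "\<phi> \<in> bundle_endos tilting_bundle"
  shows "regular_on_chart c (\<lambda>K. \<phi> c K X Y)"
    and "ix_supported (CARD('n) - 2) (\<phi> c K)"
    and "K \<notin> chart c \<Longrightarrow> \<phi> c K X Y = 0"
    and "K \<in> chart c \<Longrightarrow> K \<in> chart d \<Longrightarrow>
      ix_mult (CARD('n) - 2) (\<phi> c K) (frame_matrix (CARD('n) - 2) (taut_transition c d K)) =
      ix_mult (CARD('n) - 2) (frame_matrix (CARD('n) - 2) (taut_transition c d K)) (\<phi> d K)"
proof -
  let ?m = "CARD('n) - 2"
  note \<phi> = assms[unfolded tilting_endos_iff]
  show "regular_on_chart c (\<lambda>K. \<phi> c K X Y)" using \<phi> by blast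
  show supp: "ix_supported ?m (\<phi> c K)" for c K using \<phi> unfolding ix_supported_def by blast
  show "\<phi> c K X Y = 0" if "K \<notin> chart c" using \<phi> that by blast
  show "ix_mult ?m (\<phi> c K) (frame_matrix ?m (taut_transition c d K)) =
      ix_mult ?m (frame_matrix ?m (taut_transition c d K)) (\<phi> d K)" if K: "K \<in> chart c" "K \<in> chart d"
  proof (intro ext)
    fix X Y
    show "ix_mult ?m (\<phi> c K) (frame_matrix ?m (taut_transition c d K)) X Y =
        ix_mult ?m (frame_matrix ?m (taut_transition c d K)) (\<phi> d K) X Y"
    proof (cases "X \<in> young_ix ?m \<and> Y \<in> young_ix ?m")
      case True
      then have "(\<Sum>Z\<in>young_ix ?m. \<phi> c K X Z * frame_change (taut_transition c d K) Z Y) =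
          (\<Sum>Z\<in>young_ix ?m. frame_change (taut_transition c d K) X Z * \<phi> d K Z Y)"
        using \<phi> K by blast
      with True show ?thesis by (simp add: ix_mult_def frame_matrix_def)
    next
      case False
      then have "ix_mult ?m (\<phi> c K) (frame_matrix ?m (taut_transition c d K)) X Y = 0"
        unfolding ix_mult_def by (intro sum.neutral) (auto simp: frame_matrix_def ix_supportedD[OF supp])
      moreover have "ix_mult ?m (frame_matrix ?m (taut_transition c d K)) (\<phi> d K) X Y = 0"
        using False unfolding ix_mult_def by (intro sum.neutral) (auto simp: frame_matrix_def ix_supportedD[OF supp])
      ultimately show ?thesis by simp
    qed
  qed
qed

lemma endo_on_matrices_chart:
  fixes \<phi> :: "('a::field_char_0, 'n::finite, (nat \<times> nat) \<times> nat) local_matrices"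
  assumes "\<phi> \<in> bundle_endos tilting_bundle" "K \<in> chart c"
  shows "endo_on_matrices \<phi> c (chart_mat c K) = \<phi> c K"
  unfolding endo_on_matrices_def ker_mat_chart_mat[OF assms(2)] frame_mat_chart_mat[OF assms(2)]
    frame_inv_chart_mat[OF assms(2)]
  by (simp add: frame_matrix_id[OF tilting_endosD(2)[OF assms(1)]])

lemma frame_mat_as_mat2: "mat2 (frame_inv c M 1 1) (frame_inv c M 1 2) (frame_inv c M 2 1) (frame_inv c M 2 2) = frame_inv c M"
  by (simp add: frame_inv_def)

lemma mat2_mult_id_left: "mat2_mult (mat2 1 0 0 1) (frame_mat c M) = frame_mat c (M :: _ \<Rightarrow> 'a::field_char_0)"
  by (simp add: frame_mat_def mat2_mult_mat2)

text \<open>The frame matrices for \<open>c\<close> and \<open>d\<close> differ by the transition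
  matrix of the bundle, and the gluing condition on \<open>\<phi>\<close> moves it across to
  cancel.\<close>

lemma endo_on_matrices_indep:
  fixes \<phi> :: "('a::field_char_0, 'n::finite, (nat \<times> nat) \<times> nat) local_matrices"
  assumes \<phi>: "\<phi> \<in> bundle_endos tilting_bundle" and c: "minor c M \<noteq> 0" and d: "minor d M \<noteq> 0"
  shows "endo_on_matrices \<phi> c M = endo_on_matrices \<phi> d M"
proof -
  let ?m = "CARD('n) - 2"
  let ?K = "ker_mat M"
  let ?R = "frame_matrix ?m :: (nat \<Rightarrow> nat \<Rightarrow> 'a) \<Rightarrow> 'a ix_matrix"
  define T where "T = taut_transition c d ?K"
  have T: "T = mat2_mult (frame_inv c M) (frame_mat d M)"
    unfolding T_def taut_transition_def chart_mat_ker_mat[OF c] frame_mat_gl2_act frame_mat_as_mat2 ..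
  have "?R (frame_mat d M) = ix_mult ?m (?R (frame_mat c M)) (?R T)"
    unfolding frame_matrix_mult T mat2_mult_assoc[symmetric] frame_mat_inv[OF c] mat2_mult_id_left ..
  then have "endo_on_matrices \<phi> d M =
      ix_mult ?m (ix_mult ?m (?R (frame_mat c M)) (ix_mult ?m (?R T) (\<phi> d ?K))) (?R (frame_inv d M))"
    by (simp only: endo_on_matrices_def ix_mult_assoc)
  also have "ix_mult ?m (?R T) (\<phi> d ?K) = ix_mult ?m (\<phi> c ?K) (?R T)"
    unfolding T_def by (rule tilting_endosD(4)[OF \<phi> ker_mat_chart[OF c] ker_mat_chart[OF d], symmetric])
  also have "ix_mult ?m (ix_mult ?m (?R (frame_mat c M)) (ix_mult ?m (\<phi> c ?K) (?R T))) (?R (frame_inv d M)) =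
      ix_mult ?m (ix_mult ?m (?R (frame_mat c M)) (\<phi> c ?K)) (ix_mult ?m (?R T) (?R (frame_inv d M)))"
    by (simp only: ix_mult_assoc)
  also have "ix_mult ?m (?R T) (?R (frame_inv d M)) = ?R (frame_inv c M)"
  proof -
    have "mat2_mult (frame_inv c M) (mat2 1 0 0 1) = frame_inv c M"
      by (simp add: frame_inv_def mat2_mult_mat2)
    then show ?thesis unfolding frame_matrix_mult T mat2_mult_assoc frame_mat_inv[OF d] by simp
  qed
  finally show ?thesis by (simp only: endo_on_matrices_def)
qed

text \<open>Left multiplication by an invertible \<open>g\<close> keeps the kernel and multiplies
  the frame matrix by \<open>g\<close>, so the value is conjugated.\<close>

lemma endo_on_matrices_equivariant:
  fixes \<phi> :: "('a::field_char_0, 'n::finite, (nat \<times> nat) \<times> nat) local_matrices"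
  assumes g: "gl2_det (mat2 p q r s) \<noteq> 0"
  shows "ix_mult (CARD('n) - 2) (endo_on_matrices \<phi> c (gl2_act (mat2 p q r s) M)) (frame_matrix (CARD('n) - 2) (mat2 p q r s)) =
    ix_mult (CARD('n) - 2) (frame_matrix (CARD('n) - 2) (mat2 p q r s)) (endo_on_matrices \<phi> c M)"
proof -
  let ?m = "CARD('n) - 2"
  let ?g = "mat2 p q r s"
  let ?R = "frame_matrix ?m :: (nat \<Rightarrow> nat \<Rightarrow> 'a) \<Rightarrow> 'a ix_matrix"
  have fm: "frame_mat c (gl2_act ?g M) = mat2_mult ?g (frame_mat c M)"
    unfolding frame_mat_gl2_act by simp
  have "ix_mult ?m (endo_on_matrices \<phi> c (gl2_act ?g M)) (?R ?g) =
      ix_mult ?m (ix_mult ?m (?R (mat2_mult ?g (frame_mat c M))) (\<phi> c (ker_mat M)))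
        (ix_mult ?m (?R (frame_inv c (gl2_act ?g M))) (?R ?g))"
    by (simp only: endo_on_matrices_def ker_mat_gl2_act[OF g] fm ix_mult_assoc)
  also have "\<dots> = ix_mult ?m (?R ?g) (endo_on_matrices \<phi> c M)"
    unfolding frame_matrix_mult[of _ "frame_inv c (gl2_act ?g M)"] frame_inv_gl2_act[OF g]
    by (simp only: frame_matrix_mult[symmetric] endo_on_matrices_def ix_mult_assoc)
  finally show ?thesis .
qed

lemma endo_on_matrices_rational:
  fixes \<phi> :: "('a::field_char_0, 'n::finite, (nat \<times> nat) \<times> nat) local_matrices"
  assumes \<phi>: "\<phi> \<in> bundle_endos tilting_bundle"
  shows "(\<lambda>M. endo_on_matrices \<phi> c M X Y) \<in> rational_over (minor c)"
proof -
  note var = rational_over_poly[OF poly_funs.var] and const = rational_over_poly[OF poly_funs.const]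
  have fm: "(\<lambda>M :: 'n \<times> bool \<Rightarrow> 'a. frame_matrix m (frame_mat c M) X Z) \<in> rational_over (minor c)" for m X Z
  proof (cases "X \<in> young_ix m \<and> Z \<in> young_ix m")
    case True
    have "(\<lambda>M :: 'n \<times> bool \<Rightarrow> 'a. frame_change (frame_mat c M) X Z) \<in> rational_over (minor c)"
      unfolding frame_mat_def by (intro rational_over_frame_change minor_poly_funs var)
    with True show ?thesis by (simp add: frame_matrix_def)
  next
    case False
    then show ?thesis by (simp only: frame_matrix_def if_False const)
  qed
  have fi: "(\<lambda>M :: 'n \<times> bool \<Rightarrow> 'a. frame_matrix m (frame_inv c M) X Z) \<in> rational_over (minor c)" for m X Z
  proof (cases "X \<in> young_ix m \<and> Z \<in> young_ix m")
    case True
    have "(\<lambda>M :: 'n \<times> bool \<Rightarrow> 'a. frame_change (frame_inv c M) X Z) \<in> rational_over (minor c)"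
      unfolding frame_inv_def
      by (intro rational_over_frame_change minor_poly_funs rational_over_divide poly_funs_minus poly_funs.var)
    with True show ?thesis by (simp add: frame_matrix_def)
  next
    case False
    then show ?thesis by (simp only: frame_matrix_def if_False const)
  qed
  have ph: "(\<lambda>M. \<phi> c (ker_mat M) X Z) \<in> rational_over (minor c)" for X Z
  proof -
    obtain p where p: "p \<in> chart_polys c" "\<forall>K\<in>chart c. \<phi> c K X Z = p K"
      using tilting_endosD(1)[OF \<phi>] unfolding regular_on_chart_def by blast
    show ?thesis
      by (rule rational_over_cong[OF chart_polys_rational[OF p(1)]]) (simp add: p(2) ker_mat_chart)
  qed
  show ?thesis
    unfolding endo_on_matrices_def ix_mult_def
    by (intro rational_over_sum rational_over_mult minor_poly_funs fm fi ph)
qed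

lemma minor_nonzero:
  assumes "fst c \<noteq> snd c"
  obtains M :: "'n \<times> bool \<Rightarrow> 'a::field_char_0" where "minor c M \<noteq> 0"
proof
  show "minor c (\<lambda>v. if v = (fst c, False) \<or> v = (snd c, True) then 1 else (0 :: 'a)) \<noteq> 0"
    using assms by (simp add: minor_def)
qed

text \<open>Four distinct indices supply two minors without common variables, and the Hartogs
  extension for this pair gives \<open>Q\<close>. By density \<open>Q\<close> is also right for
  every other chart.\<close>

lemma endo_extension:
  fixes \<phi> :: "('a::field_char_0, 'n::finite, (nat \<times> nat) \<times> nat) local_matrices"
  assumes \<phi>: "\<phi> \<in> bundle_endos tilting_bundle" and n: "CARD('n) \<ge> 4"
  obtains Q where "\<And>X Y. (\<lambda>M. Q M X Y) \<in> poly_funs"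
    and "\<And>c M. minor c M \<noteq> 0 \<Longrightarrow> endo_on_matrices \<phi> c M = Q M"
proof -
  obtain S :: "'n set" where S: "card S = 4"
    by (rule obtain_subset_with_card_n[OF n])
  have "finite S" by (rule finite)
  then obtain xs where xs: "distinct xs" "set xs = S"
    using finite_distinct_list[of S] by auto
  then have "length xs = 4" using S distinct_card[OF xs(1)] by simp
  then obtain i j k l where "xs = [i, j, k, l]"
    by (auto simp: numeral_eq_Suc length_Suc_conv)
  with xs have distinct: "distinct [i, j, k, l]" by simp
  define Q where "Q X Y = (SOME P. P \<in> poly_funs \<and>
    (\<forall>M. minor (i, j) M \<noteq> 0 \<longrightarrow> endo_on_matrices \<phi> (i, j) M X Y = P M))" for X Y
  have Q': "Q X Y \<in> poly_funs \<and>
    (\<forall>M. minor (i, j) M \<noteq> 0 \<longrightarrow> endo_on_matrices \<phi> (i, j) M X Y = Q X Y M)" for X Y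
  proof -
    have eq: "endo_on_matrices \<phi> (i, j) M X Y = endo_on_matrices \<phi> (k, l) M X Y"
      if "minor (i, j) M \<noteq> 0" "minor (k, l) M \<noteq> 0" for M
      using endo_on_matrices_indep[OF \<phi> that] by simp
    have "\<exists>P. P \<in> poly_funs \<and>
        (\<forall>M. minor (i, j) M \<noteq> 0 \<longrightarrow> endo_on_matrices \<phi> (i, j) M X Y = P M)"
    proof (rule rational_over_two_minors[OF endo_on_matrices_rational[OF \<phi>, of "(i, j)" X Y]
          endo_on_matrices_rational[OF \<phi>, of "(k, l)" X Y] distinct])
      show "endo_on_matrices \<phi> (i, j) M X Y = endo_on_matrices \<phi> (k, l) M X Y"
        if "minor (i, j) M \<noteq> 0" "minor (k, l) M \<noteq> 0" for M
        by (rule eq[OF that])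
      fix P assume P: "P \<in> poly_funs"
        "\<And>M. minor (i, j) M \<noteq> 0 \<Longrightarrow> endo_on_matrices \<phi> (i, j) M X Y = P M"
      show "\<exists>P. P \<in> poly_funs \<and>
        (\<forall>M. minor (i, j) M \<noteq> 0 \<longrightarrow> endo_on_matrices \<phi> (i, j) M X Y = P M)"
        by (intro exI[of _ P] conjI allI impI P)
    qed
    then show ?thesis unfolding Q_def by (rule someI_ex)
  qed
  have Q1: "Q X Y \<in> poly_funs" for X Y
    by (rule conjunct1[OF Q'])
  have Q2: "endo_on_matrices \<phi> (i, j) M X Y = Q X Y M" if "minor (i, j) M \<noteq> 0" for X Y M
    by (rule mp[OF spec[OF conjunct2[OF Q']] that])
  have "endo_on_matrices \<phi> c M X Y = Q X Y M" if c: "minor c M \<noteq> 0" for c M X Y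
  proof -
    obtain P n where P: "P \<in> poly_funs" "\<And>M. minor c M \<noteq> 0 \<Longrightarrow> endo_on_matrices \<phi> c M X Y * minor c M ^ n = P M"
      using endo_on_matrices_rational[OF \<phi>, of c X Y] unfolding rational_over_def by blast
    \<comment> \<open>\<open>P\<close> is controlled only where the minor of \<open>c\<close> is
      nonzero; the extra factor makes the function vanish on the rest as well.\<close>
    let ?F = "\<lambda>M. minor c M * (P M - Q X Y M * minor c M ^ n)"
    have F: "?F \<in> poly_funs" by (intro poly_funs_closed minor_poly_funs P(1) Q1)
    obtain M0 :: "'n \<times> bool \<Rightarrow> 'a" where M0: "minor (i, j) M0 \<noteq> 0"
      using minor_nonzero[of "(i, j)"] distinct by auto
    have "?F M = 0"
    proof (rule poly_fun_eq_0[OF F minor_poly_funs M0])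
      fix M :: "'n \<times> bool \<Rightarrow> 'a" assume ij: "minor (i, j) M \<noteq> 0"
      show "?F M = 0"
      proof (cases "minor c M = 0")
        case False
        then show ?thesis
          using P(2)[OF False] Q2[OF ij, of X Y] endo_on_matrices_indep[OF \<phi> False ij] by simp
      qed simp
    qed
    then have "endo_on_matrices \<phi> c M X Y * minor c M ^ n = Q X Y M * minor c M ^ n"
      using c P(2)[OF c] by simp
    then show ?thesis using c by simp
  qed
  then have eq: "endo_on_matrices \<phi> c M = (\<lambda>X Y. Q X Y M)" if "minor c M \<noteq> 0" for c M
    using that by (intro ext)
  show ?thesis
    by (rule that[of "\<lambda>M X Y. Q X Y M"], rule Q1, rule eq)
qed

section \<open>Equivariance under GL(2) and its Lie algebra\<close>

lemma sum_prod_bool: "(\<Sum>v\<in>UNIV. h v) = (\<Sum>i\<in>UNIV. h (i :: 'n::finite, False) + h (i, True))"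
proof -
  have "(\<Sum>v\<in>UNIV. h v) = (\<Sum>i\<in>UNIV. \<Sum>s\<in>UNIV. h (i :: 'n, s :: bool))"
    using sum.cartesian_product[of "\<lambda>i s. h (i, s)" UNIV UNIV] by simp
  then show ?thesis by (simp add: UNIV_bool)
qed

lemma pderiv_sum: "pderiv (\<Sum>i\<in>S. f i) = (\<Sum>i\<in>S. pderiv (f i))"
  by (induction S rule: infinite_finite_induct) (simp_all add: pderiv_add)

text \<open>Scaling row \<open>u\<close> by s multiplies F by s^(l - k); differentiating this at s =
  1 gives the eigenvalue of the Euler operator of the row.\<close>

lemma torus_weight_polar:
  fixes F :: "('n::finite \<times> bool \<Rightarrow> 'a::field_char_0) \<Rightarrow> 'a"
  assumes F: "F \<in> poly_funs"
    and weight: "\<And>s. s \<noteq> 0 \<Longrightarrow> F (\<lambda>v. if snd v = u then s * M v else M v) * s ^ k = s ^ l * F M"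
  shows "polar u u F M = of_int (int l - int k) * F M"
proof -
  define c where "c v = (if snd v = u then [:0, M v:] else [:M v:])" for v
  obtain r where r: "\<And>s. poly r s = F (\<lambda>v. poly (c v) s)"
    using poly_funs_curve[OF F, where c = c] by blast
  have c: "(\<lambda>v. poly (c v) s) = (\<lambda>v. if snd v = u then s * M v else M v)" for s
    by (rule ext) (simp add: c_def)
  \<comment> \<open>The hypothesis is silent at s = 0; the factor s makes both sides agree there too
    and is cancelled afterwards.\<close>
  have "[:0, 1:] * (r * monom 1 k) = [:0, 1:] * Polynomial.smult (F M) (monom 1 l)"
  proof (rule poly_eq_poly_eq_iff[THEN iffD1], rule ext)
    fix s
    show "poly ([:0, 1:] * (r * monom 1 k)) s = poly ([:0, 1:] * Polynomial.smult (F M) (monom 1 l)) s"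
    proof (cases "s = 0")
      case False
      then show ?thesis using weight[OF False] by (simp add: poly_monom r c mult_ac)
    qed simp
  qed
  then have "r * monom 1 k = Polynomial.smult (F M) (monom 1 l)" by simp
  then have "poly (pderiv (r * monom 1 k)) 1 = poly (pderiv (Polynomial.smult (F M) (monom 1 l))) 1" by simp
  moreover have "poly r 1 = F M" unfolding r c by (simp cong: if_cong)
  ultimately have "poly (pderiv r) 1 = of_nat l * F M - of_nat k * F M"
    by (simp add: pderiv_mult pderiv_monom pderiv_smult poly_monom algebra_simps)
  moreover have "poly (pderiv r) 1 = (\<Sum>v\<in>UNIV. pd v F M * poly (pderiv (c v)) 1)"
    unfolding pd_chain[OF F r] c by (simp cong: if_cong)
  moreover have "\<dots> = polar u u F M"
    unfolding sum_prod_bool polar_def by (rule sum.cong) (cases u; simp add: c_def pderiv_pCons)+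
  ultimately show ?thesis by (simp add: algebra_simps)
qed

lemma schur_matrix_torus:
  assumes "b \<le> fst lam - snd lam" "snd lam \<le> fst lam"
  shows "schur_matrix lam (mat2 t 0 0 s) a b =
    (if a = b then t ^ (fst lam - b) * s ^ (snd lam + b) else (0 :: 'a::field_char_0))"
proof -
  have "[:t, 0:] ^ n = [:t ^ n:]" for n :: nat
    by (induction n) (simp_all add: one_pCons)
  moreover have "[:0, s:] ^ n = monom (s ^ n) n" for n :: nat
    by (induction n) (simp_all add: one_pCons monom_0 monom_Suc smult_monom)
  moreover have "t ^ snd lam * t ^ (fst lam - snd lam - b) = t ^ (fst lam - b)"
    unfolding power_add[symmetric] using assms by simp
  ultimately show ?thesis
    by (simp add: schur_matrix_def mat2_def power_mult_distrib power_add mult_ac)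
qed

text \<open>The substitution fixes x and sends y to s x + y, whence the binomial coefficients. The
  entry is put as a polynomial in s in order to differentiate it.\<close>

lemma schur_matrix_unipotent:
  "schur_matrix lam (mat2 1 s 0 1) a b = poly (if a \<le> b then monom (of_nat (b choose a)) (b - a) else 0) s"
proof -
  have "[:1, 0:] ^ n = (1 :: 'a poly)" for n :: nat
    by (induction n) (simp_all add: one_pCons)
  moreover have "coeff ([:s, 1:] ^ b) a = of_nat (b choose a) * s ^ (b - a)"
    by (cases "a \<le> b") (simp_all add: coeff_linear_poly_power coeff_eq_0 degree_linear_power binomial_eq_0)
  ultimately show ?thesis by (simp add: schur_matrix_def mat2_def poly_monom binomial_eq_0)
qed

text \<open>The conditions of \<open>equivariant_maps\<close> are the derivatives of
  GL(2)-equivariance along three one-parameter subgroups: the two scalings of a row, at s = 1, and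
  the unipotent one, at s = 0.\<close>

lemma equivariant_family_hom_maps:
  fixes Q :: "('n::finite \<times> bool \<Rightarrow> 'a::field_char_0) \<Rightarrow> 'a ix_matrix"
  assumes poly: "\<And>X Y. (\<lambda>M. Q M X Y) \<in> poly_funs"
    and supp: "\<And>M. ix_supported m (Q M)"
    and equiv: "\<And>p q r s M. gl2_det (mat2 p q r s) \<noteq> 0 \<Longrightarrow>
      ix_mult m (Q (gl2_act (mat2 p q r s) M)) (frame_matrix m (mat2 p q r s)) =
      ix_mult m (frame_matrix m (mat2 p q r s)) (Q M)"
    and young: "lam \<in> young m" "mu \<in> young m"
  shows "(\<lambda>a b M. if 0 \<le> a \<and> 0 \<le> b then Q M (mu, nat a) (lam, nat b) else 0) \<in> hom_maps lam mu"
proof -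
  define d where "d = fst lam - snd lam"
  define e where "e = fst mu - snd mu"
  define q where "q a b M = Q M (mu, a) (lam, b)" for a b M
  have q_poly: "q a b \<in> poly_funs" for a b unfolding q_def[abs_def] by (rule poly)
  have le: "snd lam \<le> fst lam" "snd mu \<le> fst mu" using young by (auto simp: young_def)
  have q_off: "q a b M = 0" if "e < a \<or> d < b" for a b M
    unfolding q_def by (rule ix_supportedD[OF supp]) (use that in \<open>auto simp: young_ix_iff d_def e_def\<close>)
  have block: "(\<Sum>k\<le>d. q a k (gl2_act (mat2 p r t s) M) * schur_matrix lam (mat2 p r t s) k b) =
      (\<Sum>k\<le>e. schur_matrix mu (mat2 p r t s) a k * q k b M)"
    if det: "gl2_det (mat2 p r t s) \<noteq> 0" and ab: "a \<le> e" "b \<le> d" for p r t s a b M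
  proof -
    let ?g = "mat2 p r t s"
    have ix: "(mu, a) \<in> young_ix m" "(lam, b) \<in> young_ix m"
      using ab young by (auto simp: young_ix_iff d_def e_def)
    have "ix_mult m (Q (gl2_act ?g M)) (frame_matrix m ?g) (mu, a) (lam, b) =
        (\<Sum>k\<le>d. q a k (gl2_act ?g M) * schur_matrix lam ?g k b)"
    proof -
      have "ix_mult m (Q (gl2_act ?g M)) (frame_matrix m ?g) (mu, a) (lam, b) =
          (\<Sum>Z\<in>young_ix m. Q (gl2_act ?g M) (mu, a) Z * frame_change ?g Z (lam, b))"
        unfolding ix_mult_def by (rule sum.cong) (simp_all add: frame_matrix_def ix)
      also have "\<dots> = (\<Sum>k\<le>d. Q (gl2_act ?g M) (mu, a) (lam, k) * frame_change ?g (lam, k) (lam, b))"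
        unfolding d_def by (rule sum_young_ix_block[OF young(1)]) (simp add: frame_change_def)
      finally show ?thesis by (simp add: q_def frame_change_def)
    qed
    moreover have "ix_mult m (frame_matrix m ?g) (Q M) (mu, a) (lam, b) =
        (\<Sum>k\<le>e. schur_matrix mu ?g a k * q k b M)"
    proof -
      have "ix_mult m (frame_matrix m ?g) (Q M) (mu, a) (lam, b) =
          (\<Sum>Z\<in>young_ix m. frame_change ?g (mu, a) Z * Q M Z (lam, b))"
        unfolding ix_mult_def by (rule sum.cong) (simp_all add: frame_matrix_def ix)
      also have "\<dots> = (\<Sum>k\<le>e. frame_change ?g (mu, a) (mu, k) * Q M (mu, k) (lam, b))"
        unfolding e_def by (rule sum_young_ix_block[OF young(2)]) (simp add: frame_change_def)
      finally show ?thesis by (simp add: q_def frame_change_def)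
    qed
    ultimately show ?thesis using equiv[OF det] by simp
  qed
  have torus: "q a b (gl2_act (mat2 t 0 0 s) M) * (t ^ (fst lam - b) * s ^ (snd lam + b)) =
      t ^ (fst mu - a) * s ^ (snd mu + a) * q a b M"
    if "t \<noteq> 0" "s \<noteq> 0" and ab: "a \<le> e" "b \<le> d" for t s a b M
  proof -
    have "(\<Sum>k\<le>d. q a k (gl2_act (mat2 t 0 0 s) M) * schur_matrix lam (mat2 t 0 0 s) k b) =
        (\<Sum>k\<le>d. if k = b then q a b (gl2_act (mat2 t 0 0 s) M) * (t ^ (fst lam - b) * s ^ (snd lam + b)) else 0)"
      by (rule sum.cong) (use ab le in \<open>simp_all add: schur_matrix_torus d_def\<close>)
    moreover have "(\<Sum>k\<le>e. schur_matrix mu (mat2 t 0 0 s) a k * q k b M) =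
        (\<Sum>k\<le>e. if k = a then t ^ (fst mu - a) * s ^ (snd mu + a) * q a b M else 0)"
      by (rule sum.cong) (use ab le in \<open>simp_all add: schur_matrix_torus e_def\<close>)
    moreover have "gl2_det (mat2 t 0 0 s) \<noteq> 0" using that by (simp add: gl2_det_def mat2_def)
    ultimately show ?thesis using block[of t 0 0 s a b M] ab by simp
  qed
  have torus1: "polar False False (q a b) M = of_int (int (fst mu - a) - int (fst lam - b)) * q a b M"
    if ab: "a \<le> e" "b \<le> d" for a b M
  proof (rule torus_weight_polar[OF q_poly])
    fix s :: 'a assume s: "s \<noteq> 0"
    have "gl2_act (mat2 s 0 0 1) M = (\<lambda>v. if snd v = False then s * M v else M v)"
      by (rule ext) (auto simp: gl2_act_def mat2_def split: prod.splits)
    then show "q a b (\<lambda>v. if snd v = False then s * M v else M v) * s ^ (fst lam - b) = s ^ (fst mu - a) * q a b M"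
      using torus[OF s _ ab, of 1 M] by simp
  qed
  have torus2: "polar True True (q a b) M = of_int (int (snd mu + a) - int (snd lam + b)) * q a b M"
    if ab: "a \<le> e" "b \<le> d" for a b M
  proof (rule torus_weight_polar[OF q_poly])
    fix s :: 'a assume s: "s \<noteq> 0"
    have "gl2_act (mat2 1 0 0 s) M = (\<lambda>v. if snd v = True then s * M v else M v)"
      by (rule ext) (auto simp: gl2_act_def mat2_def split: prod.splits)
    then show "q a b (\<lambda>v. if snd v = True then s * M v else M v) * s ^ (snd lam + b) = s ^ (snd mu + a) * q a b M"
      using torus[OF _ s ab, of 1 M] by simp
  qed
  have unipotent: "polar True False (q a b) M + of_nat b * q a (b - 1) M = of_nat (a + 1) * q (a + 1) b M"
    if ab: "a \<le> e" "b \<le> d" for a b M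
  proof -
    \<comment> \<open>The orbit of \<open>M\<close> under the unipotent subgroup; it adds multiples
      of row \<open>True\<close> to row \<open>False\<close>, hence its derivative is
      \<open>polar True False\<close>.\<close>
    define c where "c v = (if snd v then [:M v:] else [:M v, M (fst v, True):])" for v
    have c: "(\<lambda>v. poly (c v) s) = gl2_act (mat2 1 s 0 1) M" for s
      by (rule ext) (auto simp: c_def gl2_act_def mat2_def split: prod.splits)
    have c0: "(\<lambda>v. poly (c v) 0) = M" by (rule ext) (simp add: c_def)
    have "\<exists>r. \<forall>s. poly r s = q a k (\<lambda>v. poly (c v) s)" for k
      using poly_funs_curve[OF q_poly, where c = c] by blast
    then obtain r where r: "\<And>k s. poly (r k) s = q a k (\<lambda>v. poly (c v) s)" by metis
    define U where "U k l = (if k \<le> l then monom (of_nat (l choose k)) (l - k) else 0 :: 'a poly)" for k l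
    have "(\<Sum>k\<le>d. r k * U k b) = (\<Sum>k\<le>e. Polynomial.smult (q k b M) (U a k))"
    proof (rule poly_eq_poly_eq_iff[THEN iffD1], rule ext)
      fix s :: 'a
      have "gl2_det (mat2 1 s 0 1) \<noteq> 0" by (simp add: gl2_det_def mat2_def)
      from block[OF this ab] show "poly (\<Sum>k\<le>d. r k * U k b) s = poly (\<Sum>k\<le>e. Polynomial.smult (q k b M) (U a k)) s"
        by (simp only: poly_sum poly_mult poly_smult r c U_def schur_matrix_unipotent mult.commute)
    qed
    then have "poly (pderiv (\<Sum>k\<le>d. r k * U k b)) 0 = poly (pderiv (\<Sum>k\<le>e. Polynomial.smult (q k b M) (U a k))) 0"
      by simp
    then have eq: "(\<Sum>k\<le>d. poly (pderiv (r k)) 0 * poly (U k b) 0 + poly (r k) 0 * poly (pderiv (U k b)) 0) =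
        (\<Sum>k\<le>e. q k b M * poly (pderiv (U a k)) 0)"
      by (simp add: pderiv_sum pderiv_mult pderiv_smult poly_sum algebra_simps)
    \<comment> \<open>At s = 0 the unipotent matrix is the identity, and its derivative takes the
      monomial with exponent l of y to l times the one with exponent l - 1.\<close>
    have U0: "poly (U k l) 0 = (if k = l then 1 else 0)" for k l
      by (auto simp: U_def poly_monom power_0_left)
    have U1: "poly (pderiv (U k l)) 0 = (if l = Suc k then of_nat l else 0)" for k l
      by (auto simp: U_def pderiv_monom poly_monom power_0_left)
    have r0: "poly (r k) 0 = q a k M" for k unfolding r c0 ..
    have "(\<Sum>k\<le>d. poly (pderiv (r k)) 0 * poly (U k b) 0 + poly (r k) 0 * poly (pderiv (U k b)) 0) =
        poly (pderiv (r b)) 0 + of_nat b * q a (b - 1) M"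
    proof -
      have "(\<Sum>k\<le>d. poly (pderiv (r k)) 0 * poly (U k b) 0) = (\<Sum>k\<le>d. if k = b then poly (pderiv (r b)) 0 else 0)"
        by (rule sum.cong) (simp_all add: U0)
      moreover have "(\<Sum>k\<le>d. poly (r k) 0 * poly (pderiv (U k b)) 0) =
          (\<Sum>k\<le>d. if k = b - 1 then of_nat b * q a (b - 1) M else 0)"
        by (rule sum.cong) (cases b; simp add: U1 r0)+
      ultimately show ?thesis using ab by (simp add: sum.distrib)
    qed
    moreover have "(\<Sum>k\<le>e. q k b M * poly (pderiv (U a k)) 0) = of_nat (a + 1) * q (a + 1) b M"
    proof -
      have "(\<Sum>k\<le>e. q k b M * poly (pderiv (U a k)) 0) = (\<Sum>k\<le>e. if k = a + 1 then of_nat (a + 1) * q (a + 1) b M else 0)"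
        by (rule sum.cong) (simp_all add: U1)
      then show ?thesis using q_off[of "a + 1" b M] by simp
    qed
    moreover have "poly (pderiv (r b)) 0 = polar True False (q a b) M"
    proof -
      have "poly (pderiv (r b)) 0 = (\<Sum>v\<in>UNIV. pd v (q a b) M * poly (pderiv (c v)) 0)"
        unfolding pd_chain[OF q_poly r] c0 by simp
      also have "\<dots> = polar True False (q a b) M"
        unfolding sum_prod_bool polar_def by (rule sum.cong) (simp_all add: c_def pderiv_pCons)
      finally show ?thesis .
    qed
    ultimately show ?thesis using eq by simp
  qed
  \<comment> \<open>Padding by zeros over the integers. The unipotent condition survives at a = -1
    because its coefficient \<open>a + 1\<close> is zero there.\<close>
  define F where "F a b M = (if 0 \<le> a \<and> 0 \<le> b then q (nat a) (nat b) M else 0)" for a b :: int and M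
  have F_nat: "F (int a) (int b) = q a b" for a b by (rule ext) (simp add: F_def)
  have lev: "level lam = int d" "level mu = int e" using le by (simp_all add: level_def d_def e_def)
  have F_off: "F a b = (\<lambda>_. 0)" if "\<not> (0 \<le> a \<and> a \<le> level mu \<and> 0 \<le> b \<and> b \<le> level lam)" for a b
    by (rule ext) (use that in \<open>auto simp: F_def lev intro!: q_off\<close>)
  have F_ix: "\<exists>a' b'. a = int a' \<and> b = int b' \<and> a' \<le> e \<and> b' \<le> d"
    if "0 \<le> a \<and> a \<le> level mu \<and> 0 \<le> b \<and> b \<le> level lam" for a b
    by (rule exI[of _ "nat a"], rule exI[of _ "nat b"]) (use that lev in auto)
  have "F \<in> hom_maps lam mu"
    unfolding hom_maps_def equivariant_maps_def hom_maps_level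
  proof (intro CollectI conjI allI impI)
    fix a b :: int
    show "F a b \<in> poly_funs"
      unfolding F_def[abs_def] by (rule poly_funs_if[OF q_poly])
    show "F a b = (\<lambda>_. 0)" if "\<not> (0 \<le> a \<and> a \<le> level mu \<and> 0 \<le> b \<and> b \<le> level lam)"
      by (rule F_off[OF that])
    show "polar False False (F a b) = (\<lambda>M. of_int (int (fst mu) - int (fst lam) - a + b) * F a b M)"
    proof (cases "0 \<le> a \<and> a \<le> level mu \<and> 0 \<le> b \<and> b \<le> level lam")
      case True
      then obtain a' b' where ab: "a = int a'" "b = int b'" "a' \<le> e" "b' \<le> d" using F_ix by blast
      then have "int (fst mu - a') - int (fst lam - b') = int (fst mu) - int (fst lam) - a + b"
        by (simp add: d_def e_def of_nat_diff)
      then show ?thesis unfolding ab(1,2) F_nat using torus1[OF ab(3,4)] by (intro ext) (simp add: ab)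
    qed (simp add: F_off polar_0)
    show "polar True True (F a b) = (\<lambda>M. of_int (int (snd mu) - int (snd lam) + a - b) * F a b M)"
    proof (cases "0 \<le> a \<and> a \<le> level mu \<and> 0 \<le> b \<and> b \<le> level lam")
      case True
      then obtain a' b' where ab: "a = int a'" "b = int b'" "a' \<le> e" "b' \<le> d" using F_ix by blast
      then have "int (snd mu + a') - int (snd lam + b') = int (snd mu) - int (snd lam) + a - b" by simp
      then show ?thesis unfolding ab(1,2) F_nat using torus2[OF ab(3,4)] by (intro ext) (simp add: ab)
    qed (simp add: F_off polar_0)
    assume b: "0 \<le> b" "b \<le> level lam"
    show "polar True False (F a b) = (\<lambda>M. of_int (a + 1) * F (a + 1) b M - of_int b * F a (b - 1) M)"
    proof (cases "0 \<le> a \<and> a \<le> level mu")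
      case True
      then obtain a' b' where ab: "a = int a'" "b = int b'" "a' \<le> e" "b' \<le> d" using F_ix b by blast
      have 1: "of_int b * F a (b - 1) M = of_nat b' * q a' (b' - 1) M" for M
        by (cases b') (simp_all add: ab F_def nat_diff_distrib)
      have 2: "of_int (a + 1) * F (a + 1) b M = of_nat (a' + 1) * q (a' + 1) b' M" for M
      proof -
        have "a + 1 = int (a' + 1)" by (simp add: ab)
        then show ?thesis unfolding ab(2) by (simp only: F_nat of_int_of_nat_eq)
      qed
      have 3: "F a b = q a' b'" unfolding ab(1,2) F_nat ..
      show ?thesis
        unfolding 1 2 3 by (rule ext) (simp only: eq_diff_eq unipotent[OF ab(3,4)])
    next
      case False
      then have z: "F a b = (\<lambda>_. 0)" "F a (b - 1) = (\<lambda>_. 0)" "a + 1 = 0 \<or> F (a + 1) b = (\<lambda>_. 0)"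
        by (auto intro!: F_off)
      have "of_int (a + 1) * F (a + 1) b M = 0" for M using z(3) by (elim disjE) simp_all
      then show ?thesis by (simp only: z(1,2) polar_0 mult_zero_right diff_zero)
    qed
  qed
  then show ?thesis unfolding F_def[abs_def] q_def .
qed

section \<open>The isomorphism\<close>

lemma gl2_act_poly_funs: "F \<in> poly_funs \<Longrightarrow> (\<lambda>M. F (gl2_act g M)) \<in> poly_funs"
proof (erule poly_funs_substitute)
  show "(\<lambda>M. gl2_act g M v) \<in> poly_funs" for v
    by (cases v; cases "snd v") (auto simp: gl2_act_def intro!: poly_funs_closed)
qed

lemma exists_minor_nonzero:
  assumes "CARD('n::finite) \<ge> 4"
  obtains c and M :: "'n::finite \<times> bool \<Rightarrow> 'a::field_char_0" where "minor c M \<noteq> 0"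
proof -
  have "(UNIV :: 'n set) \<noteq> {undefined}"
  proof
    assume "(UNIV :: 'n set) = {undefined}"
    then have "CARD('n) = card {undefined :: 'n}" by (rule arg_cong)
    then show False using assms by simp
  qed
  then obtain j :: 'n where "j \<noteq> undefined" by blast
  then have "fst (j, undefined) \<noteq> snd (j, undefined :: 'n)" by simp
  then obtain M :: "'n \<times> bool \<Rightarrow> 'a" where "minor (j, undefined) M \<noteq> 0" by (rule minor_nonzero)
  then show ?thesis by (rule that)
qed

text \<open>Support and equivariance hold where a minor is nonzero, hence everywhere by density,
  both being identities between polynomial functions. On the chart matrices, where the minor is 1,
  the extension gives back \<open>\<phi>\<close>.\<close>

lemma endo_equivariant_extension:
  fixes \<phi> :: "('a::field_char_0, 'n::finite, (nat \<times> nat) \<times> nat) local_matrices"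
  assumes \<phi>: "\<phi> \<in> bundle_endos tilting_bundle" and n: "CARD('n) \<ge> 4"
  obtains Q where "\<And>X Y. (\<lambda>M. Q M X Y) \<in> poly_funs"
    and "\<And>M. ix_supported (CARD('n) - 2) (Q M)"
    and "\<And>p q r s M. gl2_det (mat2 p q r s) \<noteq> 0 \<Longrightarrow>
      ix_mult (CARD('n) - 2) (Q (gl2_act (mat2 p q r s) M)) (frame_matrix (CARD('n) - 2) (mat2 p q r s)) =
      ix_mult (CARD('n) - 2) (frame_matrix (CARD('n) - 2) (mat2 p q r s)) (Q M)"
    and "\<And>c K. K \<in> chart c \<Longrightarrow> Q (chart_mat c K) = \<phi> c K"
proof -
  let ?m = "CARD('n) - 2"
  obtain Q where Q: "\<And>X Y. (\<lambda>M. Q M X Y) \<in> poly_funs"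
    and agree: "\<And>c M. minor c M \<noteq> 0 \<Longrightarrow> endo_on_matrices \<phi> c M = Q M"
    using endo_extension[OF \<phi> n] by blast
  obtain c0 and M0 :: "'n \<times> bool \<Rightarrow> 'a" where M0: "minor c0 M0 \<noteq> 0"
    by (rule exists_minor_nonzero[OF n]) (rule that)
  show ?thesis
  proof (rule that[of Q])
    show "(\<lambda>M. Q M X Y) \<in> poly_funs" for X Y by (rule Q)
    show "ix_supported ?m (Q M)" for M
      unfolding ix_supported_def
    proof (intro allI impI, rule ccontr)
      fix X Y assume nz: "Q M X Y \<noteq> 0" and out: "\<not> (X \<in> young_ix ?m \<and> Y \<in> young_ix ?m)"
      have "Q M X Y = 0"
      proof (rule poly_fun_eq_0[OF Q minor_poly_funs M0])
        fix M :: "'n \<times> bool \<Rightarrow> 'a" assume M: "minor c0 M \<noteq> 0"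
        show "Q M X Y = 0"
        proof (cases "Y \<in> young_ix ?m")
          case False
          then show ?thesis
            unfolding agree[OF M, symmetric] endo_on_matrices_def ix_mult_def by (simp add: frame_matrix_def)
        next
          case True
          then have "X \<notin> young_ix ?m" using out by blast
          then show ?thesis
            unfolding agree[OF M, symmetric] endo_on_matrices_def ix_mult_def by (simp add: frame_matrix_def)
        qed
      qed
      with nz show False by simp
    qed
    show "Q (chart_mat c K) = \<phi> c K" if K: "K \<in> chart c" for c K
    proof -
      have "minor c (chart_mat c K) \<noteq> 0" by (simp add: minor_chart_mat[OF K])
      from agree[OF this] show ?thesis by (simp add: endo_on_matrices_chart[OF \<phi> K])
    qed
    fix p q r s :: 'a and M :: "'n \<times> bool \<Rightarrow> 'a"
    let ?g = "mat2 p q r s"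
    let ?R = "frame_matrix ?m ?g"
    assume det: "gl2_det ?g \<noteq> 0"
    show "ix_mult ?m (Q (gl2_act ?g M)) ?R = ix_mult ?m ?R (Q M)"
    proof (intro ext)
      fix X Y
      have l: "(\<lambda>M. ix_mult ?m (Q (gl2_act ?g M)) ?R X Y) \<in> poly_funs"
        unfolding ix_mult_def
        by (intro poly_funs_sum poly_funs.mult poly_funs.const gl2_act_poly_funs[of "\<lambda>M. Q M X _"] Q)
      have r: "(\<lambda>M. ix_mult ?m ?R (Q M) X Y) \<in> poly_funs"
        unfolding ix_mult_def by (intro poly_funs_sum poly_funs.mult poly_funs.const Q)
      show "ix_mult ?m (Q (gl2_act ?g M)) ?R X Y = ix_mult ?m ?R (Q M) X Y"
      proof (rule poly_funs_eqI[OF l r minor_poly_funs M0])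
        fix M :: "'n \<times> bool \<Rightarrow> 'a" assume M: "minor c0 M \<noteq> 0"
        then have "minor c0 (gl2_act ?g M) \<noteq> 0" using det by (simp add: minor_gl2_act)
        from agree[OF this] agree[OF M] endo_on_matrices_equivariant[OF det, of \<phi> c0 M]
        show "ix_mult ?m (Q (gl2_act ?g M)) ?R X Y = ix_mult ?m ?R (Q M) X Y" by simp
      qed
    qed
  qed
qed

text \<open>The family is split into blocks from \<open>lam\<close> to \<open>mu\<close>, and
  \<open>psi\<close> lifts each of them. Blocks of negative degree \<open>N k\<close> vanish and are
  lifted to zero.\<close>

lemma equivariant_family_quiver_rep:
  fixes Q :: "('n::finite \<times> bool \<Rightarrow> 'a::field_char_0) \<Rightarrow> 'a ix_matrix"
  assumes Q: "\<And>X Y. (\<lambda>M. Q M X Y) \<in> poly_funs" "\<And>M. ix_supported (CARD('n) - 2) (Q M)"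
    "\<And>p q r s M. gl2_det (mat2 p q r s) \<noteq> 0 \<Longrightarrow>
      ix_mult (CARD('n) - 2) (Q (gl2_act (mat2 p q r s) M)) (frame_matrix (CARD('n) - 2) (mat2 p q r s)) =
      ix_mult (CARD('n) - 2) (frame_matrix (CARD('n) - 2) (mat2 p q r s)) (Q M)"
  obtains x :: "('a, 'n) path_element" where "x \<in> carrier TP" "\<And>M X Y. quiver_rep M x X Y = Q M X Y"
proof -
  let ?m = "CARD('n) - 2"
  define F where "F k = (\<lambda>a b M. if 0 \<le> a \<and> 0 \<le> b then Q M (snd k, nat a) (fst k, nat b) else 0)"
    for k :: "(nat \<times> nat) \<times> (nat \<times> nat)"
  define N where "N k = int (fst (snd k)) - int (fst (fst k)) + (int (snd (snd k)) - int (snd (fst k)))"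
    for k :: "(nat \<times> nat) \<times> (nat \<times> nat)"
  define y where "y k = (if 0 \<le> N k then psi (nat (N k)) (fst k) (snd k) (F k) else (\<lambda>_. 0))" for k
  let ?S = "young ?m \<times> young ?m"
  have F: "F k \<in> hom_maps (fst k) (snd k)" if "k \<in> ?S" for k
    unfolding F_def by (rule equivariant_family_hom_maps[OF Q]) (use that in auto)
  have y: "y k \<in> carrier TP" if "k \<in> ?S" for k
    using psi_closed[OF F[OF that]] that TQ.path_zero_closed by (auto simp: y_def)
  have rep: "quiver_rep M (y k) X Y = block_rep M (fst k) (snd k) (F k) X Y" if k: "k \<in> ?S" for k M X Y
  proof (cases "0 \<le> N k")
    case True
    then show ?thesis
      using quiver_rep_psi[OF F[OF k], of "nat (N k)" M X Y] k by (simp add: y_def N_def mem_Times_iff)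
  next
    case False
    then have "F k a b M = 0" for a b
      using equivariant_maps_neg_degree[OF F[OF k, unfolded hom_maps_def]] by (simp add: N_def)
    with False show ?thesis by (simp add: y_def quiver_rep_zero block_rep_def)
  qed
  define x where "x = (\<lambda>\<pi>. \<Sum>k\<in>?S. y k \<pi>)"
  have "x \<in> carrier TP" unfolding x_def by (rule TQ.path_sum_closed) (rule y)
  moreover have "quiver_rep M x X Y = Q M X Y" for M X Y
  proof -
    have "quiver_rep M x X Y = (\<Sum>k\<in>?S. block_rep M (fst k) (snd k) (F k) X Y)"
      unfolding x_def by (subst quiver_rep_sum[OF y]) (auto simp: rep)
    also have "\<dots> = (\<Sum>k\<in>?S. if k = (fst Y, fst X) then Q M X Y else 0)"
    proof (rule sum.cong[OF refl])
      fix k assume "k \<in> ?S"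
      show "block_rep M (fst k) (snd k) (F k) X Y = (if k = (fst Y, fst X) then Q M X Y else 0)"
        using ix_supportedD[OF Q(2), of X Y M]
        by (cases X; cases Y; cases k) (auto simp: block_rep_def F_def)
    qed
    also have "\<dots> = Q M X Y"
      using ix_supportedD[OF Q(2), of X Y M]
      by (cases X; cases Y) (auto simp: finite_young young_ix_iff)
    finally show ?thesis .
  qed
  ultimately show ?thesis by (rule that)
qed

definition rep_endo ::
    "('a::field_char_0, 'n::finite) path_element \<Rightarrow> ('a, 'n, (nat \<times> nat) \<times> nat) local_matrices" where
  "rep_endo x c K X Y = (if K \<in> chart c then quiver_rep (chart_mat c K) x X Y else 0)"

lemma chart_mat_chart_polys: "P \<in> poly_funs \<Longrightarrow> (\<lambda>K. P (chart_mat c K)) \<in> chart_polys c"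
proof (induction rule: poly_funs.induct)
  case (var v)
  show ?case by (cases v) (simp add: chart_mat_def chart_polys.coord)
qed (auto intro: chart_polys.intros)

text \<open>The entries of a chart matrix are the chart coordinates, which gives regularity. The
  gluing condition is the equivariance of the representation for the transition matrix.\<close>

lemma rep_endo_closed:
  fixes x :: "('a::field_char_0, 'n::finite) path_element"
  assumes "x \<in> carrier TP"
  shows "rep_endo x \<in> bundle_endos tilting_bundle"
  unfolding tilting_endos_iff
proof (intro conjI allI ballI impI)
  fix c :: "'n \<times> 'n" and X Y
  show "regular_on_chart c (\<lambda>K. rep_endo x c K X Y)"
    unfolding regular_on_chart_def
    by (rule bexI[OF _ chart_mat_chart_polys[OF quiver_rep_poly_funs[of x X Y]]]) (simp add: rep_endo_def)
next
  fix c d :: "'n \<times> 'n" and K :: "('a ^ 'n) set" and X Y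
  assume K: "K \<in> chart c \<inter> chart d" and XY: "X \<in> young_ix (CARD('n) - 2)" "Y \<in> young_ix (CARD('n) - 2)"
  then show "(\<Sum>Z\<in>young_ix (CARD('n) - 2). rep_endo x c K X Z * frame_change (taut_transition c d K) Z Y) =
      (\<Sum>Z\<in>young_ix (CARD('n) - 2). frame_change (taut_transition c d K) X Z * rep_endo x d K Z Y)"
    using quiver_rep_equivariant[OF assms XY, of "taut_transition c d K" "chart_mat d K"]
      chart_mat_transition[of K c d] by (simp add: rep_endo_def)
next
  fix c :: "'n \<times> 'n" and K :: "('a ^ 'n) set" and X Y assume nz: "rep_endo x c K X Y \<noteq> 0"
  then show "K \<in> chart c" by (auto simp: rep_endo_def split: if_splits)
  show "X \<in> young_ix (CARD('n) - 2)" "Y \<in> young_ix (CARD('n) - 2)"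
    using nz quiver_rep_off_ix[of X Y "chart_mat c K" x] by (auto simp: rep_endo_def split: if_splits)
qed

lemma rep_endo_surj:
  fixes \<phi> :: "('a::field_char_0, 'n::finite, (nat \<times> nat) \<times> nat) local_matrices"
  assumes \<phi>: "\<phi> \<in> bundle_endos tilting_bundle" and n: "CARD('n) \<ge> 4"
  obtains x where "x \<in> carrier TP" "rep_endo x = \<phi>"
proof -
  obtain Q where Q: "\<And>X Y. (\<lambda>M. Q M X Y) \<in> poly_funs" "\<And>M. ix_supported (CARD('n) - 2) (Q M)"
    "\<And>p q r s M. gl2_det (mat2 p q r s) \<noteq> 0 \<Longrightarrow>
      ix_mult (CARD('n) - 2) (Q (gl2_act (mat2 p q r s) M)) (frame_matrix (CARD('n) - 2) (mat2 p q r s)) =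
      ix_mult (CARD('n) - 2) (frame_matrix (CARD('n) - 2) (mat2 p q r s)) (Q M)"
    and chart: "\<And>c K. K \<in> chart c \<Longrightarrow> Q (chart_mat c K) = \<phi> c K"
    by (rule endo_equivariant_extension[OF assms]) (rule that)
  obtain x :: "('a, 'n) path_element" where x: "x \<in> carrier TP" "\<And>M X Y. quiver_rep M x X Y = Q M X Y"
    by (rule equivariant_family_quiver_rep[OF Q]) (assumption, rule that)
  have "rep_endo x = \<phi>"
    by (intro ext) (simp add: rep_endo_def x(2) chart tilting_endosD(3)[OF \<phi>])
  with x(1) show ?thesis by (rule that)
qed

text \<open>Vanishing at the normalised matrices spreads by equivariance to all matrices with a
  nonzero minor, as the frame matrices are invertible, and from there by density to all
  matrices.\<close>

lemma rep_endo_eq_0_imp_ideal: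
  fixes x :: "('a::field_char_0, 'n::finite) path_element"
  assumes x: "x \<in> carrier TP" and zero: "\<And>c K X Y. rep_endo x c K X Y = 0" and n: "CARD('n) \<ge> 4"
  shows "x \<in> tilting_ideal"
proof (rule quiver_rep_eq_0_imp_ideal[OF x])
  let ?m = "CARD('n) - 2"
  obtain c0 and M0 :: "'n \<times> bool \<Rightarrow> 'a" where M0: "minor c0 M0 \<noteq> 0"
    by (rule exists_minor_nonzero[OF n]) (rule that)
  fix M X Y
  show "quiver_rep M x X Y = 0"
  proof (rule poly_fun_eq_0[OF quiver_rep_poly_funs minor_poly_funs M0])
    fix M :: "'n \<times> bool \<Rightarrow> 'a" assume M: "minor c0 M \<noteq> 0"
    let ?c = c0
    define g where "g = frame_mat ?c M"
    define M' where "M' = chart_mat ?c (ker_mat M)"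
    have act: "gl2_act g M' = M" unfolding g_def M'_def by (rule gl2_act_frame_mat[OF M, symmetric])
    have rep': "quiver_rep M' x Z W = 0" for Z W
      using zero[of ?c "ker_mat M" Z W] ker_mat_chart[OF M] by (simp add: rep_endo_def M'_def)
    have supp: "ix_supported ?m (quiver_rep M x)"
      unfolding ix_supported_def using quiver_rep_off_ix[of _ _ M x] by blast
    have "ix_mult ?m (quiver_rep M x) (frame_matrix ?m g) = (\<lambda>_ _. 0)"
    proof (intro ext)
      fix Z W
      show "ix_mult ?m (quiver_rep M x) (frame_matrix ?m g) Z W = 0"
      proof (cases "Z \<in> young_ix ?m \<and> W \<in> young_ix ?m")
        case True
        then have "ix_mult ?m (quiver_rep M x) (frame_matrix ?m g) Z W =
            (\<Sum>V\<in>young_ix ?m. quiver_rep (gl2_act g M') x Z V * frame_change g V W)"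
          unfolding ix_mult_def act by (intro sum.cong) (auto simp: frame_matrix_def)
        also have "\<dots> = 0" using quiver_rep_equivariant[OF x, of Z W g M'] True by (simp add: rep')
        finally show ?thesis .
      next
        case False
        then show ?thesis
          unfolding ix_mult_def by (intro sum.neutral) (auto simp: frame_matrix_def ix_supportedD[OF supp])
      qed
    qed
    then have "ix_mult ?m (ix_mult ?m (quiver_rep M x) (frame_matrix ?m g)) (frame_matrix ?m (frame_inv ?c M)) = (\<lambda>_ _. 0)"
      by (simp add: ix_mult_def[abs_def])
    then have "quiver_rep M x = (\<lambda>_ _. 0)"
      unfolding ix_mult_assoc frame_matrix_mult g_def frame_mat_inv[OF M] frame_matrix_id(2)[OF supp] .
    then show "quiver_rep M x X Y = 0" by simp
  qed
qed

lemma rep_endo_ideal: "x \<in> tilting_ideal \<Longrightarrow> rep_endo x c K X Y = 0"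
  by (simp add: rep_endo_def quiver_rep_ideal)

lemma rep_endo_add:
  "x \<in> carrier TP \<Longrightarrow> y \<in> carrier TP \<Longrightarrow> rep_endo (\<lambda>\<pi>. x \<pi> + y \<pi>) c K X Y = rep_endo x c K X Y + rep_endo y c K X Y"
  by (simp add: rep_endo_def quiver_rep_add)

lemma rep_endo_diff:
  "x \<in> carrier TP \<Longrightarrow> y \<in> carrier TP \<Longrightarrow> rep_endo (\<lambda>\<pi>. x \<pi> - y \<pi>) c K X Y = rep_endo x c K X Y - rep_endo y c K X Y"
  by (simp add: rep_endo_def quiver_rep_diff)

lemma rep_endo_scale: "rep_endo (\<lambda>\<pi>. s * x \<pi>) c K X Y = s * rep_endo x c K X Y"
  by (simp add: rep_endo_def quiver_rep_scale)

lemma frame_ix_tilting_bundle: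
  "frame_ix (tilting_bundle :: ('a::field, 'n::finite, (nat \<times> nat) \<times> nat) vec_bundle) = young_ix (CARD('n) - 2)"
  by (simp add: tilting_bundle_def direct_sum_bundle_def schur_bundle_def young_ix_def)

lemma rep_endo_mult:
  fixes x y :: "('a::field_char_0, 'n::finite) path_element"
  assumes "x \<in> carrier TP" "y \<in> carrier TP"
  shows "rep_endo (x \<otimes>\<^bsub>TP\<^esub> y) = rep_endo x \<otimes>\<^bsub>End_algebra tilting_bundle\<^esub> rep_endo y"
  by (intro ext) (simp add: rep_endo_def End_algebra_def frame_ix_tilting_bundle quiver_rep_mult[OF assms])

lemma rep_endo_one:
  "rep_endo (\<one>\<^bsub>TP\<^esub> :: ('a::field_char_0, 'n::finite) path_element) = \<one>\<^bsub>End_algebra tilting_bundle\<^esub>"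
  by (intro ext) (auto simp: rep_endo_def End_algebra_def frame_ix_tilting_bundle quiver_rep_one)

theorem theorem3p11:
  assumes "CARD('n::finite) \<ge> 4"
  shows "algebra_isomorphic
           (End_algebra
              (tilting_bundle :: ('a::{alg_closed_field, field_char_0}, 'n,
                                  (nat \<times> nat) \<times> nat) vec_bundle))
           (quotient_algebra tilting_path_algebra
              (Idl\<^bsub>tilting_path_algebra\<^esub>
                 (tilting_relations :: ('a, 'n) path_element set)))"
proof -
  let ?A = "End_algebra (tilting_bundle :: ('a, 'n, (nat \<times> nat) \<times> nat) vec_bundle)"
  let ?P = "TP :: ('a, ('a, 'n) path_element) module"
  let ?I = "tilting_ideal :: ('a, 'n) path_element set"
  let ?B = "quotient_algebra ?P ?I"
  interpret I: ideal ?I ?P by (rule tilting_ideal)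
  have carrier_A: "carrier ?A = bundle_endos tilting_bundle" by (simp add: End_algebra_def)
  have B: "carrier ?B = a_rcosets\<^bsub>?P\<^esub> ?I" "mult ?B = rcoset_mult ?P ?I" "one ?B = ?I +>\<^bsub>?P\<^esub> \<one>\<^bsub>?P\<^esub>"
    "add ?B = set_add ?P" "s \<odot>\<^bsub>?B\<^esub> X = (\<Union>x\<in>X. ?I +>\<^bsub>?P\<^esub> (s \<odot>\<^bsub>?P\<^esub> x))" for s X
    by (simp_all add: quotient_algebra_def ring.defs module.defs FactRing_def)
  \<comment> \<open>The isomorphism sends an endomorphism to the set of all path algebra elements
    that represent it; such a fibre is a coset of the kernel.\<close>
  define h where "h \<phi> = {x \<in> carrier ?P. rep_endo x = \<phi>}" for \<phi>
  have eq_iff: "rep_endo x = rep_endo y \<longleftrightarrow> (\<lambda>\<pi>. x \<pi> - y \<pi>) \<in> ?I" if x: "x \<in> carrier ?P" and y: "y \<in> carrier ?P" for x y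
  proof
    assume eq: "rep_endo x = rep_endo y"
    have "(\<lambda>\<pi>. x \<pi> - y \<pi>) \<in> carrier ?P"
      using I.minus_closed[OF x y] by (simp add: TQ.path_minus x y)
    then show "(\<lambda>\<pi>. x \<pi> - y \<pi>) \<in> ?I"
      by (rule rep_endo_eq_0_imp_ideal[OF _ _ assms]) (simp add: rep_endo_diff x y eq)
  next
    assume "(\<lambda>\<pi>. x \<pi> - y \<pi>) \<in> ?I"
    from rep_endo_ideal[OF this] show "rep_endo x = rep_endo y"
      by (intro ext) (simp add: rep_endo_diff x y)
  qed
  have coset: "h (rep_endo x) = ?I +>\<^bsub>?P\<^esub> x" if x: "x \<in> carrier ?P" for x
  proof (intro equalityI subsetI)
    fix y assume "y \<in> h (rep_endo x)"
    then have y: "y \<in> carrier ?P" "rep_endo y = rep_endo x" by (simp_all add: h_def)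
    then have "(\<lambda>\<pi>. y \<pi> - x \<pi>) \<in> ?I" using eq_iff x by blast
    moreover have "y = (\<lambda>\<pi>. y \<pi> - x \<pi>) \<oplus>\<^bsub>?P\<^esub> x" by (simp add: TQ.path_add)
    ultimately show "y \<in> ?I +>\<^bsub>?P\<^esub> x" unfolding a_r_coset_def' by blast
  next
    fix y assume "y \<in> ?I +>\<^bsub>?P\<^esub> x"
    then obtain i where i: "i \<in> ?I" and y: "y = i \<oplus>\<^bsub>?P\<^esub> x" unfolding a_r_coset_def' by blast
    have yc: "y \<in> carrier ?P" unfolding y using I.Icarr[OF i] x by simp
    moreover have "(\<lambda>\<pi>. y \<pi> - x \<pi>) = i" unfolding y by (simp add: TQ.path_add)
    then have "rep_endo y = rep_endo x" using eq_iff[OF yc x] i by simp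
    ultimately show "y \<in> h (rep_endo x)" by (simp add: h_def)
  qed
  have surj: "\<exists>x\<in>carrier ?P. rep_endo x = \<phi>" if "\<phi> \<in> carrier ?A" for \<phi>
    using rep_endo_surj[OF that[unfolded carrier_A] assms] by blast
  have h_hom: "h \<in> ring_hom ?A ?B"
  proof (rule ring_hom_memI)
    fix \<phi> assume "\<phi> \<in> carrier ?A"
    then obtain x where x: "x \<in> carrier ?P" and \<phi>: "\<phi> = rep_endo x" using surj by blast
    show "h \<phi> \<in> carrier ?B" unfolding \<phi> coset[OF x] B A_RCOSETS_def' using x by blast
    fix \<psi> assume "\<psi> \<in> carrier ?A"
    then obtain y where y: "y \<in> carrier ?P" and \<psi>: "\<psi> = rep_endo y" using surj by blast
    have "h (rep_endo (x \<otimes>\<^bsub>?P\<^esub> y)) = h \<phi> \<otimes>\<^bsub>?B\<^esub> h \<psi>"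
      unfolding \<phi> \<psi> coset[OF x] coset[OF y] coset[OF I.m_closed[OF x y]] B
      by (rule I.rcoset_mult_add[OF x y, symmetric])
    then show "h (\<phi> \<otimes>\<^bsub>?A\<^esub> \<psi>) = h \<phi> \<otimes>\<^bsub>?B\<^esub> h \<psi>"
      unfolding rep_endo_mult[OF x y] \<phi> \<psi> .
    have add: "rep_endo (x \<oplus>\<^bsub>?P\<^esub> y) = \<phi> \<oplus>\<^bsub>?A\<^esub> \<psi>"
      unfolding \<phi> \<psi> by (intro ext) (simp add: TQ.path_add rep_endo_add x y End_algebra_def)
    have "h (rep_endo (x \<oplus>\<^bsub>?P\<^esub> y)) = h \<phi> \<oplus>\<^bsub>?B\<^esub> h \<psi>"
      unfolding \<phi> \<psi> coset[OF x] coset[OF y] coset[OF I.a_closed[OF x y]] B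
      by (rule I.a_rcos_sum[OF x y, symmetric])
    then show "h (\<phi> \<oplus>\<^bsub>?A\<^esub> \<psi>) = h \<phi> \<oplus>\<^bsub>?B\<^esub> h \<psi>" unfolding add .
  next
    show "h \<one>\<^bsub>?A\<^esub> = \<one>\<^bsub>?B\<^esub>"
      unfolding rep_endo_one[symmetric] coset[OF I.one_closed] B ..
  qed
  have "bij_betw h (carrier ?A) (carrier ?B)"
  proof (rule bij_betw_imageI)
    show "inj_on h (carrier ?A)"
    proof (rule inj_onI)
      fix \<phi> \<psi> assume "\<phi> \<in> carrier ?A" and eq: "h \<phi> = h \<psi>"
      then obtain x where "x \<in> h \<phi>" using surj unfolding h_def by blast
      then show "\<phi> = \<psi>" using eq unfolding h_def by blast
    qed
    show "h ` carrier ?A = carrier ?B"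
    proof (intro equalityI subsetI)
      fix X assume "X \<in> h ` carrier ?A"
      then show "X \<in> carrier ?B" using ring_hom_closed[OF h_hom] by blast
    next
      fix X assume "X \<in> carrier ?B"
      then obtain x where x: "x \<in> carrier ?P" and X: "X = h (rep_endo x)"
        unfolding B A_RCOSETS_def' using coset by blast
      have "rep_endo x \<in> carrier ?A" unfolding carrier_A by (rule rep_endo_closed[OF x])
      then show "X \<in> h ` carrier ?A" unfolding X by (rule imageI)
    qed
  qed
  then have iso: "h \<in> ring_iso ?A ?B" using h_hom by (simp add: ring_iso_def)
  have smult: "h (s \<odot>\<^bsub>?A\<^esub> \<phi>) = s \<odot>\<^bsub>?B\<^esub> h \<phi>" if \<phi>_in: "\<phi> \<in> carrier ?A" for s \<phi>
  proof -
    obtain x where x: "x \<in> carrier ?P" and \<phi>: "rep_endo x = \<phi>" using surj[OF \<phi>_in] by blast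
    \<comment> \<open>Scalar multiplication on the quotient is a union over representatives; all of
      them give the same coset, and there is at least one.\<close>
    have "?I +>\<^bsub>?P\<^esub> (s \<odot>\<^bsub>?P\<^esub> y) = h (s \<odot>\<^bsub>?A\<^esub> \<phi>)" if "y \<in> h \<phi>" for y
    proof -
      have y: "y \<in> carrier ?P" "rep_endo y = \<phi>" using that by (simp_all add: h_def)
      have sy: "s \<odot>\<^bsub>?P\<^esub> y \<in> carrier ?P" unfolding TQ.path_smult by (rule TQ.path_scale_closed[OF y(1)])
      have "rep_endo (s \<odot>\<^bsub>?P\<^esub> y) = s \<odot>\<^bsub>?A\<^esub> \<phi>"
        by (intro ext) (simp add: TQ.path_smult rep_endo_scale End_algebra_def flip: y(2))
      then show ?thesis using coset[OF sy] by simp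
    qed
    moreover have "x \<in> h \<phi>" using x \<phi> by (simp add: h_def)
    ultimately show ?thesis unfolding B by blast
  qed
  have "algebra_isomorphic ?A ?B"
    unfolding algebra_isomorphic_def by (rule bexI[OF _ iso]) (use smult in blast)
  then show ?thesis unfolding tilting_ideal_def tilting_path_algebra_def .
qed

end
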